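(* Let $\mathbf{P}\subseteq\mathbb{N}$. The following conditions are equivalent, and they imply that Problem 4 for $\mathbf{P}$ is computable: (1) $\mathbf{P}$ is ultimately periodic (there are $0<p$ and $d\in\mathbb{N}$ with $n\in\mathbf{P}\leftrightarrow n+p\in\mathbf{P}$ for all $n>d$). (2) For every MLO formula $\psi(X,Y,P)$, either there is a finite state C-operator $F$ such that $\langle\mathbb{N},<\rangle\models\forall X\,\psi(X,F(X,\mathbf{P}),\mathbf{P})$, or there is a finite state C-operator $G$ such that $\langle\mathbb{N},<\rangle\models\forall Y\,\neg\psi(G(Y,\mathbf{P}),Y,\mathbf{P})$. (3) (Selection condition) For every MLO formula $\alpha(X,P)$ such that $\langle\mathbb{N},<\rangle\models\exists X\,\alpha(X,\mathbf{P})$, there is a finite state C-operator $H:\{0,1\}^\omega\to\{0,1\}^\omega$ such that $\langle\mathbb{N},<\rangle\models\alpha(H(\mathbf{P}),\mathbf{P})$.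
   Context: MLO is monadic second-order logic over $<$ and unary predicate symbols, interpreted over $\mathbb{N}$ with set variables ranging over subsets of $\mathbb{N}$, identified with $\omega$-strings over $\{0,1\}$. An operator of two arguments $F(X,P)$ is viewed as an operator on $\omega$-strings over $\{0,1\}^2$. An operator $F:\Sigma_1^\omega\to\Sigma_2^\omega$ is causal (C-operator) if whenever inputs coincide on $[0,t]$ the outputs coincide on $[0,t]$. A C-operator is finite state if there are a finite set $Q$, $q_{init}\in Q$, $\delta:Q\times\Sigma_1\to Q$ (extended to strings) and $out:Q\times\Sigma_1\to\Sigma_2$ such that the $i$-th output letter on input $a_0a_1\dots$ is $out(\delta(q_{init},a_0\dots a_{i-1}),a_i)$. Problem 4 for $\mathbf{P}$: given an MLO formula $\psi(X,Y,P)$, decide whether there is a finite state C-operator $Y=F(X,P)$ with $\langle\mathbb{N},<\rangle\models\forall X\,\psi(X,F(X,\mathbf{P}),\mathbf{P})$, and if so construct it; computable means some algorithm does this for all inputs. *)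

theory Defs
  imports Complex_Main "HOL-Library.Nat_Bijection"
begin

section \<open>Monadic second-order logic of order over the natural numbers\<close>

text \<open>First-order and set variables are both named by natural numbers, in two separate name spaces.
  A unary predicate symbol is a free set variable. The remaining connectives and the universal
  quantifiers are the usual abbreviations.\<close>

datatype mlo =
    Less nat nat
  | Eq nat nat
  | Mem nat nat  \<comment> \<open>first-order variable, then set variable\<close>
  | Neg mlo
  | Disj mlo mlo
  | Ex1 nat mlo
  | Ex2 nat mlo

primrec sat :: "(nat \<Rightarrow> nat) \<Rightarrow> (nat \<Rightarrow> nat set) \<Rightarrow> mlo \<Rightarrow> bool" where
  "sat e E (Less x y) \<longleftrightarrow> e x < e y"
| "sat e E (Eq x y) \<longleftrightarrow> e x = e y"
| "sat e E (Mem x V) \<longleftrightarrow> e x \<in> E V"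
| "sat e E (Neg \<phi>) \<longleftrightarrow> \<not> sat e E \<phi>"
| "sat e E (Disj \<phi> \<psi>) \<longleftrightarrow> sat e E \<phi> \<or> sat e E \<psi>"
| "sat e E (Ex1 x \<phi>) \<longleftrightarrow> (\<exists>n. sat (e(x := n)) E \<phi>)"
| "sat e E (Ex2 V \<phi>) \<longleftrightarrow> (\<exists>S. sat e (E(V := S)) \<phi>)"

primrec free1 :: "mlo \<Rightarrow> nat set" where
  "free1 (Less x y) = {x, y}"
| "free1 (Eq x y) = {x, y}"
| "free1 (Mem x V) = {x}"
| "free1 (Neg \<phi>) = free1 \<phi>"
| "free1 (Disj \<phi> \<psi>) = free1 \<phi> \<union> free1 \<psi>"
| "free1 (Ex1 x \<phi>) = free1 \<phi> - {x}"
| "free1 (Ex2 V \<phi>) = free1 \<phi>"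

primrec free2 :: "mlo \<Rightarrow> nat set" where
  "free2 (Less x y) = {}"
| "free2 (Eq x y) = {}"
| "free2 (Mem x V) = {V}"
| "free2 (Neg \<phi>) = free2 \<phi>"
| "free2 (Disj \<phi> \<psi>) = free2 \<phi> \<union> free2 \<psi>"
| "free2 (Ex1 x \<phi>) = free2 \<phi>"
| "free2 (Ex2 V \<phi>) = free2 \<phi> - {V}"

text \<open>The distinguished set variables \<open>X\<close>, \<open>Y\<close>, \<open>P\<close> are the set variables 0, 1 and 2.\<close>

definition formula_XYP :: "mlo \<Rightarrow> bool" where
  "formula_XYP \<psi> \<longleftrightarrow> free1 \<psi> = {} \<and> free2 \<psi> \<subseteq> {0, 1, 2}"

definition formula_XP :: "mlo \<Rightarrow> bool" where
  "formula_XP \<alpha> \<longleftrightarrow> free1 \<alpha> = {} \<and> free2 \<alpha> \<subseteq> {0, 2}"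

text \<open>The values chosen for variables other than the distinguished ones are irrelevant, as they
  do not occur free.\<close>

definition holds_XYP :: "mlo \<Rightarrow> nat set \<Rightarrow> nat set \<Rightarrow> nat set \<Rightarrow> bool" where
  "holds_XYP \<psi> X Y P \<longleftrightarrow> sat (\<lambda>_. 0) ((\<lambda>_. {})(0 := X, 1 := Y, 2 := P)) \<psi>"

definition holds_XP :: "mlo \<Rightarrow> nat set \<Rightarrow> nat set \<Rightarrow> bool" where
  "holds_XP \<alpha> X P \<longleftrightarrow> sat (\<lambda>_. 0) ((\<lambda>_. {})(0 := X, 2 := P)) \<alpha>"


section \<open>Causal and finite state operators\<close>

text \<open>An \<open>\<omega>\<close>-string over an alphabet \<open>'a\<close> is a function of type \<open>nat \<Rightarrow> 'a\<close>.\<close>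

definition causal :: "((nat \<Rightarrow> 'a) \<Rightarrow> (nat \<Rightarrow> 'b)) \<Rightarrow> bool" where
  "causal F \<longleftrightarrow> (\<forall>x y t. (\<forall>i\<le>t. x i = y i) \<longrightarrow> (\<forall>i\<le>t. F x i = F y i))"

definition transition_system :: "'q set \<Rightarrow> 'q \<Rightarrow> ('q \<Rightarrow> 'a \<Rightarrow> 'q) \<Rightarrow> bool" where
  "transition_system Q q\<^sub>0 \<delta> \<longleftrightarrow> finite Q \<and> q\<^sub>0 \<in> Q \<and> (\<forall>q\<in>Q. \<forall>a. \<delta> q a \<in> Q)"

definition machine_op ::
    "'q \<Rightarrow> ('q \<Rightarrow> 'a \<Rightarrow> 'q) \<Rightarrow> ('q \<Rightarrow> 'a \<Rightarrow> 'b) \<Rightarrow> (nat \<Rightarrow> 'a) \<Rightarrow> (nat \<Rightarrow> 'b)" where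
  "machine_op q\<^sub>0 \<delta> out x = (\<lambda>i. out (foldl \<delta> q\<^sub>0 (map x [0..<i])) (x i))"

text \<open>States are natural numbers, which is no restriction since the set of states is finite.\<close>

definition finite_state_C_operator :: "((nat \<Rightarrow> 'a) \<Rightarrow> (nat \<Rightarrow> 'b)) \<Rightarrow> bool" where
  "finite_state_C_operator F \<longleftrightarrow> causal F \<and>
     (\<exists>(Q :: nat set) q\<^sub>0 \<delta> out. transition_system Q q\<^sub>0 \<delta> \<and> F = machine_op q\<^sub>0 \<delta> out)"

text \<open>The identification of subsets of the natural numbers with \<open>\<omega>\<close>-strings over \<open>bool\<close>.\<close>

definition apply_op1 :: "((nat \<Rightarrow> bool) \<Rightarrow> (nat \<Rightarrow> bool)) \<Rightarrow> nat set \<Rightarrow> nat set" where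
  "apply_op1 H P = {i. H (\<lambda>n. n \<in> P) i}"

definition apply_op2 ::
    "((nat \<Rightarrow> bool \<times> bool) \<Rightarrow> (nat \<Rightarrow> bool)) \<Rightarrow> nat set \<Rightarrow> nat set \<Rightarrow> nat set" where
  "apply_op2 F X P = {i. F (\<lambda>n. (n \<in> X, n \<in> P)) i}"


section \<open>The conditions\<close>

definition ultimately_periodic :: "nat set \<Rightarrow> bool" where
  "ultimately_periodic P \<longleftrightarrow> (\<exists>p d. 0 < p \<and> (\<forall>n>d. n \<in> P \<longleftrightarrow> n + p \<in> P))"

definition finite_state_determinacy :: "nat set \<Rightarrow> bool" where
  "finite_state_determinacy P \<longleftrightarrow> (\<forall>\<psi>. formula_XYP \<psi> \<longrightarrow>
     (\<exists>F. finite_state_C_operator F \<and> (\<forall>X. holds_XYP \<psi> X (apply_op2 F X P) P)) \<or>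
     (\<exists>G. finite_state_C_operator G \<and> (\<forall>Y. \<not> holds_XYP \<psi> (apply_op2 G Y P) Y P)))"

definition selection_condition :: "nat set \<Rightarrow> bool" where
  "selection_condition P \<longleftrightarrow> (\<forall>\<alpha>. formula_XP \<alpha> \<longrightarrow> (\<exists>X. holds_XP \<alpha> X P) \<longrightarrow>
     (\<exists>H. finite_state_C_operator H \<and> holds_XP \<alpha> (apply_op1 H P) P))"


section \<open>Computability\<close>

text \<open>The total recursive functions of a given arity (first argument), as the least class closed
  under composition, primitive recursion and minimisation of regular functions. A function is
  meaningful only on argument lists whose length is the arity.\<close>

inductive recursive :: "nat \<Rightarrow> (nat list \<Rightarrow> nat) \<Rightarrow> bool" where
  zero: "recursive n (\<lambda>_. 0)"
| succ: "recursive 1 (\<lambda>xs. Suc (xs ! 0))"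
| proj: "i < n \<Longrightarrow> recursive n (\<lambda>xs. xs ! i)"
| comp: "recursive (length gs) f \<Longrightarrow> (\<forall>g\<in>set gs. recursive n g) \<Longrightarrow>
    recursive n (\<lambda>xs. f (map (\<lambda>g. g xs) gs))"
| prim_rec: "recursive n f \<Longrightarrow> recursive (Suc (Suc n)) g \<Longrightarrow>
    recursive (Suc n) (\<lambda>xs. rec_nat (f (tl xs)) (\<lambda>k r. g (k # r # tl xs)) (hd xs))"
| minim: "recursive (Suc n) f \<Longrightarrow> (\<forall>xs. length xs = n \<longrightarrow> (\<exists>y. f (y # xs) = 0)) \<Longrightarrow>
    recursive n (\<lambda>xs. LEAST y. f (y # xs) = 0)"

definition computable :: "(nat \<Rightarrow> nat) \<Rightarrow> bool" where
  "computable f \<longleftrightarrow> (\<exists>g. recursive 1 g \<and> (\<forall>x. g [x] = f x))"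

primrec code_mlo :: "mlo \<Rightarrow> nat" where
  "code_mlo (Less x y) = prod_encode (0, prod_encode (x, y))"
| "code_mlo (Eq x y) = prod_encode (1, prod_encode (x, y))"
| "code_mlo (Mem x V) = prod_encode (2, prod_encode (x, V))"
| "code_mlo (Neg \<phi>) = prod_encode (3, code_mlo \<phi>)"
| "code_mlo (Disj \<phi> \<psi>) = prod_encode (4, prod_encode (code_mlo \<phi>, code_mlo \<psi>))"
| "code_mlo (Ex1 x \<phi>) = prod_encode (5, prod_encode (x, code_mlo \<phi>))"
| "code_mlo (Ex2 V \<phi>) = prod_encode (6, prod_encode (V, code_mlo \<phi>))"

lemma inj_code_mlo: "inj code_mlo"
proof (rule injI)
  show "code_mlo \<phi> = code_mlo \<psi> \<Longrightarrow> \<phi> = \<psi>" for \<phi> \<psi>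
    by (induction \<phi> arbitrary: \<psi>; case_tac \<psi>) auto
qed

text \<open>Code of the machine with states \<open>{..<n}\<close>: the initial state and the table of successor states
  and output letters, four entries per state.\<close>

definition code_machine ::
    "nat \<Rightarrow> nat \<Rightarrow> (nat \<Rightarrow> bool \<times> bool \<Rightarrow> nat) \<Rightarrow> (nat \<Rightarrow> bool \<times> bool \<Rightarrow> bool) \<Rightarrow> nat" where
  "code_machine n q\<^sub>0 \<delta> out = prod_encode (q\<^sub>0, list_encode
     (concat (map (\<lambda>q. map (\<lambda>a. prod_encode (\<delta> q a, of_bool (out q a)))
        [(False, False), (False, True), (True, False), (True, True)]) [0..<n])))"

lemma code_machine_eqD:
  assumes "code_machine n q\<^sub>0 \<delta> out = code_machine n' q\<^sub>0' \<delta>' out'"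
  shows "n = n' \<and> q\<^sub>0 = q\<^sub>0' \<and> (\<forall>q<n. \<forall>a. \<delta> q a = \<delta>' q a \<and> out q a = out' q a)"
proof -
  define row where "row \<delta> out q = map (\<lambda>a. prod_encode (\<delta> q a, of_bool (out q a)))
    [(False, False), (False, True), (True, False), (True, True)]"
    for \<delta> :: "nat \<Rightarrow> bool \<times> bool \<Rightarrow> nat" and out :: "nat \<Rightarrow> bool \<times> bool \<Rightarrow> bool" and q
  have len: "length (concat (map (row \<delta> out) [0..<n])) = 4 * n" for \<delta> out n
    by (induction n) (auto simp: row_def)
  from assms have q: "q\<^sub>0 = q\<^sub>0'"
    and tab: "concat (map (row \<delta> out) [0..<n]) = concat (map (row \<delta>' out') [0..<n'])"
    by (simp_all add: code_machine_def row_def [abs_def] list_encode_eq)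
  have n: "n = n'"
    using arg_cong [OF tab, of length] by (simp only: len)
  have "map (row \<delta> out) [0..<n] = map (row \<delta>' out') [0..<n]"
    using tab unfolding n
    by (rule concat_injective) (auto simp: row_def set_zip)
  then have "row \<delta> out q = row \<delta>' out' q" if "q < n" for q
    using that by auto
  then have "\<delta> q a = \<delta>' q a \<and> out q a = out' q a" if "q < n" for q a
    using that by (cases a; cases "fst a"; cases "snd a") (auto simp: row_def of_bool_eq_iff)
  with q n show ?thesis
    by blast
qed

text \<open>The algorithm answers 0 if there is no solution, and the successor of the code of a machine
  computing a solution otherwise.\<close>

definition problem4_computable :: "nat set \<Rightarrow> bool" where
  "problem4_computable P \<longleftrightarrow> (\<exists>f. computable f \<and> (\<forall>\<psi>. formula_XYP \<psi> \<longrightarrow>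
     (if \<exists>F. finite_state_C_operator F \<and> (\<forall>X. holds_XYP \<psi> X (apply_op2 F X P) P)
      then \<exists>n q\<^sub>0 \<delta> out. f (code_mlo \<psi>) = Suc (code_machine n q\<^sub>0 \<delta> out) \<and>
             transition_system {..<n} q\<^sub>0 \<delta> \<and>
             (\<forall>X. holds_XYP \<psi> X (apply_op2 (machine_op q\<^sub>0 \<delta> out) X P) P)
      else f (code_mlo \<psi>) = 0)))"

end

theory Submission
  imports Defs "HOL-Library.Ramsey"
begin

text \<open>
  Each formula assigns to every finite word one of finitely many types (Shelah's composition method),
  compatible with concatenation, and a factorisation of an \<open>\<omega>\<close>-word into factors of
  given types decides the formula. By Ramsey's theorem and pigeonhole a satisfiable formula with
  ultimately periodic parameters has an ultimately periodic witness of bounded size; this gives the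
  selection condition and makes truth at ultimately periodic words decidable.

  For determinacy, a deterministic automaton keeps the types of the factors between finitely many
  marked positions, dropping a mark once an earlier one yields the same type up to the present; the marks
  dropped at the least index at which this happens infinitely often decide the formula. The
  resulting parity game, with the parameter built in, is reduced to the finite game that stops when a
  vertex repeats: its winner wins the infinite game with the current simple path as memory.

  The algorithm searches for a machine winning for either player, together with a finite set of
  claims about truth at small ultimately periodic words that justify one another and certify the
  machine. Conversely, either condition, applied to the formula saying that a set is the left shift of
  \<open>P\<close>, yields a finite machine predicting the next bit of \<open>P\<close>.
\<close>

section \<open>Satisfaction in words\<close>

text \<open>First-order variables occupy columns like set variables. Satisfaction makes sense in
  every word, and only \<open>Ex1\<close> insists on a singleton, so all cases can be cut into
  factors in the same way.

  The two alternatives of the determinacy condition do not exclude each other: for the formula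
  \<open>X = Y\<close> the identity serves as F and negation as G. A machine for the second
  alternative therefore does not show that the first one fails, and the algorithm could not answer 0
  on its strength. For this reason the game lets X move before Y. The machine obtained for X does
  not read the present letter of Y, so it can be run against any machine for Y, and its existence
  refutes all of them.

  Computability concerns a bare class of functions on numbers. Evaluating formulas by recursion on
  their codes, with words growing at each quantifier, would not fit primitive recursion directly.
  Checking a guessed certificate needs only bounded quantifiers, and determinacy guarantees that the
  unbounded search for one ends.\<close>

definition off :: "nat \<Rightarrow> (nat \<Rightarrow> bool) \<Rightarrow> (nat \<Rightarrow> bool) \<Rightarrow> bool" where
  "off z a b \<longleftrightarrow> (\<forall>y. y \<noteq> z \<longrightarrow> a y = b y)"

text \<open>Both conjuncts are existential statements about positions and their order. This is how
  types of factors control uniqueness, and how \<open>guard\<close> later states uniqueness by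
  \<open>Eq x x\<close> and \<open>Less x x\<close>.\<close>

lemma ex1_nat_iff: "(\<exists>!n::nat. Q n) \<longleftrightarrow> (\<exists>n. Q n) \<and> \<not> (\<exists>i j. i < j \<and> Q i \<and> Q j)"
proof (intro iffI conjI notI)
  assume "(\<exists>n. Q n) \<and> \<not> (\<exists>i j. i < j \<and> Q i \<and> Q j)"
  then obtain n where n: "Q n" "\<And>i j. i < j \<Longrightarrow> Q i \<Longrightarrow> Q j \<Longrightarrow> False" by blast
  show "\<exists>!n. Q n"
  proof (rule ex1I[of _ n])
    fix m assume "Q m"
    then show "m = n" using n(1) n(2)[of m n] n(2)[of n m] by (cases m n rule: linorder_cases) blast+
  qed (rule n(1))
qed auto

text \<open>In a word, column \<open>2x\<close> holds the first-order variable \<open>x\<close> and column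
  \<open>2V+1\<close> the set variable \<open>V\<close>, so that \<open>X\<close>, \<open>Y\<close>, \<open>P\<close> are the columns 1, 3, 5.\<close>

primrec wsat :: "mlo \<Rightarrow> (nat \<Rightarrow> nat \<Rightarrow> bool) \<Rightarrow> bool" where
  "wsat (Less x y) W \<longleftrightarrow> (\<exists>i j. i < j \<and> W i (2*x) \<and> W j (2*y))"
| "wsat (Eq x y) W \<longleftrightarrow> (\<exists>i. W i (2*x) \<and> W i (2*y))"
| "wsat (Mem x V) W \<longleftrightarrow> (\<exists>i. W i (2*x) \<and> W i (2*V+1))"
| "wsat (Neg \<phi>) W \<longleftrightarrow> \<not> wsat \<phi> W"
| "wsat (Disj \<phi> \<psi>) W \<longleftrightarrow> wsat \<phi> W \<or> wsat \<psi> W"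
| "wsat (Ex1 x \<phi>) W \<longleftrightarrow>
    (\<exists>W'. (\<forall>n. off (2*x) (W n) (W' n)) \<and> (\<exists>!n. W' n (2*x)) \<and> wsat \<phi> W')"
| "wsat (Ex2 V \<phi>) W \<longleftrightarrow> (\<exists>W'. (\<forall>n. off (2*V+1) (W n) (W' n)) \<and> wsat \<phi> W')"

definition set_col :: "nat \<Rightarrow> nat set \<Rightarrow> (nat \<Rightarrow> nat \<Rightarrow> bool) \<Rightarrow> nat \<Rightarrow> nat \<Rightarrow> bool" where
  "set_col z S W = (\<lambda>i y. if y = z then i \<in> S else W i y)"

lemma off_iff_set_col: "(\<forall>n. off z (W n) (W' n)) \<longleftrightarrow> W' = set_col z {n. W' n z} W"
  by (auto simp: off_def set_col_def fun_eq_iff)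

lemma off_set_col: "\<forall>n. off z (W n) (set_col z S W n)"
  by (simp add: off_def set_col_def)

lemma wsat_Ex2: "wsat (Ex2 V \<phi>) W \<longleftrightarrow> (\<exists>S. wsat \<phi> (set_col (2*V+1) S W))"
  unfolding wsat.simps using off_set_col off_iff_set_col by metis

lemma wsat_Ex1: "wsat (Ex1 x \<phi>) W \<longleftrightarrow> (\<exists>n. wsat \<phi> (set_col (2*x) {n} W))"
proof
  assume "wsat (Ex1 x \<phi>) W"
  then obtain W' n where W': "W' = set_col (2*x) {m. W' m (2*x)} W" "{m. W' m (2*x)} = {n}" "wsat \<phi> W'"
    unfolding wsat.simps off_iff_set_col by blast
  then show "\<exists>n. wsat \<phi> (set_col (2*x) {n} W)" by metis
next
  assume "\<exists>n. wsat \<phi> (set_col (2*x) {n} W)"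
  then obtain n where "wsat \<phi> (set_col (2*x) {n} W)" by blast
  moreover have "\<exists>!m. set_col (2*x) {n} W m (2*x)" by (simp add: set_col_def)
  ultimately show "wsat (Ex1 x \<phi>) W" unfolding wsat.simps using off_set_col by blast
qed

definition env_word :: "(nat \<Rightarrow> nat) \<Rightarrow> (nat \<Rightarrow> nat set) \<Rightarrow> nat \<Rightarrow> nat \<Rightarrow> bool" where
  "env_word e E i z \<longleftrightarrow> (if even z then e (z div 2) = i else i \<in> E (z div 2))"

lemma env_word_upd:
  "env_word (e(x := n)) E = set_col (2*x) {n} (env_word e E)"
  "env_word e (E(V := S)) = set_col (2*V+1) S (env_word e E)"
  by (auto simp: env_word_def set_col_def fun_eq_iff elim!: oddE)

lemma sat_eq_wsat: "sat e E \<phi> \<longleftrightarrow> wsat \<phi> (env_word e E)"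
  by (induction \<phi> arbitrary: e E)
    (auto simp: wsat_Ex1 wsat_Ex2 env_word_upd env_word_def simp del: wsat.simps(6,7) fun_upd_apply)

definition vars :: "mlo \<Rightarrow> nat set" where
  "vars \<phi> = (\<lambda>x. 2*x) ` free1 \<phi> \<union> (\<lambda>V. 2*V+1) ` free2 \<phi>"

lemma vars_simps:
  "vars (Less x y) = {2*x, 2*y}" "vars (Eq x y) = {2*x, 2*y}" "vars (Mem x V) = {2*x, 2*V+1}"
  "vars (Neg \<phi>) = vars \<phi>" "vars (Disj \<phi> \<psi>) = vars \<phi> \<union> vars \<psi>"
  "vars (Ex1 x \<phi>) = vars \<phi> - {2*x}" "vars (Ex2 V \<phi>) = vars \<phi> - {2*V+1}"
proof -
  have *: "2 * a \<noteq> Suc (2 * b)" "Suc (2 * b) \<noteq> 2 * a" for a b :: nat by presburger+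
  show "vars (Ex1 x \<phi>) = vars \<phi> - {2*x}" "vars (Ex2 V \<phi>) = vars \<phi> - {2*V+1}"
    using * by (auto simp: vars_def)
qed (auto simp: vars_def)

lemma wsat_cong:
  assumes "\<And>n z. z \<in> vars \<phi> \<Longrightarrow> W n z = W' n z"
  shows "wsat \<phi> W \<longleftrightarrow> wsat \<phi> W'"
  using assms
proof (induction \<phi> arbitrary: W W')
  case (Disj \<phi> \<psi>)
  have "wsat \<phi> W = wsat \<phi> W'" by (rule Disj.IH(1)) (use Disj.prems in \<open>simp add: vars_simps\<close>)
  moreover have "wsat \<psi> W = wsat \<psi> W'" by (rule Disj.IH(2)) (use Disj.prems in \<open>simp add: vars_simps\<close>)
  ultimately show ?case by simp
next
  case (Ex1 x \<phi>)
  have "wsat \<phi> (set_col (2*x) S W) = wsat \<phi> (set_col (2*x) S W')" for S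
    by (rule Ex1.IH) (use Ex1.prems in \<open>simp add: set_col_def vars_simps\<close>)
  then show ?case by (simp only: wsat_Ex1)
next
  case (Ex2 x \<phi>)
  have "wsat \<phi> (set_col (2*x+1) S W) = wsat \<phi> (set_col (2*x+1) S W')" for S
    by (rule Ex2.IH) (use Ex2.prems in \<open>simp add: set_col_def vars_simps\<close>)
  then show ?case by (simp only: wsat_Ex2)
next
  case (Neg \<phi>)
  have "wsat \<phi> W = wsat \<phi> W'" by (rule Neg.IH) (use Neg.prems in \<open>simp add: vars_simps\<close>)
  then show ?case by simp
qed (simp_all add: vars_simps)

section \<open>Types of words and lassos\<close>

fun precedes :: "nat \<Rightarrow> nat \<Rightarrow> (nat \<Rightarrow> bool) list \<Rightarrow> bool" where
  "precedes x y [] \<longleftrightarrow> False"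
| "precedes x y (a # u) \<longleftrightarrow> a x \<and> (\<exists>b\<in>set u. b y) \<or> precedes x y u"

lemma precedes_append:
  "precedes x y (u @ v) \<longleftrightarrow>
    precedes x y u \<or> precedes x y v \<or> (\<exists>a\<in>set u. a x) \<and> (\<exists>b\<in>set v. b y)"
  by (induction u) auto

lemma precedes_upt:
  "precedes x y (map W [a..<b]) \<longleftrightarrow> (\<exists>i j. a \<le> i \<and> i < j \<and> j < b \<and> W i x \<and> W j y)"
proof (induction b)
  case (Suc b)
  show ?case
  proof (cases "a \<le> b")
    case True
    have "(\<exists>i j. a \<le> i \<and> i < j \<and> j < Suc b \<and> W i x \<and> W j y) \<longleftrightarrow>
        (\<exists>i j. a \<le> i \<and> i < j \<and> j < b \<and> W i x \<and> W j y) \<or> (\<exists>i. a \<le> i \<and> i < b \<and> W i x \<and> W b y)"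
      unfolding less_Suc_eq[of _ b] by blast
    moreover have "precedes x y (map W [a..<Suc b]) \<longleftrightarrow>
        precedes x y (map W [a..<b]) \<or> (\<exists>i. a \<le> i \<and> i < b \<and> W i x \<and> W b y)"
      using True by (auto simp: precedes_append)
    ultimately show ?thesis using Suc by simp
  qed auto
qed simp

text \<open>The three bits are what \<open>precedes_append\<close> asks for: precedence in a
  concatenation depends on precedence inside the factors and on mere occurrence in them.\<close>

definition order_type :: "nat \<Rightarrow> nat \<Rightarrow> (nat \<Rightarrow> bool) list \<Rightarrow> nat" where
  "order_type x y u = of_bool (\<exists>a\<in>set u. a x) + 2 * of_bool (\<exists>a\<in>set u. a y) + 4 * of_bool (precedes x y u)"

text \<open>The second component in the case of \<open>Ex1\<close> tells whether the variable occurs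
  exactly once.\<close>

primrec ty :: "mlo \<Rightarrow> (nat \<Rightarrow> bool) list \<Rightarrow> nat" where
  "ty (Less x y) u = order_type (2*x) (2*y) u"
| "ty (Eq x y) u = of_bool (\<exists>a\<in>set u. a (2*x) \<and> a (2*y))"
| "ty (Mem x V) u = of_bool (\<exists>a\<in>set u. a (2*x) \<and> a (2*V+1))"
| "ty (Neg \<phi>) u = ty \<phi> u"
| "ty (Disj \<phi> \<psi>) u = prod_encode (ty \<phi> u, ty \<psi> u)"
| "ty (Ex1 x \<phi>) u = set_encode
     ((\<lambda>w. prod_encode (ty \<phi> w, order_type (2*x) (2*x) w)) ` {w. list_all2 (off (2*x)) u w})"
| "ty (Ex2 V \<phi>) u = set_encode (ty \<phi> ` {w. list_all2 (off (2*V+1)) u w})"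

text \<open>Mere finiteness of the set of types would suffice for determinacy; an explicit bound is
  needed because it enters, through \<open>tower\<close>, the search bounds that the algorithm
  computes.\<close>

primrec ty_bound :: "mlo \<Rightarrow> nat" where
  "ty_bound (Less x y) = 8"
| "ty_bound (Eq x y) = 2"
| "ty_bound (Mem x V) = 2"
| "ty_bound (Neg \<phi>) = ty_bound \<phi>"
| "ty_bound (Disj \<phi> \<psi>) = prod_encode (ty_bound \<phi>, ty_bound \<psi>)"
| "ty_bound (Ex1 x \<phi>) = 2 ^ prod_encode (ty_bound \<phi>, 8)"
| "ty_bound (Ex2 V \<phi>) = 2 ^ ty_bound \<phi>"

lemma triangle_mono: "a \<le> b \<Longrightarrow> triangle a \<le> triangle b"
  by (rule lift_Suc_mono_le) simp_all

lemma prod_encode_strict_mono: "a < c \<Longrightarrow> b < d \<Longrightarrow> prod_encode (a, b) < prod_encode (c, d)"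
proof -
  assume *: "a < c" "b < d"
  have "triangle (a + b) \<le> triangle (c + d)"
    by (rule triangle_mono) (use * in simp)
  then show ?thesis using * by (simp add: prod_encode_def)
qed

lemma set_encode_less:
  assumes "A \<subseteq> {..<n}" shows "set_encode A < 2 ^ n"
proof -
  have "set_encode A \<le> (\<Sum>i<n. 2 ^ i)"
    unfolding set_encode_def by (rule sum_mono2) (use assms in auto)
  also have "\<dots> = (2::nat) ^ n - 1" using mask_eq_sum_exp_nat[of n] by (simp add: lessThan_def)
  finally have "set_encode A \<le> 2 ^ n - 1" .
  moreover have "(0::nat) < 2 ^ n" by simp
  ultimately show ?thesis by linarith
qed

lemma order_type_less: "order_type x y u < 8"
  by (simp add: order_type_def of_bool_def)

lemma order_type_eqD:
  assumes "order_type x y u = order_type x y v"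
  shows "(\<exists>a\<in>set u. a x) = (\<exists>a\<in>set v. a x)" "(\<exists>a\<in>set u. a y) = (\<exists>a\<in>set v. a y)"
    "precedes x y u = precedes x y v"
proof -
  have "a = a' \<and> b = b' \<and> c = c'" if "of_bool a + 2 * of_bool b + 4 * of_bool c
     = of_bool a' + 2 * of_bool b' + 4 * (of_bool c' :: nat)" for a b c a' b' c'
    using that by (cases a; cases b; cases c; cases a'; cases b'; cases c'; simp)
  from this[OF assms[unfolded order_type_def]]
  show "(\<exists>a\<in>set u. a x) = (\<exists>a\<in>set v. a x)" "(\<exists>a\<in>set u. a y) = (\<exists>a\<in>set v. a y)"
    "precedes x y u = precedes x y v" by simp_all
qed

lemma order_type_append:
  assumes "order_type x y u = order_type x y u'" "order_type x y v = order_type x y v'"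
  shows "order_type x y (u @ v) = order_type x y (u' @ v')"
  unfolding order_type_def precedes_append set_append bex_Un
  by (simp only: order_type_eqD[OF assms(1)] order_type_eqD[OF assms(2)])

lemma ty_less: "ty \<phi> u < ty_bound \<phi>"
proof (induction \<phi> arbitrary: u)
  case (Less x y) then show ?case by (simp add: order_type_less)
next
  case (Disj \<phi> \<psi>) then show ?case by (simp add: prod_encode_strict_mono)
next
  case (Ex1 x \<phi>) then show ?case
    by (auto intro!: prod_encode_strict_mono set_encode_less order_type_less)
next
  case (Ex2 x \<phi>) then show ?case by (auto intro!: set_encode_less)
qed auto

lemma set_encode_image_eq:
  assumes "\<And>w. t w < N"
  shows "set_encode (t ` A) = set_encode (t ` B) \<longleftrightarrow> t ` A = t ` B"
proof -
  have "finite (t ` C)" for C by (rule finite_subset[of _ "{..<N}"]) (use assms in auto)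
  then show ?thesis by (simp add: set_encode_eq)
qed

lemma ty_Ex1_eq: "ty (Ex1 x \<phi>) u = ty (Ex1 x \<phi>) v \<longleftrightarrow>
    (\<lambda>w. prod_encode (ty \<phi> w, order_type (2*x) (2*x) w)) ` {w. list_all2 (off (2*x)) u w} =
    (\<lambda>w. prod_encode (ty \<phi> w, order_type (2*x) (2*x) w)) ` {w. list_all2 (off (2*x)) v w}"
  unfolding ty.simps by (rule set_encode_image_eq[where N = "prod_encode (ty_bound \<phi>, 8)"]) (intro prod_encode_strict_mono ty_less order_type_less)

lemma ty_Ex2_eq: "ty (Ex2 x \<phi>) u = ty (Ex2 x \<phi>) v \<longleftrightarrow>
    ty \<phi> ` {w. list_all2 (off (2*x+1)) u w} = ty \<phi> ` {w. list_all2 (off (2*x+1)) v w}"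
  unfolding ty.simps by (rule set_encode_image_eq[OF ty_less])

text \<open>A variant of \<open>u @ v\<close> splits at the boundary into variants of
  \<open>u\<close> and of \<open>v\<close>. Each can be exchanged for a variant of the other factor
  with the same type, and \<open>t\<close> is a congruence. This is the quantifier case of the
  composition theorem.\<close>

lemma image_variants_append:
  assumes t: "\<And>u u' v v'. t u = t u' \<Longrightarrow> t v = t v' \<Longrightarrow> t (u @ v) = t (u' @ v')"
    and eq: "t ` {w. list_all2 R u w} = t ` {w. list_all2 R u' w}"
      "t ` {w. list_all2 R v w} = t ` {w. list_all2 R v' w}"
  shows "t ` {w. list_all2 R (u @ v) w} = t ` {w. list_all2 R (u' @ v') w}"
proof -
  have "t ` {w. list_all2 R (u @ v) w} \<subseteq> t ` {w. list_all2 R (u' @ v') w}"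
    if eq: "t ` {w. list_all2 R u w} = t ` {w. list_all2 R u' w}"
      "t ` {w. list_all2 R v w} = t ` {w. list_all2 R v' w}" for u u' v v'
  proof (rule image_subsetI)
    fix w assume "w \<in> {w. list_all2 R (u @ v) w}"
    then obtain w1 w2 where w: "list_all2 R u w1" "list_all2 R v w2" "w = w1 @ w2"
      by (fastforce simp: list_all2_append1)
    have "t w1 \<in> t ` {w. list_all2 R u w}" "t w2 \<in> t ` {w. list_all2 R v w}" using w(1,2) by blast+
    then obtain z1 z2 where z: "list_all2 R u' z1" "list_all2 R v' z2" "t w1 = t z1" "t w2 = t z2"
      unfolding eq by blast
    have "t w = t (z1 @ z2)" using t[OF z(3,4)] w(3) by simp
    moreover have "list_all2 R (u' @ v') (z1 @ z2)" using z by (simp add: list_all2_appendI)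
    ultimately show "t w \<in> t ` {w. list_all2 R (u' @ v') w}" by blast
  qed
  from this[OF eq] this[OF eq[symmetric]] show ?thesis by (rule equalityI)
qed

lemma ty_append:
  assumes "ty \<phi> u = ty \<phi> u'" "ty \<phi> v = ty \<phi> v'"
  shows "ty \<phi> (u @ v) = ty \<phi> (u' @ v')"
  using assms
proof (induction \<phi> arbitrary: u u' v v')
  case (Less x y) then show ?case unfolding ty.simps by (rule order_type_append)
next
  case (Eq x y) then show ?case by (simp add: bex_Un)
next
  case (Mem x V) then show ?case by (simp add: bex_Un)
next
  case (Neg \<phi>) show ?case using Neg.prems Neg.IH[of u u' v v'] by simp
next
  case (Disj \<phi> \<psi>)
  show ?case using Disj.prems Disj.IH(1)[of u u' v v'] Disj.IH(2)[of u u' v v'] by simp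
next
  case (Ex1 x \<phi>)
  let ?t = "\<lambda>w. prod_encode (ty \<phi> w, order_type (2*x) (2*x) w)"
  show ?case unfolding ty_Ex1_eq
  proof (rule image_variants_append[where t = ?t])
    fix u u' v v' assume "?t u = ?t u'" "?t v = ?t v'"
    then show "?t (u @ v) = ?t (u' @ v')"
      unfolding prod_encode_eq prod.inject using Ex1.IH order_type_append by blast
  qed (use Ex1.prems in \<open>simp_all only: ty_Ex1_eq\<close>)
next
  case (Ex2 x \<phi>)
  show ?case unfolding ty_Ex2_eq
    by (rule image_variants_append[where t = "ty \<phi>", OF Ex2.IH]) (use Ex2.prems in \<open>simp_all only: ty_Ex2_eq\<close>)
qed

section \<open>Factorisations of omega-words\<close>

definition seg :: "(nat \<Rightarrow> 'a) \<Rightarrow> (nat \<Rightarrow> nat) \<Rightarrow> nat \<Rightarrow> 'a list" where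
  "seg W g i = map W [g i..<g (Suc i)]"

lemma cut_block:
  fixes g :: "nat \<Rightarrow> nat"
  assumes "strict_mono g" "g 0 = 0"
  shows "\<exists>i. g i \<le> n \<and> n < g (Suc i)"
proof (induction n)
  case 0
  show ?case using assms strict_monoD[OF assms(1), of 0 1] by (intro exI[of _ 0]) simp
next
  case (Suc n)
  then obtain i where i: "g i \<le> n" "n < g (Suc i)" by blast
  show ?case
  proof (cases "Suc n < g (Suc i)")
    case True then show ?thesis using i by (intro exI[of _ i]) simp
  next
    case False
    then have "g (Suc i) \<le> Suc n" "Suc n < g (Suc (Suc i))"
      using i strict_monoD[OF assms(1), of "Suc i" "Suc (Suc i)"] by simp_all
    then show ?thesis by blast
  qed
qed

lemma cut_block_unique:
  fixes g :: "nat \<Rightarrow> nat"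
  assumes "strict_mono g" "g i \<le> n" "n < g (Suc i)" "g j \<le> n" "n < g (Suc j)"
  shows "i = j"
proof -
  have "g i < g (Suc j)" "g j < g (Suc i)" using assms by linarith+
  then have "i < Suc j" "j < Suc i" using assms(1) by (simp_all add: strict_mono_less)
  then show ?thesis by simp
qed

lemma ex_seg:
  assumes g: "strict_mono g" "g 0 = 0" and len: "\<And>i. length (u i) = g (Suc i) - g i"
  shows "\<exists>W. \<forall>i. seg W g i = u i"
proof -
  define b where "b n = (SOME i. g i \<le> n \<and> n < g (Suc i))" for n
  have b: "g (b n) \<le> n \<and> n < g (Suc (b n))" for n
    unfolding b_def by (rule someI_ex) (rule cut_block[OF g])
  have "seg (\<lambda>n. u (b n) ! (n - g (b n))) g i = u i" for i
  proof (rule nth_equalityI)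
    show "length (seg (\<lambda>n. u (b n) ! (n - g (b n))) g i) = length (u i)" by (simp add: seg_def len)
    fix k assume "k < length (seg (\<lambda>n. u (b n) ! (n - g (b n))) g i)"
    then have k: "k < g (Suc i) - g i" by (simp add: seg_def)
    then have "b (g i + k) = i"
      using b[of "g i + k"] by (intro cut_block_unique[OF g(1), of _ "g i + k"]) auto
    then show "seg (\<lambda>n. u (b n) ! (n - g (b n))) g i ! k = u i ! k" using k by (simp add: seg_def)
  qed
  then show ?thesis by blast
qed

lemma list_all2_seg:
  assumes "strict_mono g" "g 0 = 0"
  shows "(\<forall>i. list_all2 R (seg W g i) (seg W' g i)) \<longleftrightarrow> (\<forall>n. R (W n) (W' n))"
proof
  assume *: "\<forall>i. list_all2 R (seg W g i) (seg W' g i)"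
  show "\<forall>n. R (W n) (W' n)"
  proof
    fix n
    obtain i where i: "g i \<le> n" "n < g (Suc i)" using cut_block[OF assms] by blast
    have "n - g i < length (seg W g i)" using i by (simp add: seg_def)
    then have "R (seg W g i ! (n - g i)) (seg W' g i ! (n - g i))"
      using * by (blast intro: list_all2_nthD)
    then show "R (W n) (W' n)" using i by (simp add: seg_def)
  qed
qed (auto simp: seg_def list_all2_conv_all_nth)

lemma ex_seg_iff:
  assumes "strict_mono g" "g 0 = 0"
  shows "(\<exists>i. \<exists>a\<in>set (seg W g i). Q a) \<longleftrightarrow> (\<exists>n. Q (W n))"
proof
  assume "\<exists>n. Q (W n)"
  then obtain n where n: "Q (W n)" by blast
  obtain i where "g i \<le> n" "n < g (Suc i)" using cut_block[OF assms] by blast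
  then show "\<exists>i. \<exists>a\<in>set (seg W g i). Q a" using n by (auto simp: seg_def intro!: exI[of _ i])
qed (auto simp: seg_def)

text \<open>Two ordered positions lie either in one block, where \<open>precedes\<close> sees them,
  or in two blocks, whose order is the order of the positions.\<close>

lemma ex_less_seg_iff:
  assumes g: "strict_mono g" "g 0 = 0"
  shows "(\<exists>i j. i < j \<and> W i x \<and> W j y) \<longleftrightarrow> (\<exists>i. precedes x y (seg W g i)) \<or>
    (\<exists>i j. i < j \<and> (\<exists>a\<in>set (seg W g i). a x) \<and> (\<exists>a\<in>set (seg W g j). a y))"
    (is "?L \<longleftrightarrow> ?R1 \<or> ?R2")
proof
  assume ?L
  then obtain m n where mn: "m < n" "W m x" "W n y" by blast
  obtain i where i: "g i \<le> m" "m < g (Suc i)" using cut_block[OF g] by blast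
  obtain j where j: "g j \<le> n" "n < g (Suc j)" using cut_block[OF g] by blast
  have "g i < g (Suc j)" using i j mn by linarith
  then have "i < Suc j" using g(1) by (simp add: strict_mono_less)
  then consider "i = j" | "i < j" by linarith
  then show "?R1 \<or> ?R2"
  proof cases
    case 1
    then have "precedes x y (seg W g i)" unfolding seg_def precedes_upt using i j mn by blast
    then show ?thesis by blast
  next
    case 2
    have "\<exists>a\<in>set (seg W g i). a x" "\<exists>a\<in>set (seg W g j). a y"
      using i j mn by (auto simp: seg_def)
    then show ?thesis using 2 by blast
  qed
next
  assume "?R1 \<or> ?R2"
  then show ?L
  proof
    assume ?R1 then show ?L unfolding seg_def precedes_upt by blast
  next
    assume ?R2
    then obtain i j m n where *: "i < j" "g i \<le> m" "m < g (Suc i)" "W m x" "g j \<le> n" "n < g (Suc j)" "W n y"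
      by (auto simp: seg_def)
    have "g (Suc i) \<le> g j" using *(1) g(1) by (simp add: strict_mono_less_eq)
    then have "m < n" using * by linarith
    then show ?L using * by blast
  qed
qed

lemma order_type_seg:
  assumes g: "strict_mono g" "g 0 = 0" "strict_mono g'" "g' 0 = 0"
    and eq: "\<And>i. order_type x y (seg W g i) = order_type x y (seg W' g' i)"
  shows "(\<exists>i j. i < j \<and> W i x \<and> W j y) \<longleftrightarrow> (\<exists>i j. i < j \<and> W' i x \<and> W' j y)"
    and "(\<exists>i. W i x) \<longleftrightarrow> (\<exists>i. W' i x)"
  unfolding ex_less_seg_iff[OF g(1,2), of W] ex_less_seg_iff[OF g(3,4), of W']
    ex_seg_iff[OF g(1,2), of W "\<lambda>a. a x", symmetric] ex_seg_iff[OF g(3,4), of W' "\<lambda>a. a x", symmetric]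
    order_type_eqD[OF eq] by (rule refl)+

text \<open>Transports a quantifier witness between two words with matching factor types: a suitable
  variant is chosen for each factor separately, and \<open>ex_seg\<close> glues the choices
  together.\<close>

lemma variants_seg:
  assumes g: "strict_mono g" "g 0 = 0" "strict_mono g'" "g' 0 = 0"
    and eq: "\<And>i. t ` {w. list_all2 R (seg W g i) w} = t ` {w. list_all2 R (seg W' g' i) w}"
    and V: "\<forall>n. R (W n) (V n)"
  obtains V' where "\<forall>n. R (W' n) (V' n)" "\<And>i. t (seg V' g' i) = t (seg V g i)"
proof -
  have "\<exists>u. list_all2 R (seg W' g' i) u \<and> t u = t (seg V g i)" for i
  proof -
    have "list_all2 R (seg W g i) (seg V g i)" using V by (simp add: seg_def list_all2_conv_all_nth)
    then have "t (seg V g i) \<in> t ` {w. list_all2 R (seg W g i) w}" by blast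
    then show ?thesis unfolding eq by fastforce
  qed
  then obtain u where u: "\<And>i. list_all2 R (seg W' g' i) (u i)" "\<And>i. t (u i) = t (seg V g i)" by metis
  have "length (u i) = g' (Suc i) - g' i" for i
    using list_all2_lengthD[OF u(1)[of i]] by (simp add: seg_def)
  then obtain V' where V': "\<And>i. seg V' g' i = u i" using ex_seg[OF g(3,4)] by metis
  have "\<forall>n. R (W' n) (V' n)"
    by (rule list_all2_seg[OF g(3,4), of R, THEN iffD1]) (simp only: V' u(1) simp_thms)
  then show ?thesis using that V' u(2) by simp
qed

lemma wsat_seg_cong:
  assumes "strict_mono g" "g 0 = 0" "strict_mono g'" "g' 0 = 0"
    and "\<And>i. ty \<phi> (seg W g i) = ty \<phi> (seg W' g' i)"
  shows "wsat \<phi> W \<longleftrightarrow> wsat \<phi> W'"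
proof -
  \<comment> \<open>The hypotheses are symmetric in the two words, so one implication suffices. It
    is stated for all words and factorisations so that the negation case can use the induction
    hypothesis in the reverse direction.\<close>
  have *: "wsat \<phi> W \<Longrightarrow> wsat \<phi> W'"
    if "strict_mono g" "g 0 = 0" "strict_mono g'" "g' 0 = 0"
    "\<And>i. ty \<phi> (seg W g i) = ty \<phi> (seg W' g' i)" for g g' W W'
    using that
  proof (induction \<phi> arbitrary: W W' g g')
    case (Less x y)
    then show ?case
      unfolding wsat.simps ty.simps using order_type_seg(1)[OF Less.prems(2-5), of "2*x" "2*y" W W'] by blast
  next
    case (Eq x y)
    have "(\<exists>a\<in>set (seg W g i). a (2*x) \<and> a (2*y)) = (\<exists>a\<in>set (seg W' g' i). a (2*x) \<and> a (2*y))" for i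
      using Eq.prems(6)[of i] unfolding ty.simps of_bool_eq_iff .
    then have "(\<exists>i. \<exists>a\<in>set (seg W g i). a (2*x) \<and> a (2*y)) = (\<exists>i. \<exists>a\<in>set (seg W' g' i). a (2*x) \<and> a (2*y))"
      by (rule arg_cong[of _ _ Ex, OF ext])
    then show ?case
      using Eq.prems(1) unfolding ex_seg_iff[OF Eq.prems(2,3)] ex_seg_iff[OF Eq.prems(4,5)] by simp
  next
    case (Mem x V)
    have "(\<exists>a\<in>set (seg W g i). a (2*x) \<and> a (2*V+1)) = (\<exists>a\<in>set (seg W' g' i). a (2*x) \<and> a (2*V+1))" for i
      using Mem.prems(6)[of i] unfolding ty.simps of_bool_eq_iff .
    then have "(\<exists>i. \<exists>a\<in>set (seg W g i). a (2*x) \<and> a (2*V+1)) = (\<exists>i. \<exists>a\<in>set (seg W' g' i). a (2*x) \<and> a (2*V+1))"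
      by (rule arg_cong[of _ _ Ex, OF ext])
    then show ?case
      using Mem.prems(1) unfolding ex_seg_iff[OF Mem.prems(2,3)] ex_seg_iff[OF Mem.prems(4,5)] by simp
  next
    case (Neg \<phi>)
    have "wsat \<phi> W' \<Longrightarrow> wsat \<phi> W"
      by (erule Neg.IH[OF _ Neg.prems(4,5,2,3)]) (use Neg.prems(6) in \<open>simp_all\<close>)
    then show ?case using Neg.prems(1) by auto
  next
    case (Disj \<phi> \<psi>)
    have "wsat \<phi> W \<Longrightarrow> wsat \<phi> W'"
      by (erule Disj.IH(1)[OF _ Disj.prems(2-5)]) (use Disj.prems(6) in \<open>unfold ty.simps prod_encode_eq prod.inject, blast\<close>)
    moreover have "wsat \<psi> W \<Longrightarrow> wsat \<psi> W'"
      by (erule Disj.IH(2)[OF _ Disj.prems(2-5)]) (use Disj.prems(6) in \<open>unfold ty.simps prod_encode_eq prod.inject, blast\<close>)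
    ultimately show ?case using Disj.prems(1) by auto
  next
    case (Ex1 x \<phi>)
    obtain V where V: "\<forall>n. off (2*x) (W n) (V n)" "\<exists>!n. V n (2*x)" "wsat \<phi> V"
      using Ex1.prems(1) unfolding wsat.simps by blast
    obtain V' where V': "\<forall>n. off (2*x) (W' n) (V' n)"
      "\<And>i. prod_encode (ty \<phi> (seg V' g' i), order_type (2*x) (2*x) (seg V' g' i)) =
        prod_encode (ty \<phi> (seg V g i), order_type (2*x) (2*x) (seg V g i))"
      by (rule variants_seg[where R = "off (2*x)" and t = "\<lambda>w. prod_encode (ty \<phi> w, order_type (2*x) (2*x) w)", OF Ex1.prems(2-5) Ex1.prems(6)[unfolded ty_Ex1_eq] V(1)]) blast
    then have eq: "\<And>i. ty \<phi> (seg V g i) = ty \<phi> (seg V' g' i)"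
      "\<And>i. order_type (2*x) (2*x) (seg V g i) = order_type (2*x) (2*x) (seg V' g' i)"
      unfolding prod_encode_eq prod.inject by simp_all
    have "wsat \<phi> V'" by (rule Ex1.IH[OF V(3) Ex1.prems(2-5) eq(1)])
    moreover have "\<exists>!n. V' n (2*x)"
      using V(2) unfolding ex1_nat_iff order_type_seg[OF Ex1.prems(2-5) eq(2)] .
    ultimately show ?case unfolding wsat.simps using V'(1) by blast
  next
    case (Ex2 x \<phi>)
    obtain V where V: "\<forall>n. off (2*x+1) (W n) (V n)" "wsat \<phi> V"
      using Ex2.prems(1) unfolding wsat.simps by blast
    obtain V' where V': "\<forall>n. off (2*x+1) (W' n) (V' n)" "\<And>i. ty \<phi> (seg V' g' i) = ty \<phi> (seg V g i)"
      by (rule variants_seg[where R = "off (2*x+1)" and t = "ty \<phi>", OF Ex2.prems(2-5) Ex2.prems(6)[unfolded ty_Ex2_eq] V(1)]) blast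
    have "wsat \<phi> V'" by (rule Ex2.IH[OF V(2) Ex2.prems(2-5)]) (simp only: V'(2))
    then show ?case unfolding wsat.simps using V'(1) by blast
  qed
  show ?thesis using *[OF assms] *[OF assms(3,4,1,2) assms(5)[symmetric]] by blast
qed

section \<open>Ultimately periodic words: a stem of length \<open>p\<close> running into a loop of
  length \<open>q\<close>\<close>

definition lasso :: "nat \<Rightarrow> nat \<Rightarrow> nat \<Rightarrow> nat" where
  "lasso p q i = (if i < p then i else p + (i - p) mod q)"

lemma lasso_less: "0 < q \<Longrightarrow> lasso p q i < p + q"
  by (simp add: lasso_def)

lemma lasso_id: "i < p + q \<Longrightarrow> lasso p q i = i"
  by (auto simp: lasso_def)

lemma lasso_Suc_lasso: "lasso p q (Suc (lasso p q i)) = lasso p q (Suc i)"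
proof (cases "i < p")
  case False
  then have "Suc (p + (i - p) mod q) - p = Suc ((i - p) mod q)" "Suc i - p = Suc (i - p)" by auto
  then show ?thesis using False by (simp add: lasso_def mod_Suc_eq)
qed (simp add: lasso_def)

lemma lasso_period: "p \<le> i \<Longrightarrow> lasso p q (i + q * k) = lasso p q i"
  by (simp add: lasso_def) (metis Nat.diff_add_assoc2 mod_mult_self2)

text \<open>The listed positions need not be consecutive: the successor of an entry only has to
  share its color with the next entry. Hence a piece between equal colors can be cut out and a path
  remains.\<close>

fun path :: "(nat \<Rightarrow> 'c) \<Rightarrow> 'c \<Rightarrow> nat list \<Rightarrow> 'c \<Rightarrow> bool" where
  "path \<kappa> c [] d \<longleftrightarrow> c = d"
| "path \<kappa> c (i # xs) d \<longleftrightarrow> \<kappa> i = c \<and> path \<kappa> (\<kappa> (Suc i)) xs d"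

lemma path_append: "path \<kappa> c (xs @ ys) d \<longleftrightarrow> (\<exists>e. path \<kappa> c xs e \<and> path \<kappa> e ys d)"
  by (induction xs arbitrary: c) auto

lemma path_upt: "a \<le> b \<Longrightarrow> path \<kappa> (\<kappa> a) [a..<b] (\<kappa> b)"
  by (induction b rule: dec_induct) (auto simp: path_append)

lemma path_last: "path \<kappa> c xs d \<Longrightarrow> xs \<noteq> [] \<Longrightarrow> \<kappa> (Suc (last xs)) = d"
  by (induction xs arbitrary: c) (auto split: if_splits)

lemma path_hd: "path \<kappa> c xs d \<Longrightarrow> xs \<noteq> [] \<Longrightarrow> \<kappa> (hd xs) = c"
  by (cases xs) auto

lemma path_nth: "path \<kappa> c xs d \<Longrightarrow> Suc i < length xs \<Longrightarrow> \<kappa> (Suc (xs ! i)) = \<kappa> (xs ! Suc i)"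
proof (induction xs arbitrary: c i)
  case (Cons a xs)
  show ?case
  proof (cases i)
    case 0
    then show ?thesis using Cons.prems path_hd[of \<kappa> "\<kappa> (Suc a)" xs d] by (cases xs) auto
  next
    case (Suc j)
    then show ?thesis using Cons.prems Cons.IH[of "\<kappa> (Suc a)" j] by auto
  qed
qed simp

text \<open>All that the combinatorial arguments use of types: there are finitely many, they form a
  congruence, and the types of the factors decide membership. The free alphabet allows triples of
  bits for the games and full letters for the witnesses.\<close>

locale omega_type =
  fixes \<tau> :: "'a list \<Rightarrow> nat" and N :: nat and L :: "(nat \<Rightarrow> 'a) \<Rightarrow> bool"
  assumes type_less: "\<tau> u < N"
    and type_append: "\<tau> u = \<tau> u' \<Longrightarrow> \<tau> v = \<tau> v' \<Longrightarrow> \<tau> (u @ v) = \<tau> (u' @ v')"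
    and type_omega: "strict_mono g \<Longrightarrow> g 0 = 0 \<Longrightarrow> strict_mono g' \<Longrightarrow> g' 0 = 0 \<Longrightarrow>
      (\<And>i. \<tau> (seg W g i) = \<tau> (seg W' g' i)) \<Longrightarrow> L W \<longleftrightarrow> L W'"
begin

text \<open>Pigeonhole on prefixes: there are at most \<open>N * C\<close> pairs of a prefix type
  and the color reached. If two prefixes share the pair, the stretch between them can be removed
  without changing the type of the whole or breaking the path.\<close>

lemma shorten_path:
  assumes "finite (range \<kappa>)" "card (range \<kappa>) \<le> C" "path \<kappa> c xs d" "xs \<noteq> []"
  shows "\<exists>ys. ys \<noteq> [] \<and> path \<kappa> c ys d \<and> \<tau> (map W ys) = \<tau> (map W xs) \<and> length ys \<le> N * C"
  using assms(3,4)
proof (induction "length xs" arbitrary: xs rule: less_induct)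
  case less
  show ?case
  proof (cases "length xs \<le> N * C")
    case False
    define e where "e l = \<kappa> (Suc (xs ! (l - 1)))" for l
    define f where "f l = (\<tau> (map W (take l xs)), e l)" for l
    have split: "path \<kappa> c (take l xs) (e l) \<and> path \<kappa> (e l) (drop l xs) d"
      if "l \<in> {1..length xs}" for l
    proof -
      have "path \<kappa> c (take l xs @ drop l xs) d" using less.prems by simp
      then obtain e' where e': "path \<kappa> c (take l xs) e'" "path \<kappa> e' (drop l xs) d"
        unfolding path_append by blast
      have "take l xs \<noteq> []" using that less.prems by auto
      with e'(1) have "\<kappa> (Suc (last (take l xs))) = e'" by (rule path_last)
      moreover have "last (take l xs) = xs ! (l - 1)"
        using that less.prems \<open>take l xs \<noteq> []\<close> by (simp add: last_conv_nth min_absorb2)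
      ultimately show ?thesis using e' by (simp add: e_def)
    qed
    have "f ` {1..length xs} \<subseteq> {..<N} \<times> range \<kappa>"
      by (auto simp: f_def e_def type_less)
    then have "card (f ` {1..length xs}) \<le> card ({..<N} \<times> range \<kappa>)"
      by (intro card_mono) (auto simp: assms(1))
    also have "\<dots> \<le> N * C" using assms(2) by (simp add: card_cartesian_product)
    also have "\<dots> < card {1..length xs}" using False by simp
    finally have "\<not> inj_on f {1..length xs}" by (rule pigeonhole)
    then obtain k l where kl: "k \<in> {1..length xs}" "l \<in> {1..length xs}" "f k = f l" "k < l"
      unfolding inj_on_def by (metis linorder_neqE_nat)
    let ?ys = "take k xs @ drop l xs"
    have "length ?ys < length xs" "?ys \<noteq> []" using kl by auto
    moreover have "path \<kappa> c ?ys d"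
      using split[OF kl(1)] split[OF kl(2)] kl(3) unfolding path_append f_def by auto
    ultimately obtain ys where "ys \<noteq> []" "path \<kappa> c ys d" "length ys \<le> N * C"
      "\<tau> (map W ys) = \<tau> (map W ?ys)"
      using less.hyps by blast
    moreover have "\<tau> (map W ?ys) = \<tau> (map W (take l xs) @ map W (drop l xs))"
      unfolding map_append by (rule type_append) (use kl(3) in \<open>auto simp: f_def\<close>)
    then have "\<tau> (map W ?ys) = \<tau> (map W xs)" by (simp flip: map_append)
    ultimately show ?thesis by metis
  qed (use less.prems in blast)
qed

text \<open>Positions are first thinned out to a single color of \<open>\<kappa>\<close>; Ramsey's
  theorem then gives an infinite subset between any two members of which the factor has one fixed
  type.\<close>

lemma ramsey_cut:
  fixes \<kappa> :: "nat \<Rightarrow> 'c"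
  assumes "finite (range \<kappa>)"
  obtains g f c where "strict_mono g" "g 0 = 0" "\<And>i. \<kappa> (g (Suc i)) = c"
    "\<And>i. \<tau> (seg W g (Suc i)) = f"
proof -
  \<comment> \<open>Position 0 is excluded because it serves as the first cut, whose color is not
    prescribed.\<close>
  have "finite (\<kappa> ` {1..})" using assms by (rule finite_subset[rotated]) auto
  then obtain a where a: "infinite {b \<in> {1..}. \<kappa> b = \<kappa> a}"
    using pigeonhole_infinite[of "{1..}" \<kappa>] infinite_Ici by blast
  define Z where "Z = {b \<in> {1..}. \<kappa> b = \<kappa> a}"
  have "infinite Z" using a by (simp only: Z_def not_False_eq_True)
  from Ramsey2[OF this, of "\<lambda>A. \<tau> (map W [Min A..<Max A])" N] type_less
  obtain Y t where Y: "Y \<subseteq> Z" "infinite Y"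
    "\<And>x y. x \<in> Y \<Longrightarrow> y \<in> Y \<Longrightarrow> x \<noteq> y \<Longrightarrow> \<tau> (map W [Min {x,y}..<Max {x,y}]) = t"
    by auto
  define g where "g n = (case n of 0 \<Rightarrow> 0 | Suc m \<Rightarrow> enumerate Y m)" for n
  have en: "enumerate Y m \<in> Y" for m using Y(2) by (rule enumerate_in_set)
  have pos: "0 < enumerate Y m" for m using en[of m] Y(1) by (auto simp: Z_def)
  have step: "enumerate Y m < enumerate Y (Suc m)" for m using Y(2) by (simp add: enumerate_step)
  have "strict_mono g"
    by (rule strict_mono_Suc_iff[THEN iffD2]) (auto simp: g_def pos step split: nat.split)
  moreover have "g 0 = 0" by (simp add: g_def)
  moreover have "\<kappa> (g (Suc i)) = \<kappa> a" for i using en[of i] Y(1) by (auto simp: g_def Z_def)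
  moreover have "\<tau> (seg W g (Suc i)) = t" for i
    using Y(3)[OF en[of i] en[of "Suc i"]] step[of i] by (simp add: seg_def g_def min_def max_def)
  ultimately show ?thesis by (rule that)
qed

text \<open>Stem and loop are the shortened first and second factors of a Ramsey cut. All later
  factors have the type of the loop, so repeating the loop reproduces the sequence of types.
  \<open>idx\<close> names the original position copied at each place of the lasso, and
  \<open>\<kappa>\<close> carries side information, such as a machine state or a position of the
  parameter, that must stay coherent across the jumps.\<close>

lemma lasso_exists:
  fixes \<kappa> :: "nat \<Rightarrow> 'c"
  assumes \<kappa>: "finite (range \<kappa>)" "card (range \<kappa>) \<le> C"
  obtains p q idx where "0 < p" "0 < q" "p \<le> N * C" "q \<le> N * C" "\<kappa> (idx 0) = \<kappa> 0"
    "\<And>i. i < p + q \<Longrightarrow> \<kappa> (Suc (idx i)) = \<kappa> (idx (lasso p q (Suc i)))"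
    "L (\<lambda>i. W (idx (lasso p q i))) \<longleftrightarrow> L W"
proof -
  obtain g f c where g: "strict_mono g" "g 0 = 0" "\<And>i. \<kappa> (g (Suc i)) = c"
    "\<And>i. \<tau> (seg W g (Suc i)) = f"
    by (rule ramsey_cut[OF \<kappa>(1), of W]) blast
  have less: "g 0 < g (Suc 0)" "g (Suc 0) < g (Suc (Suc 0))" using g(1) by (simp_all add: strict_mono_Suc_iff)
  obtain xs where xs: "xs \<noteq> []" "path \<kappa> (\<kappa> 0) xs c" "\<tau> (map W xs) = \<tau> (map W [0..<g 1])" "length xs \<le> N * C"
    using shorten_path[OF \<kappa>, of "\<kappa> 0" "[0..<g 1]" c W] path_upt[of 0 "g 1" \<kappa>] less g(2) g(3)[of 0] by auto
  obtain ys where ys: "ys \<noteq> []" "path \<kappa> c ys c" "\<tau> (map W ys) = \<tau> (map W [g 1..<g 2])" "length ys \<le> N * C"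
    using shorten_path[OF \<kappa>, of c "[g 1..<g 2]" c W] path_upt[of "g 1" "g 2" \<kappa>] less g(3)[of 0] g(3)[of 1]
    by (auto simp: numeral_2_eq_2)
  define p q idx where "p = length xs" and "q = length ys" and "idx i = (xs @ ys) ! i" for i
  have pq: "0 < p" "0 < q" using xs(1) ys(1) by (auto simp: p_def q_def)
  have path: "path \<kappa> (\<kappa> 0) (xs @ ys) c" using xs(2) ys(2) by (auto simp: path_append)
  have "\<kappa> (Suc (idx i)) = \<kappa> (idx (lasso p q (Suc i)))" if "i < p + q" for i
  proof (cases "Suc i < p + q")
    case True
    then show ?thesis using path_nth[OF path, of i] by (simp add: lasso_id idx_def p_def q_def)
  next
    case False
    then have i: "Suc i = p + q" using that by simp
    then have "lasso p q (Suc i) = p" by (simp add: lasso_def)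
    moreover have "idx i = last (xs @ ys)" 
    proof -
      have "i = length (xs @ ys) - 1" using i by (simp add: p_def q_def)
      then show ?thesis using ys(1) by (metis idx_def last_conv_nth append_is_Nil_conv)
    qed
    moreover have "idx p = hd ys" using ys(1) by (simp add: idx_def p_def nth_append hd_conv_nth)
    ultimately show ?thesis using path_last[OF path] path_hd[OF ys(2,1)] xs(1) by simp
  qed
  moreover have "\<kappa> (idx 0) = \<kappa> 0" using path_hd[OF path] xs(1) by (simp add: idx_def hd_conv_nth)
  moreover have "L (\<lambda>i. W (idx (lasso p q i))) \<longleftrightarrow> L W"
  proof (rule type_omega)
    define g' where "g' n = (case n of 0 \<Rightarrow> 0 | Suc m \<Rightarrow> p + q * m)" for n
    show "strict_mono g'"
      by (rule strict_mono_Suc_iff[THEN iffD2]) (use pq in \<open>auto simp: g'_def split: nat.split\<close>)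
    show "g' 0 = 0" by (simp add: g'_def)
    show "\<tau> (seg (\<lambda>i. W (idx (lasso p q i))) g' i) = \<tau> (seg W g i)" for i
    proof (cases i)
      case 0
      have "map (\<lambda>i. W (idx (lasso p q i))) [0..<p] = map W xs"
        by (rule nth_equalityI) (auto simp: p_def idx_def lasso_def nth_append)
      then show ?thesis using 0 xs(3) g(2) by (simp add: seg_def g'_def)
    next
      case (Suc m)
      have "map (\<lambda>i. W (idx (lasso p q i))) [p + q * m..<p + q * m + q] = map W ys"
        using pq by (intro nth_equalityI) (auto simp: p_def q_def idx_def lasso_def nth_append add.commute)
      then have "\<tau> (seg (\<lambda>i. W (idx (lasso p q i))) g' i) = \<tau> (map W ys)"
        using Suc by (simp add: seg_def g'_def add.commute add.left_commute)
      also have "\<dots> = f" using ys(3) g(4)[of 0] by (simp add: seg_def numeral_2_eq_2)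
      finally show ?thesis using Suc g(4) by simp
    qed
  qed (use g in auto)
  moreover have "p \<le> N * C" "q \<le> N * C" using xs(4) ys(4) by (auto simp: p_def q_def)
  ultimately show ?thesis using that pq by blast
qed

end

section \<open>Determinisation\<close>

definition inf_min :: "(nat \<Rightarrow> nat) \<Rightarrow> nat \<Rightarrow> bool" where
  "inf_min f c \<longleftrightarrow> (\<forall>m. \<exists>n\<ge>m. f n = c) \<and> (\<exists>m. \<forall>n\<ge>m. c \<le> f n)"

lemma inf_min_exists:
  assumes "\<And>n. f n \<le> B"
  shows "\<exists>c. inf_min f c"
proof -
  have "finite (range f)" by (rule finite_subset[of _ "{..B}"]) (use assms in auto)
  then obtain a where "infinite {n \<in> UNIV. f n = f a}"
    using pigeonhole_infinite[of UNIV f] by auto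
  then have ex: "\<forall>m. \<exists>n\<ge>m. f n = f a" by (auto simp: infinite_nat_iff_unbounded_le)
  define c where "c = (LEAST c. \<forall>m. \<exists>n\<ge>m. f n = c)"
  have c: "\<forall>m. \<exists>n\<ge>m. f n = c" unfolding c_def using ex by (rule LeastI)
  have "\<exists>m. \<forall>n\<ge>m. f n \<noteq> d" if "d < c" for d
    using not_less_Least[OF that[unfolded c_def]] by blast
  then obtain m where m: "\<And>d n. d < c \<Longrightarrow> m d \<le> n \<Longrightarrow> f n \<noteq> d" by metis
  define M where "M = Max (insert 0 (m ` {..<c}))"
  have "c \<le> f n" if "M \<le> n" for n
  proof (rule ccontr)
    assume "\<not> c \<le> f n"
    then have d: "f n < c" by simp
    then have "m (f n) \<le> M" by (auto simp: M_def intro: Max_ge)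
    then show False using m[OF d, of n] that by simp
  qed
  then show ?thesis using c unfolding inf_min_def by blast
qed

text \<open>Deletes the boundary at index \<open>j\<close>. The entries are types in the automaton
  and words in its shadow run \<open>pieces\<close>.\<close>

definition merge :: "('b \<Rightarrow> 'b \<Rightarrow> 'b) \<Rightarrow> nat \<Rightarrow> 'b list \<Rightarrow> 'b list" where
  "merge h j xs = take (j - 1) xs @ h (xs ! (j - 1)) (xs ! j) # drop (Suc j) xs"

lemma split_at_two:
  assumes "0 < j" "j < length xs"
  obtains ys a b zs where "xs = ys @ a # b # zs" "j = Suc (length ys)"
proof
  show "xs = take (j - 1) xs @ xs ! (j - 1) # xs ! j # drop (Suc j) xs"
    using assms by (cases j) (auto simp: Cons_nth_drop_Suc id_take_nth_drop[symmetric])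
qed (use assms in auto)

lemma merge_eq: "merge h (Suc (length ys)) (ys @ a # b # zs) = ys @ h a b # zs"
  by (simp add: merge_def nth_append)

lemma length_merge: "0 < j \<Longrightarrow> j < length xs \<Longrightarrow> length (merge h j xs) = length xs - 1"
  by (elim split_at_two) (auto simp: merge_eq)

lemma set_merge: "set (merge h j xs) \<subseteq> set xs \<union> {h a b |a b. True}"
  by (auto simp: merge_def dest: in_set_takeD in_set_dropD)

lemma concat_take_merge:
  assumes "0 < j" "j < length us"
  shows "concat (take n (merge (@) j us)) = (if n < j then concat (take n us) else concat (take (Suc n) us))"
proof -
  obtain ys a b zs where *: "us = ys @ a # b # zs" "j = Suc (length ys)" by (rule split_at_two[OF assms])
  show ?thesis
  proof (cases "n < j")
    case True
    then show ?thesis unfolding * merge_eq by simp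
  next
    case False
    then obtain k where "n = Suc (length ys) + k" using *(2) by (metis le_add_diff_inverse not_less)
    then show ?thesis unfolding * merge_eq by simp
  qed
qed

abbreviation plen :: "nat \<Rightarrow> 'b list list \<Rightarrow> nat" where
  "plen n us \<equiv> length (concat (take n us))"

lemma length_concat_take_le: "plen n us \<le> length (concat us)"
  by (metis append_take_drop_id concat_append le_add1 length_append)

lemma concat_take_eq_take: "concat (take n us) = take (plen n us) (concat us)"
  by (metis append_eq_conv_conj append_take_drop_id concat_append)

context omega_type
begin

definition rep :: "nat \<Rightarrow> 'a list" where
  "rep t = (SOME u. \<tau> u = t)"

lemma type_rep [simp]: "\<tau> (rep (\<tau> u)) = \<tau> u"
  unfolding rep_def by (rule someI) (rule refl)

text \<open>The product of types, computed on representatives; it is independent of their choice by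
  \<open>type_append\<close>.\<close>

definition ctype :: "nat list \<Rightarrow> nat" where
  "ctype fs = \<tau> (concat (map rep fs))"

lemma ctype_map: "ctype (map \<tau> us) = \<tau> (concat us)"
proof (induction us)
  case (Cons u us)
  then show ?case using type_append[of "rep (\<tau> u)" u "concat (map rep (map \<tau> us))" "concat us"]
    by (simp add: ctype_def)
qed (simp add: ctype_def)

definition dup :: "nat list \<Rightarrow> nat \<Rightarrow> nat \<Rightarrow> bool" where
  "dup fs i j \<longleftrightarrow> i < j \<and> j < length fs \<and> ctype (drop i fs) = ctype (drop j fs)"

text \<open>The disjunct \<open>N < j\<close> makes the minimum exist: the value
  \<open>Suc N\<close> means that no boundary is dropped.\<close>

definition dpos :: "nat list \<Rightarrow> nat" where
  "dpos fs = (LEAST j. (\<exists>i. dup fs i j) \<or> N < j)"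

definition dsrc :: "nat list \<Rightarrow> nat \<Rightarrow> nat" where
  "dsrc fs j = (SOME i. dup fs i j)"

text \<open>By \<open>type_omega\<close> all words with such a factorisation agree on
  \<open>L\<close>, so one example settles them all.\<close>

definition accepting :: "nat \<Rightarrow> nat \<Rightarrow> bool" where
  "accepting a f \<longleftrightarrow> (\<exists>W g. strict_mono g \<and> g 0 = 0 \<and> \<tau> (seg W g 0) = a \<and>
     (\<forall>i. \<tau> (seg W g (Suc i)) = f) \<and> L W)"

definition reduce :: "nat list \<Rightarrow> nat list" where
  "reduce fs = (if dpos fs \<le> N then merge (\<lambda>s t. \<tau> (rep s @ rep t)) (dpos fs) fs else fs)"

text \<open>A min-parity color: the index of the dropped boundary dominates, and the last bit
  records acceptance. The two types guessed from this event are that of the input before boundary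
  \<open>j\<close> and that of the stretch from the surviving boundary \<open>i\<close> to
  \<open>j\<close>.\<close>

definition color :: "nat list \<Rightarrow> nat" where
  "color fs = (let j = dpos fs; i = dsrc fs j in
     2 * j + of_bool (j \<le> N \<and> accepting (ctype (take j fs)) (ctype (take (j - i) (drop i fs)))))"

primrec factors :: "(nat \<Rightarrow> 'a) \<Rightarrow> nat \<Rightarrow> nat list" where
  "factors W 0 = []"
| "factors W (Suc k) = reduce (factors W k @ [\<tau> [W k]])"

lemma dpos_le: "dpos fs \<le> Suc N"
  unfolding dpos_def by (rule Least_le) simp

lemma dup_dpos: "dpos fs \<le> N \<Longrightarrow> \<exists>i. dup fs i (dpos fs)"
  using LeastI[of "\<lambda>j. (\<exists>i. dup fs i j) \<or> N < j" "Suc N"] by (auto simp: dpos_def)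

lemma dup_dsrc: "dpos fs \<le> N \<Longrightarrow> dup fs (dsrc fs (dpos fs)) (dpos fs)"
  unfolding dsrc_def by (rule someI_ex) (rule dup_dpos)

lemma dpos_bounds: "dpos fs \<le> N \<Longrightarrow> 0 < dpos fs \<and> dpos fs < length fs"
  using dup_dpos[of fs] by (auto simp: dup_def)

text \<open>The \<open>N + 1\<close> suffixes starting at the boundaries up to \<open>N\<close> have
  at most \<open>N\<close> types. This keeps the state at length at most \<open>N\<close>, hence the
  automaton finite.\<close>

lemma dpos_le_N_if_long:
  assumes "N < length fs"
  shows "dpos fs \<le> N"
proof -
  have "(\<lambda>j. ctype (drop j fs)) ` {..N} \<subseteq> {..<N}" by (auto simp: ctype_def type_less)
  then have "card ((\<lambda>j. ctype (drop j fs)) ` {..N}) \<le> card {..<N}" by (rule card_mono[rotated]) simp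
  then have "\<not> inj_on (\<lambda>j. ctype (drop j fs)) {..N}" by (intro pigeonhole) simp
  then obtain i j where "i \<le> N" "j \<le> N" "i \<noteq> j" "ctype (drop i fs) = ctype (drop j fs)"
    unfolding inj_on_def by auto
  then obtain i j where ij: "i < j" "j \<le> N" "ctype (drop i fs) = ctype (drop j fs)"
    by (metis linorder_neqE_nat)
  then have "dup fs i j" using assms by (simp add: dup_def)
  then have "dpos fs \<le> j" unfolding dpos_def by (intro Least_le) blast
  then show ?thesis using ij by simp
qed

definition states :: "nat list set" where
  "states = {fs. set fs \<subseteq> {..<N} \<and> length fs \<le> N}"

lemma finite_states: "finite states"
  unfolding states_def by (rule finite_lists_length_le) simp

lemma reduce_states:
  assumes "fs \<in> states"
  shows "reduce (fs @ [\<tau> [a]]) \<in> states"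
proof -
  let ?fs = "fs @ [\<tau> [a]]"
  have fs: "set ?fs \<subseteq> {..<N}" "length ?fs \<le> Suc N" using assms by (auto simp: states_def type_less)
  show ?thesis
  proof (cases "dpos ?fs \<le> N")
    case True
    then have b: "0 < dpos ?fs" "dpos ?fs < length ?fs" using dpos_bounds by blast+
    have "set (merge (\<lambda>s t. \<tau> (rep s @ rep t)) (dpos ?fs) ?fs) \<subseteq> {..<N}"
      using fs(1) set_merge[of "\<lambda>s t. \<tau> (rep s @ rep t)" "dpos ?fs" ?fs] type_less by blast
    moreover have "length (merge (\<lambda>s t. \<tau> (rep s @ rep t)) (dpos ?fs) ?fs) \<le> N"
      using fs(2) by (simp add: length_merge[OF b])
    ultimately show ?thesis using True by (simp add: reduce_def states_def)
  next
    case False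
    then have "length ?fs \<le> N" using dpos_le_N_if_long[of ?fs] by linarith
    then show ?thesis using False fs by (simp add: reduce_def states_def)
  qed
qed

lemma factors_states: "factors W k \<in> states"
  by (induction k) (simp_all add: states_def[THEN eqset_imp_iff, of "[]"] reduce_states)

lemma color_bound: "color fs \<le> 2 * N + 3"
  using dpos_le[of fs] by (simp add: color_def Let_def of_bool_def)

text \<open>Shadow run of the automaton that keeps the factors themselves instead of their types, so
  that boundaries have positions in the input.\<close>

primrec pieces :: "(nat \<Rightarrow> 'a) \<Rightarrow> nat \<Rightarrow> 'a list list" where
  "pieces W 0 = []"
| "pieces W (Suc k) = (let us = pieces W k @ [[W k]]; j = dpos (map \<tau> us) in
     if j \<le> N then merge (@) j us else us)"

lemma pieces_props:
  "map \<tau> (pieces W k) = factors W k \<and> concat (pieces W k) = map W [0..<k] \<and> [] \<notin> set (pieces W k)"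
proof (induction k)
  case (Suc k)
  let ?us = "pieces W k @ [[W k]]" and ?h = "\<lambda>s t. \<tau> (rep s @ rep t)"
  define d where "d = dpos (map \<tau> ?us)"
  have eq: "map \<tau> ?us = factors W k @ [\<tau> [W k]]" "concat ?us = map W [0..<Suc k]" "[] \<notin> set ?us"
    using Suc by simp_all
  show ?case
  proof (cases "dpos (map \<tau> ?us) \<le> N")
    case True
    have b: "0 < d" "d < length ?us"
      using dpos_bounds[OF True] by (simp_all add: d_def)
    obtain ys a b zs where *: "?us = ys @ a # b # zs" "d = Suc (length ys)"
      by (rule split_at_two[OF b])
    have "map \<tau> (merge (@) d ?us) = merge ?h d (map \<tau> ?us)"
      unfolding * merge_eq
      using merge_eq[of ?h "map \<tau> ys" "\<tau> a" "\<tau> b" "map \<tau> zs"] type_append[OF type_rep[of a] type_rep[of b]]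
      by simp
    moreover have "concat (merge (@) d ?us) = concat ?us" "[] \<notin> set (merge (@) d ?us)"
      using eq(3) unfolding * merge_eq by auto
    ultimately show ?thesis using True eq by (simp add: reduce_def Let_def d_def del: concat_append)
  next
    case False
    then show ?thesis using eq by (simp add: reduce_def Let_def)
  qed
qed simp

lemmas map_pieces = pieces_props[THEN conjunct1]
  and concat_pieces = pieces_props[THEN conjunct2, THEN conjunct1]
  and pieces_nonempty = pieces_props[THEN conjunct2, THEN conjunct2]

text \<open>Let \<open>J\<close> be the least position at which factors are merged infinitely often. The first \<open>J\<close>
  boundaries are eventually fixed, and the boundary at index \<open>J\<close> is removed infinitely often because
  the types from it and from one of the fixed boundaries to the present coincide. By
  pigeonhole these removed boundaries yield a factorisation of the input whose type decides
  membership.\<close>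

lemma inf_min_color: "\<exists>c. inf_min (\<lambda>k. color (factors W k @ [\<tau> [W k]])) c \<and> (odd c \<longleftrightarrow> L W)"
proof -
  define us where "us k = pieces W k @ [[W k]]" for k
  define j where "j k = dpos (map \<tau> (us k))" for k
  have us_types: "map \<tau> (us k) = factors W k @ [\<tau> [W k]]" for k by (simp add: us_def map_pieces)
  have pieces_Suc: "pieces W (Suc k) = (if j k \<le> N then merge (@) (j k) (us k) else us k)" for k
    by (simp add: us_def j_def Let_def)
  have jb: "0 < j k" "j k < length (us k)" if "j k \<le> N" for k
    using dpos_bounds[OF that[unfolded j_def]] by (simp_all add: j_def)
  have concat_us: "concat (us k) = map W [0..<Suc k]" for k by (simp add: us_def concat_pieces)
  have "length (pieces W k) = length (factors W k)" for k by (simp flip: map_pieces)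
  then have len: "length (pieces W k) \<le> N" for k using factors_states[of W k] by (simp add: states_def)
  have len_Suc: "length (pieces W (Suc k)) = length (pieces W k) + (if j k \<le> N then 0 else 1)" for k
    using jb[of k] by (simp add: pieces_Suc length_merge us_def del: pieces.simps)
  then have len_mono: "length (pieces W k) \<le> length (pieces W k')" if "k \<le> k'" for k k'
    using lift_Suc_mono_le[of "\<lambda>k. length (pieces W k)" k k'] that by simp
  obtain J where J: "inf_min j J" using inf_min_exists[of j "Suc N"] dpos_le by (auto simp: j_def)
  obtain K0 where K0: "\<And>k. k \<ge> K0 \<Longrightarrow> J \<le> j k" using J by (auto simp: inf_min_def)
  \<comment> \<open>Otherwise nothing is ever merged from \<open>K0\<close> on, and the number of
    factors grows beyond \<open>N\<close>.\<close>
  have "J \<le> N"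
  proof (rule ccontr)
    assume "\<not> J \<le> N"
    then have "\<not> j k \<le> N" if "k \<ge> K0" for k using K0[OF that] by simp
    then have "length (pieces W (K0 + n)) = length (pieces W K0) + n" for n
      by (induction n) (simp_all add: len_Suc del: pieces.simps)
    from this[of "Suc N"] show False using len[of "K0 + Suc N"] by simp
  qed
  obtain k0 where k0: "k0 \<ge> K0" "j k0 = J" using J by (auto simp: inf_min_def)
  have "0 < J" using jb[of k0] k0 \<open>J \<le> N\<close> by simp
  \<comment> \<open>The number of factors never falls, since each step adds one and merges at most
    one pair. As \<open>J\<close> was a valid index at time \<open>k0\<close>, the boundaries up to
    index \<open>J\<close> are present from \<open>K\<close> on.\<close>
  define K where "K = Suc k0"
  have jK: "J \<le> j k" if "k \<ge> K" for k using K0[of k] that k0 by (simp add: K_def)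
  have "J < length (us k0)" using jb[of k0] k0 \<open>J \<le> N\<close> by simp
  then have "J \<le> length (pieces W K)" using len_Suc[of k0] by (simp add: K_def us_def del: pieces.simps)
  then have lenK: "J \<le> length (pieces W k)" if "k \<ge> K" for k using len_mono[OF that] by simp
  define pos where "pos k n = plen n (pieces W k)" for k n
  have pos_us: "plen n (us k) = pos k n" if "k \<ge> K" "n \<le> J" for k n
    using lenK[OF that(1)] that(2) by (simp add: pos_def us_def)
  have pos_Suc: "pos (Suc k) n = (if j k \<le> n \<and> j k \<le> N then plen (Suc n) (us k) else pos k n)"
    if "k \<ge> K" "n \<le> J" for k n
    using concat_take_merge[OF jb, of k n] pos_us[OF that] by (simp add: pos_def pieces_Suc del: pieces.simps)
  have fixed: "pos k n = pos K n" if "k \<ge> K" "n < J" for k n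
    using that(1)
  proof (induction k rule: dec_induct)
    case (step k)
    then show ?case using pos_Suc[of k n] jK[of k] that(2) by simp
  qed simp
  \<comment> \<open>Dropping boundary \<open>J\<close> moves the following boundary down to its
    index, and no factor is empty.\<close>
  have pos_event: "pos k J < pos (Suc k) J" if "k \<ge> K" "j k = J" for k
  proof -
    have "J < length (us k)" using jb[of k] that \<open>J \<le> N\<close> by simp
    then have "concat (take (Suc J) (us k)) = concat (take J (us k)) @ us k ! J"
      by (simp add: take_Suc_conv_app_nth)
    moreover have "us k ! J \<noteq> []"
      using nth_mem[OF \<open>J < length (us k)\<close>] pieces_nonempty[of W k] unfolding us_def by auto
    ultimately show ?thesis using pos_Suc[of k J] that \<open>J \<le> N\<close> pos_us[of k J] by simp
  qed
  have pos_step: "pos k J \<le> pos (Suc k) J" if "k \<ge> K" for k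
    using pos_event[OF that] pos_Suc[OF that, of J] jK[OF that] by (cases "j k = J") auto
  have pos_mono: "pos k J \<le> pos k' J" if "K \<le> k" "k \<le> k'" for k k'
    using that(2)
  proof (induction k' rule: dec_induct)
    case (step m)
    then show ?case using pos_step[of m] that(1) by simp
  qed simp
  have pieces_take: "concat (take n (us k)) = map W [0..<plen n (us k)]" for k n
    using length_concat_take_le[of n "us k"]
    by (subst concat_take_eq_take) (simp add: concat_us take_map del: upt_Suc)
  have pieces_drop: "concat (drop n (us k)) = map W [plen n (us k)..<Suc k]" for k n
  proof -
    have "concat (us k) = concat (take n (us k)) @ concat (drop n (us k))"
      by (metis append_take_drop_id concat_append)
    then have "concat (drop n (us k)) = drop (plen n (us k)) (concat (us k))"
      by simp
    then show ?thesis by (simp add: concat_us drop_map drop_upt del: upt_Suc)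
  qed
  have pos_le: "pos k J \<le> k" for k
    using length_concat_take_le[of J "pieces W k"] by (simp add: pos_def concat_pieces)
  define i where "i k = dsrc (map \<tau> (us k)) J" for k
  define a where "a k = \<tau> (map W [0..<pos k J])" for k
  define f where "f k = \<tau> (map W [pos K (i k)..<pos k J])" for k
  have event: "i k < J \<and> pos K (i k) \<le> pos k J \<and> \<tau> (map W [pos K (i k)..<Suc k]) = \<tau> (map W [pos k J..<Suc k])
      \<and> color (map \<tau> (us k)) = 2 * J + of_bool (accepting (a k) (f k))"
    if "k \<ge> K" "j k = J" for k
  proof -
    have dup: "dup (map \<tau> (us k)) (i k) J"
      using dup_dsrc[of "map \<tau> (us k)"] that \<open>J \<le> N\<close> by (simp add: i_def j_def)
    then have i: "i k < J" by (simp add: dup_def)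
    have pi: "plen (i k) (us k) = pos K (i k)"
      using pos_us[OF that(1), of "i k"] fixed[OF that(1) i] i by simp
    have pJ: "plen J (us k) = pos k J" using pos_us[OF that(1), of J] by simp
    have "\<tau> (concat (drop (i k) (us k))) = \<tau> (concat (drop J (us k)))"
      using dup by (simp add: dup_def drop_map ctype_map)
    then have eq: "\<tau> (map W [pos K (i k)..<Suc k]) = \<tau> (map W [pos k J..<Suc k])"
      by (simp only: pieces_drop pi pJ)
    have "take J (us k) = take (i k) (us k) @ take (J - i k) (drop (i k) (us k))"
      using i by (metis le_add_diff_inverse less_imp_le take_add)
    then have cat: "concat (take J (us k)) = concat (take (i k) (us k)) @ concat (take (J - i k) (drop (i k) (us k)))"
      by (metis concat_append)
    then have le: "pos K (i k) \<le> pos k J" using pi pJ by (metis length_append le_add1)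
    have "concat (take (J - i k) (drop (i k) (us k))) = drop (pos K (i k)) (concat (take J (us k)))"
      using cat pi by simp
    also have "\<dots> = map W [pos K (i k)..<pos k J]"
      by (subst pieces_take) (simp add: pJ drop_map drop_upt)
    finally have "ctype (take (J - i k) (drop (i k) (map \<tau> (us k)))) = f k"
      by (simp add: f_def drop_map take_map ctype_map)
    moreover have "ctype (take J (map \<tau> (us k))) = a k"
      using pieces_take[of J k] by (simp add: take_map ctype_map a_def pJ)
    ultimately have "color (map \<tau> (us k)) = 2 * J + of_bool (accepting (a k) (f k))"
      using that(2) \<open>J \<le> N\<close> by (simp add: color_def Let_def j_def i_def)
    then show ?thesis using i eq le by blast
  qed
  define E where "E = {k. k \<ge> K \<and> j k = J}"
  have claim: "accepting a' f' \<longleftrightarrow> L W" if inf: "infinite {k \<in> E. (i k, a k, f k) = (i', a', f')}" for i' a' f'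
  proof -
    define F where "F = {k \<in> E. (i k, a k, f k) = (i', a', f')}"
    have "infinite F" using inf by (simp only: F_def not_False_eq_True)
    have E: "k \<ge> K" "j k = J" "i k = i'" "a k = a'" "f k = f'" if "k \<in> F" for k
      using that by (auto simp: E_def F_def)
    have less: "pos k J < pos k' J" if "k \<in> F" "k < k'" for k k'
      using pos_event[OF E(1,2)[OF that(1)]] pos_mono[of "Suc k" k'] E(1)[OF that(1)] that(2) by simp
    have "inj_on (\<lambda>k. pos k J) F"
    proof (rule inj_onI)
      fix k k' assume "k \<in> F" "k' \<in> F" "pos k J = pos k' J"
      then show "k = k'" using less[of k k'] less[of k' k] by (cases k k' rule: linorder_cases) simp_all
    qed
    then have "infinite ((\<lambda>k. pos k J) ` F)" using \<open>infinite F\<close> finite_imageD by blast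
    then have unb: "\<exists>k\<in>F. m < pos k J" for m unfolding infinite_nat_iff_unbounded by blast
    \<comment> \<open>Each selected boundary lies beyond the time of the previous event, so the
      equality of types observed at that event can be prolonged up to it.\<close>
    obtain ks where ks: "\<And>n. ks n \<in> F" "\<And>n. ks n < pos (ks (Suc n)) J"
      using dependent_nat_choice[of "\<lambda>_ k. k \<in> F" "\<lambda>_ k k'. k < pos k' J"] unb by metis
    define g where "g n = (case n of 0 \<Rightarrow> 0 | Suc m \<Rightarrow> pos (ks m) J)" for n
    have g0: "0 < pos (ks 0) J"
    proof -
      have "J \<le> length (pieces W (ks 0))" using lenK E(1)[OF ks(1)] by blast
      then obtain u vs where u: "pieces W (ks 0) = u # vs" using \<open>0 < J\<close> by (cases "pieces W (ks 0)") auto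
      then have "u \<noteq> []" using pieces_nonempty[of W "ks 0"] by auto
      then show ?thesis using u \<open>0 < J\<close> by (cases J) (auto simp: pos_def)
    qed
    have gS: "pos (ks n) J < pos (ks (Suc n)) J" for n using ks(2)[of n] pos_le[of "ks n"] by simp
    have "strict_mono g"
      by (rule strict_mono_Suc_iff[THEN iffD2]) (auto simp: g_def g0 gS split: nat.split)
    moreover have "g 0 = 0" by (simp add: g_def)
    moreover have "\<tau> (seg W g 0) = a'" using E(4)[OF ks(1)[of 0]] by (simp add: seg_def g_def a_def)
    \<comment> \<open>At event \<open>ks n\<close> the stretches from the fixed boundary
      \<open>i'\<close> and from the dropped one to the present have equal types. Appending the
      letters up to the next selected boundary lets the fixed start replace the moving one, and from
      the fixed start the type is \<open>f'\<close>.\<close>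
    moreover have "\<tau> (seg W g (Suc n)) = f'" for n
    proof -
      let ?k = "ks n" and ?k' = "ks (Suc n)"
      note ev = event[OF E(1,2)[OF ks(1)]] and e = E[OF ks(1)]
      have "[pos ?k J..<pos ?k' J] = [pos ?k J..<Suc ?k] @ [Suc ?k..<pos ?k' J]"
        using pos_le[of ?k] ks(2)[of n] by (metis le_SucI le_add_diff_inverse Suc_leI upt_add_eq_append)
      moreover have "[pos K i'..<pos ?k' J] = [pos K i'..<Suc ?k] @ [Suc ?k..<pos ?k' J]"
        using pos_le[of ?k] ks(2)[of n] ev[of n] e(3)[of n]
        by (metis le_SucI le_trans le_add_diff_inverse Suc_leI upt_add_eq_append)
      ultimately have "\<tau> (map W [pos ?k J..<pos ?k' J]) = \<tau> (map W [pos K i'..<pos ?k' J])"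
        using type_append[OF ev[of n, THEN conjunct2, THEN conjunct2, THEN conjunct1] refl, of "map W [Suc ?k..<pos ?k' J]"] e(3)[of n]
        by (simp del: upt_Suc)
      also have "\<dots> = f'" using e(3,5)[of "Suc n"] by (simp add: f_def)
      finally show ?thesis by (simp add: seg_def g_def)
    qed
    ultimately show ?thesis
      unfolding accepting_def
    proof (intro iffI)
      assume g: "strict_mono g" "g 0 = 0" "\<tau> (seg W g 0) = a'" "\<And>n. \<tau> (seg W g (Suc n)) = f'"
      assume "\<exists>W g. strict_mono g \<and> g 0 = 0 \<and> \<tau> (seg W g 0) = a' \<and> (\<forall>i. \<tau> (seg W g (Suc i)) = f') \<and> L W"
      then obtain W' g' where g': "strict_mono g'" "g' 0 = 0" "\<tau> (seg W' g' 0) = a'"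
        "\<And>i. \<tau> (seg W' g' (Suc i)) = f'" "L W'" by blast
      have "\<tau> (seg W g n) = \<tau> (seg W' g' n)" for n using g g' by (cases n) auto
      then show "L W" using type_omega[OF g(1,2) g'(1,2)] g'(5) by blast
    qed blast
  qed
  have "infinite E"
    unfolding infinite_nat_iff_unbounded_le
  proof
    fix m
    obtain k where "k \<ge> max m K" "j k = J" using J unfolding inf_min_def by blast
    then show "\<exists>n\<ge>m. n \<in> E" by (auto simp: E_def)
  qed
  define B where "B = {k \<in> E. accepting (a k) (f k) \<noteq> L W}"
  \<comment> \<open>If infinitely many events guessed wrongly, one triple would recur infinitely
    often among them, against \<open>claim\<close>.\<close>
  have "finite B"
  proof (rule ccontr)
    assume "infinite B"
    have "(\<lambda>k. (i k, a k, f k)) ` B \<subseteq> {..<J} \<times> {..<N} \<times> {..<N}"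
      using event by (auto simp: B_def E_def a_def f_def type_less)
    then have "finite ((\<lambda>k. (i k, a k, f k)) ` B)" by (rule finite_subset) simp
    then obtain k where k: "k \<in> B" "infinite {n \<in> B. (i n, a n, f n) = (i k, a k, f k)}"
      using pigeonhole_infinite[OF \<open>infinite B\<close>, of "\<lambda>k. (i k, a k, f k)"] by blast
    have "infinite {n \<in> E. (i n, a n, f n) = (i k, a k, f k)}"
      by (rule infinite_super[OF _ k(2)]) (auto simp: B_def)
    then have "accepting (a k) (f k) \<longleftrightarrow> L W" by (rule claim)
    then show False using k(1) by (simp add: B_def)
  qed
  then obtain M where M: "\<And>k. k \<in> B \<Longrightarrow> k < M" by (metis finite_nat_iff_bounded lessThan_iff subsetD)
  let ?c = "2 * J + of_bool (L W)"
  have col: "color (map \<tau> (us k)) = ?c" if "k \<ge> M" "k \<in> E" for k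
  proof -
    have "k \<notin> B" using M[of k] that by auto
    then show ?thesis using event[of k] that(2) by (simp add: B_def E_def)
  qed
  have "inf_min (\<lambda>k. color (map \<tau> (us k))) ?c"
    unfolding inf_min_def
  proof (intro conjI allI)
    fix m
    obtain k where "k \<ge> max m M" "k \<in> E" using \<open>infinite E\<close> unfolding infinite_nat_iff_unbounded_le by blast
    then show "\<exists>n\<ge>m. color (map \<tau> (us n)) = ?c" using col by (intro exI[of _ k]) auto
  next
    have "?c \<le> color (map \<tau> (us k))" if "k \<ge> max M K" for k
    proof (cases "j k = J")
      case True
      then show ?thesis using col[of k] that by (simp add: E_def)
    next
      case False
      then have "Suc J \<le> j k" using jK[of k] that by simp
      moreover have "2 * j k \<le> color (map \<tau> (us k))" by (simp add: color_def Let_def j_def)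
      ultimately show ?thesis by (simp add: of_bool_def)
    qed
    then show "\<exists>m. \<forall>n\<ge>m. ?c \<le> color (map \<tau> (us n))" by blast
  qed
  then show ?thesis by (intro exI[of _ ?c]) (simp add: us_types)
qed

end

section \<open>Games on finite graphs\<close>

definition cycle :: "'v list \<Rightarrow> 'v \<Rightarrow> 'v set" where
  "cycle s v = set (dropWhile (\<lambda>x. x \<noteq> v) s)"

definition advance :: "'v list \<Rightarrow> 'v \<Rightarrow> 'v list" where
  "advance s v = (if v \<in> set s then takeWhile (\<lambda>x. x \<noteq> v) s @ [v] else s @ [v])"

definition stacks :: "'v set \<Rightarrow> 'v list set" where
  "stacks V = {s. s \<noteq> [] \<and> distinct s \<and> set s \<subseteq> V}"

lemma finite_stacks: "finite V \<Longrightarrow> finite (stacks V)"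
  by (rule finite_subset[OF _ finite_lists_length_le[of V "card V"]])
    (auto simp: stacks_def card_mono simp flip: distinct_card)

lemma last_advance [simp]: "last (advance s v) = v"
  by (simp add: advance_def)

lemma advance_stacks: "s \<in> stacks V \<Longrightarrow> v \<in> V \<Longrightarrow> advance s v \<in> stacks V"
  by (auto simp: stacks_def advance_def dest: set_takeWhileD)

text \<open>Cutting a cycle leaves a prefix of the stack, so a property of all prefixes survives the
  cut.\<close>

lemma advance_eq_take:
  assumes "v \<in> set s"
  shows "advance s v = take (Suc (length (takeWhile (\<lambda>x. x \<noteq> v) s))) s"
proof -
  have "dropWhile (\<lambda>x. x \<noteq> v) s \<noteq> []" using assms by (simp add: dropWhile_eq_Nil_conv)
  then obtain ys where "dropWhile (\<lambda>x. x \<noteq> v) s = v # ys"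
    using hd_dropWhile[of "\<lambda>x. x \<noteq> v" s] by (cases "dropWhile (\<lambda>x. x \<noteq> v) s") auto
  then have "s = takeWhile (\<lambda>x. x \<noteq> v) s @ v # ys" by (metis takeWhile_dropWhile_id)
  then show ?thesis using assms by (metis advance_def append_Cons append_Nil append_assoc
    append_eq_conv_conj length_append_singleton)
qed

text \<open>The number of stacked vertices of color \<open>c\<close>, minus a large multiple of the number of those of
  smaller color, would increase with every visit to color \<open>c\<close>.\<close>

lemma stack_inf_min:
  fixes v :: "nat \<Rightarrow> 'v" and pr :: "'v \<Rightarrow> nat"
  assumes "finite V" and vV: "\<And>t. v t \<in> V"
    and s0: "s 0 = [v 0]" and s_Suc: "\<And>t. s (Suc t) = advance (s t) (v (Suc t))"
    and good: "\<And>t. v (Suc t) \<in> set (s t) \<Longrightarrow> Good (Min (pr ` cycle (s t) (v (Suc t))))"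
    and c: "inf_min (\<lambda>t. pr (v t)) c"
  shows "Good c"
proof (rule ccontr)
  assume bad: "\<not> Good c"
  have st: "s t \<in> stacks V" for t
    by (induction t) (use s0 s_Suc vV in \<open>auto intro: advance_stacks simp: stacks_def[THEN eqset_imp_iff, of "[_]"]\<close>)
  obtain T where T: "\<And>t. t \<ge> T \<Longrightarrow> c \<le> pr (v t)" using c by (auto simp: inf_min_def)
  define cnt where "cnt R A = int (card {x \<in> A. R (pr x)})" for R A
  have cnt_Un: "cnt R (A \<union> B) = cnt R A + cnt R B" if "finite A" "finite B" "A \<inter> B = {}" for R A B
  proof -
    have "{x \<in> A \<union> B. R (pr x)} = {x \<in> A. R (pr x)} \<union> {x \<in> B. R (pr x)}" by auto
    moreover have "card ({x \<in> A. R (pr x)} \<union> {x \<in> B. R (pr x)}) = card {x \<in> A. R (pr x)} + card {x \<in> B. R (pr x)}"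
      using that by (intro card_Un_disjoint) auto
    ultimately show ?thesis by (simp add: cnt_def)
  qed
  have "{y \<in> {x}. R (pr y)} = (if R (pr x) then {x} else {})" for R x by auto
  then have cnt_single: "cnt R {x} = of_bool (R (pr x))" for R x by (simp add: cnt_def)
  define C where "C = cnt (\<lambda>n. n = c)"
  define Lo where "Lo = cnt (\<lambda>n. n < c)"
  \<comment> \<open>The weight exceeds the number of vertices of color \<open>c\<close> that can
    leave the stack together with one vertex of smaller color.\<close>
  define \<Phi> where "\<Phi> A = C A - (int (card V) + 1) * Lo A" for A
  note C_def = C_def cnt_def and Lo_def = Lo_def cnt_def
    and CUn = cnt_Un[of _ _ "\<lambda>n. n = c", folded C_def] and LUn = cnt_Un[of _ _ "\<lambda>n. n < c", folded Lo_def]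
    and single = cnt_single[of "\<lambda>n. n = c", folded C_def] cnt_single[of "\<lambda>n. n < c", folded Lo_def]
  have CV: "C A \<le> int (card V)" if "A \<subseteq> V" for A
    unfolding C_def using that \<open>finite V\<close> by (auto intro!: card_mono)
  have pos: "0 \<le> C A" "0 \<le> Lo A" for A by (simp_all add: C_def Lo_def)
  have potential: "\<Phi> (set (s t)) + of_bool (pr (v (Suc t)) = c) \<le> \<Phi> (set (s (Suc t)))" if "t \<ge> T" for t
  proof -
    let ?v = "v (Suc t)"
    have nlow: "\<not> pr ?v < c" using T[of "Suc t"] that by simp
    show ?thesis
    proof (cases "?v \<in> set (s t)")
      case False
      then have "set (s (Suc t)) = set (s t) \<union> {?v}" by (simp add: s_Suc advance_def)
      then show ?thesis using False nlow CUn[of "set (s t)" "{?v}"] LUn[of "set (s t)" "{?v}"]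
        by (simp add: \<Phi>_def single)
    next
      case True
      define A where "A = set (takeWhile (\<lambda>x. x \<noteq> ?v) (s t))"
      define D where "D = cycle (s t) ?v"
      have un: "set (s t) = A \<union> D"
        unfolding A_def D_def cycle_def by (metis set_append takeWhile_dropWhile_id)
      have "distinct (takeWhile (\<lambda>x. x \<noteq> ?v) (s t) @ dropWhile (\<lambda>x. x \<noteq> ?v) (s t))"
        using st[of t] by (simp add: stacks_def)
      then have disj: "A \<inter> D = {}" unfolding A_def D_def cycle_def distinct_append by blast
      have fin: "finite A" "finite D" by (auto simp: A_def D_def cycle_def)
      have "?v \<notin> A" unfolding A_def by (auto dest: set_takeWhileD)
      then have "?v \<in> D" using True un by auto
      have new: "set (s (Suc t)) = A \<union> {?v}" using True by (simp add: s_Suc advance_def A_def)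
      have e1: "\<Phi> (set (s t)) = C A + C D - (int (card V) + 1) * (Lo A + Lo D)"
        unfolding un \<Phi>_def CUn[OF fin disj] LUn[OF fin disj] ..
      have e2: "\<Phi> (set (s (Suc t))) = C A + of_bool (pr ?v = c) - (int (card V) + 1) * Lo A"
        using CUn[OF fin(1), of "{?v}"] LUn[OF fin(1), of "{?v}"] \<open>?v \<notin> A\<close> nlow
        unfolding new \<Phi>_def by (simp add: single)
      show ?thesis
      \<comment> \<open>If the cycle has no smaller color, it has no vertex of color
        \<open>c\<close> either, as its least color would then be the bad \<open>c\<close>; removing
        it costs nothing. If it has one, the weight regained outweighs all vertices of color
        \<open>c\<close> that are lost.\<close>
      proof (cases "Lo D = 0")
        case True
        then have ge: "c \<le> pr x" if "x \<in> D" for x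
          using that fin(2) by (auto simp: Lo_def)
        have "pr x \<noteq> c" if "x \<in> D" for x
        proof
          assume "pr x = c"
          then have "Min (pr ` D) = c" using that ge fin(2) by (intro Min_eqI) auto
          then show False using good[OF \<open>?v \<in> set (s t)\<close>] bad by (simp add: D_def)
        qed
        then have "{x \<in> D. pr x = c} = {}" "pr ?v \<noteq> c" using \<open>?v \<in> D\<close> by blast+
        then have "C D = 0" "pr ?v \<noteq> c" by (simp_all only: C_def card.empty of_nat_0 not_False_eq_True)
        then show ?thesis using e1 e2 True by simp
      next
        case False
        then have "1 \<le> Lo D" using pos(2)[of D] by simp
        then have "(int (card V) + 1) * 1 \<le> (int (card V) + 1) * Lo D" by (intro mult_left_mono) auto
        moreover have "C D \<le> int (card V)" using CV[of D] st[of t] un by (auto simp: stacks_def)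
        ultimately show ?thesis using e1 e2 by (simp add: algebra_simps)
      qed
    qed
  qed
  have mono: "\<Phi> (set (s T')) \<le> \<Phi> (set (s t))" if "T \<le> T'" "T' \<le> t" for T' t
    using that(2)
  proof (induction t rule: dec_induct)
    case (step t)
    have "0 \<le> (of_bool (pr (v (Suc t)) = c) :: int)" by simp
    then show ?case using step.IH potential[of t] step.hyps that(1) by linarith
  qed simp
  have "\<exists>t\<ge>T. \<Phi> (set (s T)) + int n \<le> \<Phi> (set (s t))" for n
  proof (induction n)
    case (Suc n)
    then obtain t where t: "t \<ge> T" "\<Phi> (set (s T)) + int n \<le> \<Phi> (set (s t))" by blast
    obtain m where m: "m \<ge> Suc t" "pr (v m) = c" using c unfolding inf_min_def by blast
    then obtain m' where m': "m = Suc m'" by (cases m) auto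
    have "\<Phi> (set (s m')) + 1 \<le> \<Phi> (set (s m))" using potential[of m'] m t(1) m' by simp
    moreover have "\<Phi> (set (s t)) \<le> \<Phi> (set (s m'))" using mono[of t m'] t(1) m m' by simp
    ultimately show ?case using t m by (intro exI[of _ m]) simp
  qed auto
  then obtain t where t: "\<Phi> (set (s T)) + int (nat (int (card V) - \<Phi> (set (s T)) + 1)) \<le> \<Phi> (set (s t))" by blast
  have "\<Phi> (set (s t)) \<le> C (set (s t))" using pos(2) by (simp add: \<Phi>_def)
  also have "\<dots> \<le> int (card V)" using CV st[of t] by (auto simp: stacks_def)
  finally show False using t by linarith
qed

text \<open>The finite game that stops as soon as a vertex repeats and is won according to the least color
  of the cycle closed. A winning strategy for it is replayed forever by cutting every closed
  cycle off the stack of visited vertices.\<close>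

primrec wins :: "('v \<Rightarrow> bool \<Rightarrow> bool \<Rightarrow> 'v) \<Rightarrow> ('v set \<Rightarrow> bool) \<Rightarrow> nat \<Rightarrow> 'v list \<Rightarrow> bool" where
  "wins \<delta> Q 0 s \<longleftrightarrow> True"
| "wins \<delta> Q (Suc n) s \<longleftrightarrow> (\<forall>x. \<exists>y. let v = \<delta> (last s) x y in
     if v \<in> set s then Q (cycle s v) else wins \<delta> Q n (s @ [v]))"

text \<open>Backward induction on the finite game. One player commits to \<open>x\<close> before the
  reply \<open>y\<close>, so \<open>\<sigma>\<close> may see \<open>x\<close> while
  \<open>\<xi>\<close> depends on the stack alone; this asymmetry later gives a machine whose output
  ignores its present input.\<close>

lemma game_determined:
  fixes \<delta> :: "'v \<Rightarrow> bool \<Rightarrow> bool \<Rightarrow> 'v" and pr :: "'v \<Rightarrow> nat" and Win :: "nat \<Rightarrow> bool"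
  assumes "finite V" "v0 \<in> V" and closed: "\<forall>v\<in>V. \<forall>x y. \<delta> v x y \<in> V"
  shows "(\<exists>\<sigma>. \<forall>x v s c. v 0 = v0 \<and> s 0 = [v0] \<and>
        (\<forall>t. v (Suc t) = \<delta> (v t) (x t) (\<sigma> (s t) (x t)) \<and> s (Suc t) = advance (s t) (v (Suc t))) \<and>
        inf_min (\<lambda>t. pr (v t)) c \<longrightarrow> Win c) \<or>
     (\<exists>\<xi>. \<forall>y v s c. v 0 = v0 \<and> s 0 = [v0] \<and>
        (\<forall>t. v (Suc t) = \<delta> (v t) (\<xi> (s t)) (y t) \<and> s (Suc t) = advance (s t) (v (Suc t))) \<and>
        inf_min (\<lambda>t. pr (v t)) c \<longrightarrow> \<not> Win c)"
proof -
  define Q where "Q A \<longleftrightarrow> Win (Min (pr ` A))" for A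
  \<comment> \<open>A simple path has at most \<open>card V\<close> vertices, so the fuel is
    positive on every stack and the value of \<open>wins\<close> at 0 is never consulted.\<close>
  define W where "W s = wins \<delta> Q (Suc (card V) - length s) s" for s
  have W: "W s \<longleftrightarrow> (\<forall>x. \<exists>y. let v = \<delta> (last s) x y in if v \<in> set s then Q (cycle s v) else W (s @ [v]))"
    if "s \<in> stacks V" for s
  proof -
    have "length s \<le> card V" using that \<open>finite V\<close> distinct_card[of s] card_mono[of V "set s"]
      by (auto simp: stacks_def)
    then have "Suc (card V) - length s = Suc (card V - length s)" by simp
    then show ?thesis by (simp add: W_def)
  qed
  have last_V: "last s \<in> V" if "s \<in> stacks V" for s using that by (auto simp: stacks_def)
  \<comment> \<open>All nonempty prefixes have to be winning, not just the current stack, because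
    play resumes from a prefix whenever a cycle closes.\<close>
  define inv where "inv R s \<longleftrightarrow> s \<in> stacks V \<and> (\<forall>k. 0 < k \<and> k \<le> length s \<longrightarrow> R (take k s))"
    for R :: "'v list \<Rightarrow> bool" and s
  have inv_advance: "inv R (advance s v)" if "inv R s" "v \<in> V" "v \<notin> set s \<Longrightarrow> R (s @ [v])" for R s v
  proof (cases "v \<in> set s")
    case True
    then show ?thesis
      using that(1,2) advance_stacks[of s V v] unfolding inv_def
      by (simp add: advance_eq_take min_def)
  next
    case False
    then show ?thesis
      using that advance_stacks[of s V v] unfolding inv_def
      by (auto simp: advance_def le_Suc_eq)
  qed
  have inv_R: "R s" "s \<in> stacks V" if "inv R s" for R s
    using that unfolding inv_def by (auto simp: stacks_def dest: spec[of _ "length s"])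
  have init: "[v0] \<in> stacks V" using \<open>v0 \<in> V\<close> by (simp add: stacks_def)
  show ?thesis
  proof (cases "W [v0]")
    case True
    define \<sigma> where "\<sigma> s x = (SOME y. let v = \<delta> (last s) x y in if v \<in> set s then Q (cycle s v) else W (s @ [v]))" for s x
    have \<sigma>: "let v = \<delta> (last s) x (\<sigma> s x) in if v \<in> set s then Q (cycle s v) else W (s @ [v])"
      if "inv W s" for s x
      unfolding \<sigma>_def by (rule someI_ex) (use W inv_R[OF that] in blast)
    have "Win c" if v0: "v 0 = v0" and s0: "s 0 = [v0]"
      and step: "\<And>t. v (Suc t) = \<delta> (v t) (x t) (\<sigma> (s t) (x t)) \<and> s (Suc t) = advance (s t) (v (Suc t))"
      and c: "inf_min (\<lambda>t. pr (v t)) c" for x v s c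
    proof -
      have inv: "inv W (s t) \<and> last (s t) = v t" for t
      proof (induction t)
        case 0
        then show ?case using s0 v0 True init by (auto simp: inv_def le_Suc_eq)
      next
        case (Suc t)
        have "v (Suc t) \<in> V" using step[of t] closed last_V inv_R(2) Suc by metis
        moreover have "W (s t @ [v (Suc t)])" if "v (Suc t) \<notin> set (s t)"
          using \<sigma>[of "s t" "x t"] Suc step[of t] that by (simp add: Let_def)
        ultimately show ?case using Suc step[of t] inv_advance[of W "s t" "v (Suc t)"] by simp
      qed
      show ?thesis
      proof (rule stack_inf_min[OF \<open>finite V\<close> _ _ _ _ c])
        show "v t \<in> V" for t using inv[of t] last_V inv_R(2) by metis
        show "Win (Min (pr ` cycle (s t) (v (Suc t))))" if "v (Suc t) \<in> set (s t)" for t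
          using \<sigma>[of "s t" "x t"] inv[of t] step[of t] that by (simp add: Let_def Q_def)
      qed (use s0 v0 step in auto)
    qed
    then show ?thesis by blast
  next
    case False
    define \<xi> where "\<xi> s = (SOME x. \<forall>y. let v = \<delta> (last s) x y in if v \<in> set s then \<not> Q (cycle s v) else \<not> W (s @ [v]))" for s
    have \<xi>: "\<forall>y. let v = \<delta> (last s) (\<xi> s) y in if v \<in> set s then \<not> Q (cycle s v) else \<not> W (s @ [v])"
      if "inv (\<lambda>s. \<not> W s) s" for s
    proof -
      have "\<not> W s" "s \<in> stacks V" using inv_R[OF that] by auto
      then have "\<exists>x. \<forall>y. let v = \<delta> (last s) x y in if v \<in> set s then \<not> Q (cycle s v) else \<not> W (s @ [v])"
        using W[of s] by (smt (verit))
      then show ?thesis unfolding \<xi>_def by (rule someI_ex)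
    qed
    have "\<not> Win c" if v0: "v 0 = v0" and s0: "s 0 = [v0]"
      and step: "\<And>t. v (Suc t) = \<delta> (v t) (\<xi> (s t)) (y t) \<and> s (Suc t) = advance (s t) (v (Suc t))"
      and c: "inf_min (\<lambda>t. pr (v t)) c" for y v s c
    proof -
      have inv: "inv (\<lambda>s. \<not> W s) (s t) \<and> last (s t) = v t" for t
      proof (induction t)
        case 0
        then show ?case using s0 v0 False init by (auto simp: inv_def le_Suc_eq)
      next
        case (Suc t)
        have "v (Suc t) \<in> V" using step[of t] closed last_V inv_R(2) Suc by metis
        moreover have "\<not> W (s t @ [v (Suc t)])" if "v (Suc t) \<notin> set (s t)"
          using \<xi>[of "s t"] Suc step[of t] that by (simp add: Let_def)
        ultimately show ?case using Suc step[of t] inv_advance[of "\<lambda>s. \<not> W s" "s t" "v (Suc t)"] by simp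
      qed
      show ?thesis
      proof (rule stack_inf_min[OF \<open>finite V\<close> _ _ _ _ c, where Good = "\<lambda>c. \<not> Win c"])
        show "v t \<in> V" for t using inv[of t] last_V inv_R(2) by metis
        show "\<not> Win (Min (pr ` cycle (s t) (v (Suc t))))" if "v (Suc t) \<in> set (s t)" for t
          using \<xi>[of "s t", THEN spec, of "y t"] inv[of t] step[of t] that by (simp add: Let_def Q_def)
      qed (use s0 v0 step in auto)
    qed
    then show ?thesis by blast
  qed
qed

section \<open>Determinacy by finite machines for ultimately periodic parameters\<close>

definition play :: "nat set \<Rightarrow> nat set \<Rightarrow> nat set \<Rightarrow> nat \<Rightarrow> nat \<Rightarrow> bool" where
  "play X Y P i z \<longleftrightarrow> z = 1 \<and> i \<in> X \<or> z = 3 \<and> i \<in> Y \<or> z = 5 \<and> i \<in> P"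

lemma holds_XYP_iff:
  assumes "formula_XYP \<psi>"
  shows "holds_XYP \<psi> X Y P \<longleftrightarrow> wsat \<psi> (play X Y P)"
  unfolding holds_XYP_def sat_eq_wsat
proof (rule wsat_cong)
  fix n z assume "z \<in> vars \<psi>"
  then obtain V where "z = 2 * V + 1" "V \<in> {0, 1, 2}"
    using assms by (auto simp: formula_XYP_def vars_def)
  then show "env_word (\<lambda>_. 0) ((\<lambda>_. {})(0 := X, 1 := Y, 2 := P)) n z = play X Y P n z"
    by (auto simp: env_word_def play_def)
qed

lemma holds_XP_iff:
  assumes "formula_XP \<alpha>"
  shows "holds_XP \<alpha> X P \<longleftrightarrow> wsat \<alpha> (play X {} P)"
proof -
  have "(\<lambda>_::nat. {})(0 := X, 2 := P) = (\<lambda>_. {})(0 := X, 1 := {}, 2 := P)" by (auto simp: fun_eq_iff)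
  then have "holds_XP \<alpha> X P \<longleftrightarrow> holds_XYP \<alpha> X {} P" by (simp only: holds_XP_def holds_XYP_def)
  then show ?thesis using assms by (subst holds_XYP_iff[symmetric]) (auto simp: formula_XP_def formula_XYP_def)
qed

lemma ultimately_periodic_lasso:
  assumes "ultimately_periodic P"
  obtains p q where "0 < q" "\<And>i. i \<in> P \<longleftrightarrow> lasso p q i \<in> P"
proof -
  obtain q d where q: "0 < q" "\<And>n. n > d \<Longrightarrow> n \<in> P \<longleftrightarrow> n + q \<in> P"
    using assms unfolding ultimately_periodic_def by blast
  have shift: "n \<in> P \<longleftrightarrow> n + q * k \<in> P" if "n > d" for n k
  proof (induction k)
    case (Suc k)
    then show ?case using q(2)[of "n + q * k"] that by (simp add: algebra_simps)
  qed simp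
  \<comment> \<open>The stem has length \<open>Suc d\<close> because periodicity is only given for
    numbers strictly above \<open>d\<close>.\<close>
  have "i \<in> P \<longleftrightarrow> lasso (Suc d) q i \<in> P" for i
  proof (cases "i < Suc d")
    case False
    then have "i = Suc d + (i - Suc d) mod q + q * ((i - Suc d) div q)" by simp
    then show ?thesis using shift[of "Suc d + (i - Suc d) mod q" "(i - Suc d) div q"] False
      by (simp add: lasso_def)
  qed (simp add: lasso_def)
  then show ?thesis using that q(1) by blast
qed

text \<open>Used because a vertex of the game stores the color of the transition that led to it, one
  step late.\<close>

lemma inf_min_Suc:
  assumes "inf_min (\<lambda>n. f (Suc n)) c"
  shows "inf_min f c"
proof -
  obtain m where m: "\<And>n. n \<ge> m \<Longrightarrow> c \<le> f (Suc n)" using assms by (auto simp: inf_min_def)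
  have "c \<le> f n" if "n \<ge> Suc m" for n using m[of "n - 1"] that by simp
  moreover have "\<exists>n\<ge>k. f n = c" for k
  proof -
    obtain n where "n \<ge> k" "f (Suc n) = c" using assms by (auto simp: inf_min_def)
    then show ?thesis by (intro exI[of _ "Suc n"]) simp
  qed
  ultimately show ?thesis unfolding inf_min_def by blast
qed

definition letter3 :: "bool \<times> bool \<times> bool \<Rightarrow> nat \<Rightarrow> bool" where
  "letter3 a z \<longleftrightarrow> z = 1 \<and> fst a \<or> z = 3 \<and> fst (snd a) \<or> z = 5 \<and> snd (snd a)"

lemma omega_type_ty: "omega_type (\<lambda>u. ty \<phi> (map h u)) (ty_bound \<phi>) (\<lambda>W. wsat \<phi> (\<lambda>i. h (W i)))"
proof
  show "ty \<phi> (map h u) < ty_bound \<phi>" for u by (rule ty_less)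
next
  fix u u' v v' assume "ty \<phi> (map h u) = ty \<phi> (map h u')" "ty \<phi> (map h v) = ty \<phi> (map h v')"
  then show "ty \<phi> (map h (u @ v)) = ty \<phi> (map h (u' @ v'))" unfolding map_append by (rule ty_append)
next
  fix g g' :: "nat \<Rightarrow> nat" and W W'
  assume g: "strict_mono g" "g 0 = 0" "strict_mono g'" "g' 0 = 0"
    and *: "\<And>i. ty \<phi> (map h (seg W g i)) = ty \<phi> (map h (seg W' g' i))"
  have seg_map: "seg (\<lambda>i. h (W i)) g i = map h (seg W g i)" for W g i by (simp add: seg_def)
  show "wsat \<phi> (\<lambda>i. h (W i)) \<longleftrightarrow> wsat \<phi> (\<lambda>i. h (W' i))"
    by (rule wsat_seg_cong[OF g]) (simp only: seg_map *)
qed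

lemma machine_encode:
  fixes nx :: "'s \<Rightarrow> 'a \<Rightarrow> 's" and out :: "'s \<Rightarrow> 'a \<Rightarrow> 'b"
  assumes "finite S" "s0 \<in> S" "\<And>s a. s \<in> S \<Longrightarrow> nx s a \<in> S"
  obtains n :: nat and q0 \<delta> out' where "transition_system {..<n} q0 \<delta>"
    "\<And>x i. machine_op q0 \<delta> out' x i = out (foldl nx s0 (map x [0..<i])) (x i)"
    "\<And>q a b. (\<And>s. out s a = out s b) \<Longrightarrow> out' q a = out' q b"
proof -
  obtain e where e: "bij_betw e S {..<card S}"
    using ex_bij_betw_finite_nat[OF assms(1)] by (auto simp: atLeast0LessThan)
  define d where "d = the_inv_into S e"
  have de: "d (e s) = s" if "s \<in> S" for s
    using e that by (simp add: d_def bij_betw_def the_inv_into_f_f)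
  have dS: "d q \<in> S" if "q < card S" for q
    using e that unfolding d_def by (intro the_inv_into_into) (auto simp: bij_betw_def)
  have eS: "e s < card S" if "s \<in> S" for s using e that by (auto simp: bij_betw_def)
  define \<delta> where "\<delta> q a = e (nx (d q) a)" for q a
  define out' where "out' q a = out (d q) a" for q a
  have "transition_system {..<card S} (e s0) \<delta>"
    using assms dS eS by (auto simp: transition_system_def \<delta>_def)
  moreover have fold: "foldl nx s0 w \<in> S \<and> foldl \<delta> (e s0) w = e (foldl nx s0 w)" for w
    by (induction w rule: rev_induct) (use assms in \<open>auto simp: \<delta>_def de\<close>)
  have "machine_op (e s0) \<delta> out' x i = out (foldl nx s0 (map x [0..<i])) (x i)" for x i
    using fold by (simp add: machine_op_def out'_def de)
  moreover have "out' q a = out' q b" if "\<And>s. out s a = out s b" for q a b using that by (simp add: out'_def)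
  ultimately show ?thesis by (rule that)
qed

text \<open>A vertex consists of the automaton state, the color just produced and the current
  position on the lasso of \<open>P\<close>, so the machines need not read \<open>P\<close>. The
  second alternative is stronger than condition (2): the output does not depend on the present
  letter of \<open>Y\<close>, as \<open>mutual_play\<close> requires.\<close>

theorem machine_determinacy:
  fixes \<psi> :: mlo
  assumes "0 < per" and lasso_P: "\<And>i. i \<in> P \<longleftrightarrow> lasso pre per i \<in> P"
  shows "(\<exists>(n::nat) q0 \<delta> out. transition_system {..<n} q0 \<delta> \<and>
      (\<forall>X. wsat \<psi> (play X (apply_op2 (machine_op q0 \<delta> out) X P) P))) \<or>
    (\<exists>(n::nat) q0 \<delta> out. transition_system {..<n} q0 \<delta> \<and> (\<forall>q x y p. out q (x, p) = out q (y, p)) \<and>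
      (\<forall>Y. \<not> wsat \<psi> (play (apply_op2 (machine_op q0 \<delta> out) Y P) Y P)))"
proof -
  interpret omega_type "\<lambda>u. ty \<psi> (map letter3 u)" "ty_bound \<psi>" "\<lambda>W. wsat \<psi> (\<lambda>i. letter3 (W i))"
    by (rule omega_type_ty)
  let ?t = "\<lambda>a. ty \<psi> (map letter3 [a])"
  define \<delta> where "\<delta> v x y = (let fs = fst v @ [?t (x, y, snd (snd v) \<in> P)] in
      (reduce fs, color fs, lasso pre per (Suc (snd (snd v)))))" for v :: "nat list \<times> nat \<times> nat" and x y
  define V where "V = states \<times> {..2 * ty_bound \<psi> + 3} \<times> {..<pre + per}"
  define v0 where "v0 = ([] :: nat list, 0 :: nat, 0 :: nat)"
  have fin: "finite V" by (simp add: V_def finite_states)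
  have v0: "v0 \<in> V" using factors_states[of undefined 0] \<open>0 < per\<close> by (simp add: V_def v0_def)
  have closed: "\<delta> v x y \<in> V" if "v \<in> V" for v x y
    using that reduce_states color_bound lasso_less[OF \<open>0 < per\<close>]
    by (auto simp: V_def \<delta>_def Let_def)
  have run: "\<exists>c. inf_min (\<lambda>t. fst (snd (v t))) c \<and> (odd c \<longleftrightarrow> wsat \<psi> (play X Y P))"
    if "v 0 = v0" "\<And>t. v (Suc t) = \<delta> (v t) (t \<in> X) (t \<in> Y)" for v X Y
  proof -
    define W where "W t = (t \<in> X, t \<in> Y, t \<in> P)" for t
    have P: "(lasso pre per t \<in> P) = (t \<in> P)" for t using lasso_P by blast
    have v: "fst (v t) = factors W t \<and> snd (snd (v t)) = lasso pre per t" for t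
    proof (induction t)
      case 0
      then show ?case using that(1) \<open>0 < per\<close> by (simp add: v0_def lasso_id)
    next
      case (Suc t)
      then show ?case by (simp add: that(2) \<delta>_def Let_def W_def lasso_Suc_lasso P)
    qed
    have "fst (snd (v (Suc t))) = color (factors W t @ [?t (W t)])" for t
      using v[of t] by (simp add: that(2) \<delta>_def Let_def W_def P)
    moreover obtain c where "inf_min (\<lambda>t. color (factors W t @ [?t (W t)])) c"
      "odd c \<longleftrightarrow> wsat \<psi> (\<lambda>i. letter3 (W i))" using inf_min_color[of W] by blast
    moreover have "(\<lambda>i. letter3 (W i)) = play X Y P"
      by (intro ext) (simp add: letter3_def play_def W_def)
    ultimately have "inf_min (\<lambda>t. fst (snd (v (Suc t)))) c" "odd c \<longleftrightarrow> wsat \<psi> (play X Y P)" by simp_all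
    then show ?thesis using inf_min_Suc[of "\<lambda>t. fst (snd (v t))"] by blast
  qed
  have init: "[v0] \<in> stacks V" using v0 by (simp add: stacks_def)
  have last_V: "last s \<in> V" if "s \<in> stacks V" for s using that by (auto simp: stacks_def)
  have "\<forall>v\<in>V. \<forall>x y. \<delta> v x y \<in> V" using closed by blast
  from game_determined[where \<delta> = \<delta> and pr = "\<lambda>v. fst (snd v)" and Win = odd, OF fin v0 this] show ?thesis
  proof (elim disjE exE)
    fix \<sigma>
    assume \<sigma>: "\<forall>x v s c. v 0 = v0 \<and> s 0 = [v0] \<and>
        (\<forall>t. v (Suc t) = \<delta> (v t) (x t) (\<sigma> (s t) (x t)) \<and> s (Suc t) = advance (s t) (v (Suc t))) \<and>
        inf_min (\<lambda>t. fst (snd (v t))) c \<longrightarrow> odd c"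
    define nx where "nx s a = advance s (\<delta> (last s) (fst a) (\<sigma> s (fst a)))" for s and a :: "bool \<times> bool"
    obtain n q0 d out where m: "transition_system {..<n::nat} q0 d"
      "\<And>x i. machine_op q0 d out x i = \<sigma> (foldl nx [v0] (map x [0..<i])) (fst (x i))"
      by (rule machine_encode[OF finite_stacks[OF fin] init, of nx "\<lambda>s a. \<sigma> s (fst a)"])
        (auto simp: nx_def intro!: advance_stacks closed last_V)
    have "wsat \<psi> (play X (apply_op2 (machine_op q0 d out) X P) P)" for X
    proof -
      define Y where "Y = apply_op2 (machine_op q0 d out) X P"
      define s where "s t = foldl nx [v0] (map (\<lambda>n. (n \<in> X, n \<in> P)) [0..<t])" for t
      have Y: "t \<in> Y \<longleftrightarrow> \<sigma> (s t) (t \<in> X)" for t by (simp add: Y_def apply_op2_def m(2) s_def)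
      have s_Suc: "s (Suc t) = advance (s t) (\<delta> (last (s t)) (t \<in> X) (\<sigma> (s t) (t \<in> X)))" for t
        by (simp add: s_def nx_def)
      have s_0: "s 0 = [v0]" by (simp add: s_def)
      obtain c where c: "inf_min (\<lambda>t. fst (snd (last (s t)))) c" "odd c \<longleftrightarrow> wsat \<psi> (play X Y P)"
        using run[of "\<lambda>t. last (s t)" X Y] by (auto simp: s_0 s_Suc Y)
      have "odd c" using \<sigma>[rule_format, of "\<lambda>t. last (s t)" s "\<lambda>t. t \<in> X" c] c(1) by (simp add: s_0 s_Suc)
      then show ?thesis using c(2) by (simp add: Y_def)
    qed
    then show ?thesis using m(1) by blast
  next
    fix \<xi>
    assume \<xi>: "\<forall>y v s c. v 0 = v0 \<and> s 0 = [v0] \<and>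
        (\<forall>t. v (Suc t) = \<delta> (v t) (\<xi> (s t)) (y t) \<and> s (Suc t) = advance (s t) (v (Suc t))) \<and>
        inf_min (\<lambda>t. fst (snd (v t))) c \<longrightarrow> \<not> odd c"
    define nx where "nx s a = advance s (\<delta> (last s) (\<xi> s) (fst a))" for s and a :: "bool \<times> bool"
    obtain n q0 d out where m: "transition_system {..<n::nat} q0 d"
      "\<And>x i. machine_op q0 d out x i = \<xi> (foldl nx [v0] (map x [0..<i]))"
      "\<And>q a b. out q a = out q b"
      by (rule machine_encode[OF finite_stacks[OF fin] init, of nx "\<lambda>s a. \<xi> s"])
        (auto simp: nx_def intro!: advance_stacks closed last_V)
    have "\<not> wsat \<psi> (play (apply_op2 (machine_op q0 d out) Y P) Y P)" for Y
    proof -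
      define X where "X = apply_op2 (machine_op q0 d out) Y P"
      define s where "s t = foldl nx [v0] (map (\<lambda>n. (n \<in> Y, n \<in> P)) [0..<t])" for t
      have X: "t \<in> X \<longleftrightarrow> \<xi> (s t)" for t by (simp add: X_def apply_op2_def m(2) s_def)
      have s_Suc: "s (Suc t) = advance (s t) (\<delta> (last (s t)) (\<xi> (s t)) (t \<in> Y))" for t
        by (simp add: s_def nx_def)
      have s_0: "s 0 = [v0]" by (simp add: s_def)
      obtain c where c: "inf_min (\<lambda>t. fst (snd (last (s t)))) c" "odd c \<longleftrightarrow> wsat \<psi> (play X Y P)"
        using run[of "\<lambda>t. last (s t)" X Y] by (auto simp: s_0 s_Suc X)
      have "\<not> odd c" using \<xi>[rule_format, of "\<lambda>t. last (s t)" s "\<lambda>t. t \<in> Y" c] c(1) by (simp add: s_0 s_Suc)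
      then show ?thesis using c(2) by (simp add: X_def)
    qed
    then show ?thesis using m(1,3) by blast
  qed
qed

section \<open>Recursive functions\<close>

text \<open>Recursive functions are meaningful only on lists of the right length; working up to
  equality there allows free rewriting of the function terms.\<close>

definition recn :: "nat \<Rightarrow> (nat list \<Rightarrow> nat) \<Rightarrow> bool" where
  "recn n F \<longleftrightarrow> (\<exists>g. recursive n g \<and> (\<forall>xs. length xs = n \<longrightarrow> g xs = F xs))"

lemma recn_cong: "recn n F \<Longrightarrow> (\<And>xs. length xs = n \<Longrightarrow> F xs = G xs) \<Longrightarrow> recn n G"
  unfolding recn_def by metis

lemma recn_zero: "recn n (\<lambda>_. 0)"
  unfolding recn_def by (blast intro: recursive.zero)

lemma recn_proj: "i < n \<Longrightarrow> recn n (\<lambda>xs. xs ! i)"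
  unfolding recn_def by (blast intro: recursive.proj)

lemma recn_succ: "recn 1 (\<lambda>xs. Suc (xs ! 0))"
  unfolding recn_def by (blast intro: recursive.succ)

lemma recn_comp1: "recn 1 (\<lambda>ys. h (ys ! 0)) \<Longrightarrow> recn n f \<Longrightarrow> recn n (\<lambda>xs. h (f xs))"
  unfolding recn_def
proof (elim exE conjE)
  fix h' f'
  assume *: "recursive 1 h'" "\<forall>xs. length xs = 1 \<longrightarrow> h' xs = h (xs ! 0)"
    "recursive n f'" "\<forall>xs. length xs = n \<longrightarrow> f' xs = f xs"
  have r: "recursive n (\<lambda>xs. h' (map (\<lambda>g. g xs) [f']))"
    by (rule recursive.comp) (use * in auto)
  show "\<exists>g. recursive n g \<and> (\<forall>xs. length xs = n \<longrightarrow> g xs = h (f xs))"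
    by (intro exI conjI, rule r) (use * in auto)
qed

lemma recn_comp2: "recn 2 (\<lambda>ys. h (ys ! 0) (ys ! 1)) \<Longrightarrow> recn n f \<Longrightarrow> recn n g \<Longrightarrow> recn n (\<lambda>xs. h (f xs) (g xs))"
  unfolding recn_def
proof (elim exE conjE)
  fix h' f' g'
  assume *: "recursive 2 h'" "\<forall>xs. length xs = 2 \<longrightarrow> h' xs = h (xs ! 0) (xs ! 1)"
    "recursive n f'" "\<forall>xs. length xs = n \<longrightarrow> f' xs = f xs"
    "recursive n g'" "\<forall>xs. length xs = n \<longrightarrow> g' xs = g xs"
  have r: "recursive n (\<lambda>xs. h' (map (\<lambda>g. g xs) [f', g']))"
    by (rule recursive.comp) (use * in \<open>auto simp: numeral_2_eq_2\<close>)
  show "\<exists>F. recursive n F \<and> (\<forall>xs. length xs = n \<longrightarrow> F xs = h (f xs) (g xs))"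
    by (intro exI conjI, rule r) (use * in auto)
qed

lemma recn_rec:
  assumes "recn n f" "recn (Suc (Suc n)) g"
  shows "recn (Suc n) (\<lambda>xs. rec_nat (f (tl xs)) (\<lambda>k r. g (k # r # tl xs)) (hd xs))"
proof -
  obtain f' g' where *: "recursive n f'" "\<forall>xs. length xs = n \<longrightarrow> f' xs = f xs"
    "recursive (Suc (Suc n)) g'" "\<forall>xs. length xs = Suc (Suc n) \<longrightarrow> g' xs = g xs"
    using assms unfolding recn_def by blast
  have "recursive (Suc n) (\<lambda>xs. rec_nat (f' (tl xs)) (\<lambda>k r. g' (k # r # tl xs)) (hd xs))"
    by (rule recursive.prim_rec) (use * in auto)
  moreover have "rec_nat (f' (tl xs)) (\<lambda>k r. g' (k # r # tl xs)) m
      = rec_nat (f (tl xs)) (\<lambda>k r. g (k # r # tl xs)) m" if "length xs = Suc n" for xs m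
    using * that by (induction m) auto
  ultimately show ?thesis unfolding recn_def by blast
qed

lemma recn_minim:
  assumes "recn (Suc n) f" "\<And>xs. length xs = n \<Longrightarrow> \<exists>y. f (y # xs) = 0"
  shows "recn n (\<lambda>xs. LEAST y. f (y # xs) = 0)"
proof -
  obtain f' where *: "recursive (Suc n) f'" "\<forall>xs. length xs = Suc n \<longrightarrow> f' xs = f xs"
    using assms(1) unfolding recn_def by blast
  have r: "recursive n (\<lambda>xs. LEAST y. f' (y # xs) = 0)"
    by (rule recursive.minim) (use * assms(2) in auto)
  show ?thesis unfolding recn_def by (intro exI conjI, rule r) (use * in auto)
qed

lemma list1_cases: "length xs = Suc 0 \<Longrightarrow> (\<And>a. xs = [a] \<Longrightarrow> thesis) \<Longrightarrow> thesis"
  by (cases xs) auto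

lemma list2_cases: "length xs = 2 \<Longrightarrow> (\<And>a b. xs = [a, b] \<Longrightarrow> thesis) \<Longrightarrow> thesis"
  by (cases xs; cases "tl xs") auto

lemma recn_rec2:
  assumes "recn 1 (\<lambda>xs. f (xs ! 0))" "recn 3 (\<lambda>xs. g (xs ! 0) (xs ! 1) (xs ! 2))"
  shows "recn 2 (\<lambda>xs. rec_nat (f (xs ! 1)) (\<lambda>k r. g k r (xs ! 1)) (xs ! 0))"
proof -
  have "recn (Suc (Suc 1)) (\<lambda>xs. g (xs ! 0) (xs ! 1) (xs ! 2))"
    using assms(2) by (simp add: numeral_3_eq_3)
  from recn_rec[OF assms(1) this] show ?thesis
    unfolding One_nat_def numeral_2_eq_2
    by (elim recn_cong) (auto elim!: list2_cases[unfolded numeral_2_eq_2])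
qed

lemma recn_rec1:
  assumes "recn 2 (\<lambda>xs. g (xs ! 0) (xs ! 1))"
  shows "recn 1 (\<lambda>xs. rec_nat c (\<lambda>k r. g k r) (xs ! 0))"
proof -
  have "recn 1 (\<lambda>_. c)"
    by (induction c) (use recn_zero recn_comp1[OF recn_succ] in auto)
  moreover have "recn 3 (\<lambda>xs. g (xs ! 0) (xs ! 1))"
    by (rule recn_comp2[OF assms]; rule recn_proj) simp_all
  ultimately have "recn 2 (\<lambda>xs. rec_nat c (\<lambda>k r. g k r) (xs ! 0))"
    by (rule recn_rec2[where f = "\<lambda>_. c" and g = "\<lambda>k r _. g k r"])
  from recn_comp2[where h = "\<lambda>a _. rec_nat c (\<lambda>k r. g k r) a", OF this recn_proj[of 0 1] recn_proj[of 0 1]]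
  show ?thesis by simp
qed

lemma recn_add: "recn 2 (\<lambda>xs. xs ! 0 + xs ! 1)"
proof -
  have "recn 2 (\<lambda>xs. rec_nat (xs ! 1) (\<lambda>k r. Suc r) (xs ! 0))"
    by (intro recn_rec2[where f = "\<lambda>b. b" and g = "\<lambda>k r b. Suc r"] recn_proj recn_comp1[OF recn_succ]) simp_all
  moreover have "rec_nat b (\<lambda>k r. Suc r) a = a + b" for a b :: nat by (induction a) auto
  ultimately show ?thesis by simp
qed

lemma recn_mult: "recn 2 (\<lambda>xs. xs ! 0 * xs ! 1)"
proof -
  have "recn 2 (\<lambda>xs. rec_nat 0 (\<lambda>k r. r + xs ! 1) (xs ! 0))"
    by (intro recn_rec2[where f = "\<lambda>b. 0" and g = "\<lambda>k r b. r + b"] recn_zero recn_proj recn_comp2[OF recn_add]) simp_all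
  moreover have "rec_nat 0 (\<lambda>k r. r + b) a = a * b" for a b :: nat by (induction a) auto
  ultimately show ?thesis by simp
qed

lemma recn_pred: "recn 1 (\<lambda>xs. xs ! 0 - 1)"
proof -
  have "recn 1 (\<lambda>xs. rec_nat 0 (\<lambda>k r. k) (xs ! 0))" by (intro recn_rec1 recn_proj) simp
  moreover have "rec_nat 0 (\<lambda>k r. k) a = a - 1" for a :: nat by (cases a) auto
  ultimately show ?thesis by simp
qed

lemma recn_sub: "recn 2 (\<lambda>xs. xs ! 0 - xs ! 1)"
proof -
  have "recn 2 (\<lambda>xs. rec_nat (xs ! 1) (\<lambda>k r. r - 1) (xs ! 0))"
    by (intro recn_rec2[where f = "\<lambda>b. b" and g = "\<lambda>k r b. r - 1"] recn_proj recn_comp1[OF recn_pred]) simp_all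
  moreover have "rec_nat b (\<lambda>k r. r - 1) a = b - a" for a b :: nat by (induction a) auto
  ultimately have "recn 2 (\<lambda>xs. xs ! 1 - xs ! 0)" by simp
  from recn_comp2[where h = "\<lambda>a b. b - a", OF this recn_proj[of 1 2] recn_proj[of 0 2]]
  show ?thesis by simp
qed

lemma recn_triangle: "recn 1 (\<lambda>xs. triangle (xs ! 0))"
proof -
  have "recn 1 (\<lambda>xs. rec_nat 0 (\<lambda>k r. Suc (k + r)) (xs ! 0))"
    by (intro recn_rec1 recn_comp1[OF recn_succ] recn_add)
  moreover have "rec_nat 0 (\<lambda>k r. Suc (k + r)) a = triangle a" for a by (induction a) auto
  ultimately show ?thesis by simp
qed

definition pfst :: "nat \<Rightarrow> nat" where "pfst x = fst (prod_decode x)"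
definition psnd :: "nat \<Rightarrow> nat" where "psnd x = snd (prod_decode x)"

lemma pfst_encode [simp]: "pfst (prod_encode (a, b)) = a" by (simp add: pfst_def)
lemma psnd_encode [simp]: "psnd (prod_encode (a, b)) = b" by (simp add: psnd_def)
lemma encode_pfst_psnd [simp]: "prod_encode (pfst x, psnd x) = x" by (simp add: pfst_def psnd_def)

text \<open>The sum of the components indexes the largest triangular number not exceeding
  \<open>x\<close>. So the Cantor pairing can be inverted by one minimisation.\<close>

lemma Least_triangle: "(LEAST s. x < triangle (Suc s)) = pfst x + psnd x"
proof (rule Least_equality)
  have x: "x = triangle (pfst x + psnd x) + pfst x"
    using encode_pfst_psnd[of x] by (simp only: prod_encode_def prod.case)
  show "x < triangle (Suc (pfst x + psnd x))" by (subst x) simp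
  fix s assume s: "x < triangle (Suc s)"
  show "pfst x + psnd x \<le> s"
  proof (rule ccontr)
    assume "\<not> pfst x + psnd x \<le> s"
    then have "triangle (Suc s) \<le> triangle (pfst x + psnd x)" by (intro triangle_mono) simp
    then show False using s x by linarith
  qed
qed

lemma recn_psum: "recn 1 (\<lambda>xs. pfst (xs ! 0) + psnd (xs ! 0))"
proof -
  have "recn (Suc 1) (\<lambda>xs. Suc (xs ! 1) - triangle (Suc (xs ! 0)))"
    by (intro recn_comp2[OF recn_sub] recn_comp1[OF recn_triangle] recn_comp1[OF recn_succ] recn_proj) auto
  then have "recn 1 (\<lambda>xs. LEAST y. Suc ((y # xs) ! 1) - triangle (Suc ((y # xs) ! 0)) = 0)"
  proof (rule recn_minim)
    fix xs :: "nat list"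
    have "xs ! 0 < triangle (Suc (xs ! 0))" by simp
    then show "\<exists>y. Suc ((y # xs) ! 1) - triangle (Suc ((y # xs) ! 0)) = 0"
      by (intro exI[of _ "xs ! 0"]) (simp del: triangle_Suc)
  qed
  then show ?thesis
  proof (rule recn_cong)
    fix xs :: "nat list"
    show "(LEAST y. Suc ((y # xs) ! 1) - triangle (Suc ((y # xs) ! 0)) = 0) = pfst (xs ! 0) + psnd (xs ! 0)"
      using Least_triangle[of "xs ! 0"] by (simp add: Suc_le_eq del: triangle_Suc)
  qed
qed

lemma recn_pfst: "recn 1 (\<lambda>xs. pfst (xs ! 0))"
proof -
  have "recn 1 (\<lambda>xs. xs ! 0 - triangle (pfst (xs ! 0) + psnd (xs ! 0)))"
    by (intro recn_comp2[OF recn_sub] recn_comp1[OF recn_triangle] recn_psum recn_proj) auto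
  moreover have "x - triangle (pfst x + psnd x) = pfst x" for x
    using encode_pfst_psnd[of x] by (simp only: prod_encode_def prod.case)
  ultimately show ?thesis by simp
qed

lemma recn_psnd: "recn 1 (\<lambda>xs. psnd (xs ! 0))"
proof -
  have "recn 1 (\<lambda>xs. (pfst (xs ! 0) + psnd (xs ! 0)) - pfst (xs ! 0))"
    by (intro recn_comp2[OF recn_sub] recn_pfst recn_psum)
  then show ?thesis by simp
qed

lemma recn_prod_encode: "recn 2 (\<lambda>xs. prod_encode (xs ! 0, xs ! 1))"
  unfolding prod_encode_def prod.case
  by (intro recn_comp2[OF recn_add] recn_comp1[OF recn_triangle] recn_proj) auto

lemma computable_iff: "computable f \<longleftrightarrow> recn 1 (\<lambda>xs. f (xs ! 0))"
proof
  assume "recn 1 (\<lambda>xs. f (xs ! 0))"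
  then obtain g where "recursive 1 g" "\<forall>xs. length xs = 1 \<longrightarrow> g xs = f (xs ! 0)" by (auto simp: recn_def)
  then show "computable f" unfolding computable_def by (intro exI[of _ g]) simp
next
  assume "computable f"
  then obtain g where "recursive 1 g" "\<And>x. g [x] = f x" by (auto simp: computable_def)
  then show "recn 1 (\<lambda>xs. f (xs ! 0))"
    unfolding recn_def by (intro exI[of _ g]) (auto elim!: list1_cases)
qed

lemma computable_comp: "computable f \<Longrightarrow> computable g \<Longrightarrow> computable (\<lambda>x. f (g x))"
  unfolding computable_iff by (rule recn_comp1)

lemma computable_comp2:
  "recn 2 (\<lambda>ys. h (ys ! 0) (ys ! 1)) \<Longrightarrow> computable f \<Longrightarrow> computable g \<Longrightarrow> computable (\<lambda>x. h (f x) (g x))"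
  unfolding computable_iff by (rule recn_comp2)

named_theorems comp_intros

lemma computable_id [comp_intros]: "computable (\<lambda>x. x)"
  unfolding computable_iff by (rule recn_proj) simp

lemma computable_Suc [comp_intros]: "computable f \<Longrightarrow> computable (\<lambda>x. Suc (f x))"
  unfolding computable_iff by (rule recn_comp1[OF recn_succ])

lemma computable_const [comp_intros]: "computable (\<lambda>_. c)"
  by (induction c) (simp_all add: computable_Suc, simp add: computable_iff recn_zero)

lemma computable_add [comp_intros]: "computable f \<Longrightarrow> computable g \<Longrightarrow> computable (\<lambda>x. f x + g x)"
  by (rule computable_comp2[OF recn_add])

lemma computable_mult [comp_intros]: "computable f \<Longrightarrow> computable g \<Longrightarrow> computable (\<lambda>x. f x * g x)"
  by (rule computable_comp2[OF recn_mult])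

lemma computable_diff [comp_intros]: "computable f \<Longrightarrow> computable g \<Longrightarrow> computable (\<lambda>x. f x - g x)"
  by (rule computable_comp2[OF recn_sub])

lemma computable_prod_encode [comp_intros]:
  "computable f \<Longrightarrow> computable g \<Longrightarrow> computable (\<lambda>x. prod_encode (f x, g x))"
  by (rule computable_comp2[OF recn_prod_encode])

lemma computable_pfst [comp_intros]: "computable f \<Longrightarrow> computable (\<lambda>x. pfst (f x))"
  unfolding computable_iff by (rule recn_comp1[OF recn_pfst])

lemma computable_psnd [comp_intros]: "computable f \<Longrightarrow> computable (\<lambda>x. psnd (f x))"
  unfolding computable_iff by (rule recn_comp1[OF recn_psnd])

text \<open>Only unary functions are handled from here on; the ternary step function is presented on
  nested pairs, and the argument \<open>x\<close> is passed along as parameter.\<close>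

lemma computable_rec_nat [comp_intros]:
  assumes "computable f" "computable (\<lambda>z. g (pfst z) (pfst (psnd z)) (psnd (psnd z)))" "computable h"
  shows "computable (\<lambda>x. rec_nat (f x) (\<lambda>k r. g k r x) (h x))"
proof -
  let ?g = "\<lambda>z. g (pfst z) (pfst (psnd z)) (psnd (psnd z))"
  have "recn 3 (\<lambda>ys. ?g (prod_encode (ys ! 0, prod_encode (ys ! 1, ys ! 2))))"
    by (intro recn_comp1[OF assms(2)[unfolded computable_iff]] recn_comp2[OF recn_prod_encode] recn_proj) simp_all
  then have "recn 3 (\<lambda>ys. g (ys ! 0) (ys ! 1) (ys ! 2))" by simp
  from recn_rec2[OF assms(1)[unfolded computable_iff] this]
  have "recn 2 (\<lambda>xs. rec_nat (f (xs ! 1)) (\<lambda>k r. g k r (xs ! 1)) (xs ! 0))" .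
  from computable_comp2[OF this assms(3) computable_id] show ?thesis .
qed

definition decp :: "(nat \<Rightarrow> bool) \<Rightarrow> bool" where
  "decp R \<longleftrightarrow> computable (\<lambda>x. of_bool (R x))"

lemma computable_of_bool [comp_intros]: "decp R \<Longrightarrow> computable (\<lambda>x. of_bool (R x))"
  by (simp add: decp_def)

lemma decp_comp: "decp R \<Longrightarrow> computable f \<Longrightarrow> decp (\<lambda>x. R (f x))"
  unfolding decp_def by (rule computable_comp)

lemma decp_not [comp_intros]: "decp R \<Longrightarrow> decp (\<lambda>x. \<not> R x)"
proof -
  assume R: "decp R"
  have "computable (\<lambda>x. 1 - of_bool (R x))" by (intro comp_intros R)
  moreover have "1 - of_bool (R x) = (of_bool (\<not> R x) :: nat)" for x by (cases "R x") simp_all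
  ultimately show ?thesis by (simp only: decp_def)
qed

lemma decp_conj [comp_intros]: "decp R \<Longrightarrow> decp S \<Longrightarrow> decp (\<lambda>x. R x \<and> S x)"
proof -
  assume *: "decp R" "decp S"
  have "computable (\<lambda>x. of_bool (R x) * of_bool (S x))" by (intro comp_intros *)
  moreover have "of_bool (R x) * of_bool (S x) = (of_bool (R x \<and> S x) :: nat)" for x by simp
  ultimately show ?thesis by (simp only: decp_def)
qed

lemma decp_disj [comp_intros]: "decp R \<Longrightarrow> decp S \<Longrightarrow> decp (\<lambda>x. R x \<or> S x)"
  using decp_not[OF decp_conj[OF decp_not decp_not], of R S] by simp

lemma decp_imp [comp_intros]: "decp R \<Longrightarrow> decp S \<Longrightarrow> decp (\<lambda>x. R x \<longrightarrow> S x)"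
  unfolding imp_conv_disj by (intro comp_intros)

lemma decp_iff [comp_intros]: "decp R \<Longrightarrow> decp S \<Longrightarrow> decp (\<lambda>x. R x = S x)"
  unfolding iff_conv_conj_imp by (intro comp_intros)

lemma decp_le [comp_intros]: "computable f \<Longrightarrow> computable g \<Longrightarrow> decp (\<lambda>x. f x \<le> g x)"
proof -
  assume *: "computable f" "computable g"
  have "computable (\<lambda>x. 1 - (f x - g x))" by (intro comp_intros *)
  moreover have "(1 - (f x - g x)) = of_bool (f x \<le> g x)" for x by (simp add: of_bool_def)
  ultimately show ?thesis by (simp add: decp_def)
qed

lemma decp_less [comp_intros]: "computable f \<Longrightarrow> computable g \<Longrightarrow> decp (\<lambda>x. f x < g x)"
  unfolding less_eq_Suc_le by (intro comp_intros)

lemma decp_eq [comp_intros]: "computable f \<Longrightarrow> computable g \<Longrightarrow> decp (\<lambda>x. f x = g x)"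
  unfolding order.eq_iff by (intro comp_intros)

lemma computable_if [comp_intros]:
  "decp R \<Longrightarrow> computable f \<Longrightarrow> computable g \<Longrightarrow> computable (\<lambda>x. if R x then f x else g x)"
proof -
  assume *: "decp R" "computable f" "computable g"
  have "computable (\<lambda>x. of_bool (R x) * f x + of_bool (\<not> R x) * g x)" by (intro comp_intros *)
  moreover have "of_bool (R x) * f x + of_bool (\<not> R x) * g x = (if R x then f x else g x)" for x by simp
  ultimately show ?thesis by simp
qed

lemma decp_if [comp_intros]:
  "decp R \<Longrightarrow> decp S \<Longrightarrow> decp T \<Longrightarrow> decp (\<lambda>x. if R x then S x else T x)"
  unfolding if_bool_eq_conj by (intro comp_intros)

lemma decp_bex [comp_intros]:
  assumes "computable b" "decp (\<lambda>z. R (pfst z) (psnd z))"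
  shows "decp (\<lambda>x. \<exists>y<b x. R y x)"
proof -
  have R: "decp (\<lambda>z. R (f z) (g z))" if "computable f" "computable g" for f g
    using decp_comp[OF assms(2) computable_prod_encode[OF that]] by simp
  have "computable (\<lambda>x. rec_nat 0 (\<lambda>k r. if R k x then 1 else r) (b x))"
    by (intro comp_intros assms(1) R)
  moreover have "rec_nat (0::nat) (\<lambda>k r. if R k x then 1 else r) n = of_bool (\<exists>y<n. R y x)" for n x
    by (induction n) (auto simp: less_Suc_eq)
  ultimately show ?thesis by (simp only: decp_def)
qed

lemma decp_ball [comp_intros]:
  assumes "computable b" "decp (\<lambda>z. R (pfst z) (psnd z))"
  shows "decp (\<lambda>x. \<forall>y<b x. R y x)"
  using decp_not[OF decp_bex[OF assms(1) decp_not[OF assms(2)]]] by simp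

lemma computable_Least:
  assumes "decp (\<lambda>z. R (pfst z) (psnd z))" "\<And>x. \<exists>y. R y x"
  shows "computable (\<lambda>x. LEAST y. R y x)"
proof -
  have "computable (\<lambda>z. of_bool (\<not> R (pfst z) (psnd z)))" by (intro comp_intros assms(1))
  then have "recn 1 (\<lambda>xs. of_bool (\<not> R (pfst (xs ! 0)) (psnd (xs ! 0))))" by (simp add: computable_iff)
  from recn_comp1[OF this recn_prod_encode]
  have "recn (Suc 1) (\<lambda>xs. of_bool (\<not> R (xs ! 0) (xs ! 1)))" by (simp add: numeral_2_eq_2)
  then have "recn 1 (\<lambda>xs. LEAST y. of_bool (\<not> R ((y # xs) ! 0) ((y # xs) ! 1)) = (0::nat))"
    by (rule recn_minim) (simp add: assms(2))
  then show ?thesis by (simp add: computable_iff)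
qed

lemma computable_power2 [comp_intros]: "computable f \<Longrightarrow> computable (\<lambda>x. 2 ^ f x)"
proof -
  assume *: "computable f"
  have "computable (\<lambda>x. rec_nat 1 (\<lambda>k r. r + r) (f x))" by (intro comp_intros *)
  moreover have "rec_nat 1 (\<lambda>k r. r + r) n = (2::nat) ^ n" for n by (induction n) auto
  ultimately show ?thesis by simp
qed

lemma computable_mod [comp_intros]: "computable f \<Longrightarrow> computable g \<Longrightarrow> computable (\<lambda>x. f x mod g x)"
proof -
  assume *: "computable f" "computable g"
  have g: "computable (\<lambda>z. g (psnd (psnd z)))" by (rule computable_comp[OF *(2)]) (intro comp_intros)
  have "computable (\<lambda>x. rec_nat 0 (\<lambda>k r. if Suc r = g x then 0 else Suc r) (f x))" by (intro comp_intros * g)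
  moreover have "rec_nat 0 (\<lambda>k r. if Suc r = m then 0 else Suc r) n = n mod m" for m n :: nat
    by (induction n) (auto simp: mod_Suc)
  ultimately show ?thesis by simp
qed

lemma decp_mem_set_decode [comp_intros]:
  "computable f \<Longrightarrow> computable g \<Longrightarrow> decp (\<lambda>x. f x \<in> set_decode (g x))"
proof -
  assume *: "computable f" "computable g"
  \<comment> \<open>Testing a bit by division is replaced by a bounded search for quotient and
    remainder, which the closure rules cover.\<close>
  have iff: "n \<in> set_decode y \<longleftrightarrow> (\<exists>q<Suc y. \<exists>r<2 ^ n. y = (q + q + 1) * 2 ^ n + r)" for n y :: nat
  proof
    assume "n \<in> set_decode y"
    then obtain q where q: "y div 2 ^ n = 2 * q + 1" unfolding set_decode_def by (auto elim: oddE)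
    have "q \<le> y div 2 ^ n" using q by simp
    also have "\<dots> \<le> y" by simp
    finally have "q < Suc y" by simp
    moreover have "y = (q + q + 1) * 2 ^ n + y mod 2 ^ n"
      using div_mult_mod_eq[of y "2 ^ n"] q by (simp add: mult_2)
    ultimately show "\<exists>q<Suc y. \<exists>r<2 ^ n. y = (q + q + 1) * 2 ^ n + r"
      by (intro exI[of _ q] conjI exI[of _ "y mod 2 ^ n"]) simp_all
  next
    assume "\<exists>q<Suc y. \<exists>r<2 ^ n. y = (q + q + 1) * 2 ^ n + r"
    then obtain q r where "r < 2 ^ n" "y = (q + q + 1) * 2 ^ n + r" by blast
    then have "y div 2 ^ n = q + q + 1" by (intro div_nat_eqI) (auto simp: algebra_simps)
    then show "n \<in> set_decode y" by (simp add: set_decode_def)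
  qed
  have fz: "computable (\<lambda>z. f (psnd z))" "computable (\<lambda>z. f (psnd (psnd z)))" "computable (\<lambda>z. g (psnd (psnd z)))"
    by (rule computable_comp[OF *(1)] computable_comp[OF *(2)], intro comp_intros)+
  show ?thesis unfolding iff by (intro comp_intros * fz)
qed

section \<open>Certified evaluation of formulas\<close>

lemma pfst_le: "pfst x \<le> x" using le_prod_encode_1[of "pfst x" "psnd x"] by simp
lemma psnd_le: "psnd x \<le> x" using le_prod_encode_2[of "psnd x" "pfst x"] by simp

lemma psnd_less: "pfst x \<noteq> 0 \<Longrightarrow> psnd x < x"
proof -
  assume "pfst x \<noteq> 0"
  moreover have "n \<le> triangle n" for n by (induction n) auto
  from this[of "pfst x + psnd x"] have "pfst x + psnd x + pfst x \<le> prod_encode (pfst x, psnd x)"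
    by (simp only: prod_encode_def prod.case add_le_mono1)
  ultimately show ?thesis by simp
qed

lemma sub_less:
  assumes "pfst x \<noteq> 0"
  shows "psnd x < x" "pfst (psnd x) < x" "psnd (psnd x) < x"
  using psnd_less[OF assms] pfst_le[of "psnd x"] psnd_le[of "psnd x"] by linarith+

text \<open>Every number is decoded to some formula, so that the algorithm need not recognise the codes
  of formulas.\<close>

function dec :: "nat \<Rightarrow> mlo" where
  "dec x = (let a = pfst (psnd x); c = psnd (psnd x) in
     if pfst x = 0 then Less a c
     else if pfst x = 1 then Eq a c
     else if pfst x = 2 then Mem a c
     else if pfst x = 3 then Neg (dec (psnd x))
     else if pfst x = 4 then Disj (dec a) (dec c)
     else if pfst x = 5 then Ex1 a (dec c)
     else Ex2 a (dec c))"
  by auto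
termination
  by (relation "measure id") (simp_all add: sub_less)

declare dec.simps [simp del]

lemma dec_code_mlo: "dec (code_mlo \<phi>) = \<phi>"
  by (induction \<phi>) (subst dec.simps, simp)+

lemma vars_dec: "z \<in> vars (dec x) \<Longrightarrow> z < 2 * x + 2"
proof (induction x rule: less_induct)
  case (less x)
  let ?a = "pfst (psnd x)" and ?c = "psnd (psnd x)"
  have le: "?a \<le> x" "?c \<le> x"
    using psnd_le[of x] pfst_le[of "psnd x"] psnd_le[of "psnd x"] by linarith+
  have IH: "y < x \<Longrightarrow> z \<in> vars (dec y) \<Longrightarrow> z < 2 * x + 2" for y
    using less.IH[of y] by simp
  consider "pfst x = 0" | "pfst x = 1" | "pfst x = 2" | "pfst x \<ge> 3" by linarith
  then show ?case
  proof cases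
    case 4
    then have "z \<in> vars (dec (psnd x)) \<or> z \<in> vars (dec ?a) \<or> z \<in> vars (dec ?c)"
      using less.prems by (subst (asm) dec.simps) (auto simp: Let_def vars_simps split: if_splits)
    then show ?thesis using IH sub_less[of x] 4 by auto
  qed (use less.prems le in \<open>auto simp: dec.simps[of x] vars_simps Let_def\<close>)
qed

text \<open>The recursion of \<open>ty_bound\<close> follows subformulas and would need
  course-of-values recursion on codes. Since subformulas have smaller codes, this plain primitive
  recursion dominates it: 8 covers the atoms, and one step covers every connective and
  quantifier.\<close>

primrec tower :: "nat \<Rightarrow> nat" where
  "tower 0 = 8"
| "tower (Suc n) = 2 ^ prod_encode (tower n, tower n)"

lemma le_power2: "n \<le> (2::nat) ^ n"
  by (rule less_imp_le) (rule less_exp)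

lemma tower_mono: "m \<le> n \<Longrightarrow> tower m \<le> tower n"
proof (rule lift_Suc_mono_le[of tower])
  fix k show "tower k \<le> tower (Suc k)"
    unfolding tower.simps by (rule order_trans[OF le_prod_encode_1 le_power2])
qed

lemma prod_encode_mono: "a \<le> c \<Longrightarrow> b \<le> d \<Longrightarrow> prod_encode (a, b) \<le> prod_encode (c, d)"
  unfolding prod_encode_def prod.case by (intro add_mono triangle_mono) auto

lemma ty_bound_dec: "ty_bound (dec x) \<le> tower x"
proof (induction x rule: less_induct)
  case (less x)
  let ?a = "pfst (psnd x)" and ?c = "psnd (psnd x)"
  have 8: "8 \<le> tower x" using tower_mono[of 0 x] by simp
  show ?case
  proof (cases "pfst x \<le> 2")
    case True
    then show ?thesis using 8 by (subst dec.simps) (auto simp: Let_def)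
  next
    case False
    then have sub: "psnd x < x" "?a < x" "?c < x" using sub_less[of x] by auto
    then obtain y where y: "x = Suc y" by (cases x) auto
    have "ty_bound (dec z) \<le> tower y" if "z < x" for z
      using less.IH[OF that] tower_mono[of z y] that y by linarith
    then have IH: "ty_bound (dec (psnd x)) \<le> tower y" "ty_bound (dec ?a) \<le> tower y" "ty_bound (dec ?c) \<le> tower y"
      using sub by blast+
    have 8: "8 \<le> tower y" using tower_mono[of 0 y] by simp
    have tx: "tower x = 2 ^ prod_encode (tower y, tower y)" using y by simp
    have p: "prod_encode (ty_bound (dec ?a), ty_bound (dec ?c)) \<le> tower x"
      unfolding tx by (rule order_trans[OF prod_encode_mono[OF IH(2,3)] le_power2])
    have e: "2 ^ prod_encode (ty_bound (dec ?c), 8) \<le> tower x"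
      unfolding tx by (intro power_increasing prod_encode_mono IH(3) 8) simp
    have "2 ^ ty_bound (dec ?c) \<le> (2::nat) ^ prod_encode (ty_bound (dec ?c), 8)"
      by (intro power_increasing le_prod_encode_1) simp
    then have e': "2 ^ ty_bound (dec ?c) \<le> tower x" using e by linarith
    consider "pfst x = 3" | "pfst x = 4" | "pfst x = 5" | "pfst x > 5" using False by linarith
    then show ?thesis
    proof cases
      case 1
      have "tower y \<le> tower x" using y by (intro tower_mono) simp
      then show ?thesis using 1 IH(1) by (subst dec.simps) (simp add: Let_def)
    next
      case 2
      then show ?thesis using p by (subst dec.simps) (simp add: Let_def)
    next
      case 3
      then show ?thesis using e by (subst dec.simps) (simp add: Let_def)
    next
      case 4
      then show ?thesis using e' by (subst dec.simps) (simp add: Let_def)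
    qed
  qed
qed

section \<open>Lasso words coded by numbers\<close>

definition wbit :: "nat \<Rightarrow> nat \<Rightarrow> nat \<Rightarrow> bool" where
  "wbit w i z \<longleftrightarrow> prod_encode (i, z) \<in> set_decode w"

definition lword :: "nat \<Rightarrow> nat \<Rightarrow> nat \<Rightarrow> nat \<Rightarrow> nat \<Rightarrow> bool" where
  "lword p q w i z \<longleftrightarrow> wbit w (lasso p q i) z"

definition word_code :: "nat \<Rightarrow> nat \<Rightarrow> (nat \<Rightarrow> nat \<Rightarrow> bool) \<Rightarrow> nat" where
  "word_code n Z V = set_encode {prod_encode (i, z) |i z. i < n \<and> z < Z \<and> V i z}"

lemma finite_word_code: "finite {prod_encode (i, z) |i z. i < n \<and> z < Z \<and> V i z}"
  by (rule finite_subset[of _ "prod_encode ` ({..<n} \<times> {..<Z})"]) auto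

lemma wbit_word_code: "wbit (word_code n Z V) i z \<longleftrightarrow> i < n \<and> z < Z \<and> V i z"
  by (auto simp: wbit_def word_code_def set_encode_inverse[OF finite_word_code] prod_encode_eq)

lemma word_code_less: "n \<le> M \<Longrightarrow> word_code n Z V < 2 ^ prod_encode (M, Z)"
  unfolding word_code_def by (rule set_encode_less) (auto intro: prod_encode_strict_mono)

definition ev_eq :: "nat \<Rightarrow> nat \<Rightarrow> nat \<Rightarrow> nat \<Rightarrow> nat \<Rightarrow> bool" where
  "ev_eq p q w a b \<longleftrightarrow> (\<exists>i<p + q. wbit w i a \<and> wbit w i b)"

text \<open>The later position runs through one further round of the loop, since a mark on the loop
  is followed by every mark of the next round.\<close>

definition ev_less :: "nat \<Rightarrow> nat \<Rightarrow> nat \<Rightarrow> nat \<Rightarrow> nat \<Rightarrow> bool" where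
  "ev_less p q w a b \<longleftrightarrow> (\<exists>i<p + q. \<exists>j<p + q + q. i < j \<and> wbit w i a \<and> wbit w (lasso p q j) b)"

lemma lasso_lasso [simp]: "lasso p q (lasso p q i) = lasso p q i"
  by (simp add: lasso_def)

lemma ev_eq_iff:
  assumes "0 < q" shows "ev_eq p q w a b \<longleftrightarrow> (\<exists>i. lword p q w i a \<and> lword p q w i b)"
  unfolding ev_eq_def lword_def using lasso_less[OF assms] lasso_id by metis

lemma ev_less_iff:
  assumes "0 < q" shows "ev_less p q w a b \<longleftrightarrow> (\<exists>i j. i < j \<and> lword p q w i a \<and> lword p q w j b)"
proof
  assume "ev_less p q w a b"
  then show "\<exists>i j. i < j \<and> lword p q w i a \<and> lword p q w j b"
    unfolding ev_less_def lword_def using lasso_id by metis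
next
  assume "\<exists>i j. i < j \<and> lword p q w i a \<and> lword p q w j b"
  then obtain i j where ij: "i < j" "wbit w (lasso p q i) a" "wbit w (lasso p q j) b"
    by (auto simp: lword_def)
  show "ev_less p q w a b"
  proof (cases "j < p")
    case True
    then have "lasso p q i = i" using ij by (simp add: lasso_def)
    then show ?thesis unfolding ev_less_def using ij True by (intro exI[of _ i] conjI exI[of _ j]) auto
  next
    case False
    let ?j = "lasso p q j + q"
    have j: "p \<le> lasso p q j" "lasso p q j < p + q" using False assms by (auto simp: lasso_def)
    have "lasso p q ?j = lasso p q j" using lasso_period[OF j(1), of q 1] by simp
    moreover have "lasso p q i < ?j" using lasso_less[OF assms, of p i] j by simp
    ultimately show ?thesis unfolding ev_less_def using ij j lasso_less[OF assms, of p i]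
      by (intro exI[of _ "lasso p q i"] conjI exI[of _ ?j]) auto
  qed
qed

text \<open>In words with arbitrary columns \<open>Eq x x\<close> says that the column is marked and
  \<open>Less x x\<close> that it is marked twice. So the uniqueness demanded by \<open>Ex1\<close>
  becomes part of the formula, and witnesses for both quantifiers are bounded in the same
  way.\<close>

definition guard :: "nat \<Rightarrow> mlo \<Rightarrow> mlo" where
  "guard x \<phi> = Neg (Disj (Neg \<phi>) (Disj (Neg (Eq x x)) (Less x x)))"

lemma wsat_guard: "wsat (guard x \<phi>) V \<longleftrightarrow> wsat \<phi> V \<and> (\<exists>!n. V n (2*x))"
  unfolding guard_def wsat.simps ex1_nat_iff by blast

text \<open>By the last hypothesis a color determines the color of the next position; agreement
  along the \<open>p + q\<close> edges of the lasso, back edge included, therefore propagates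
  forever.\<close>

lemma lasso_homomorphism:
  assumes "\<kappa> (f 0) = \<kappa>' 0" "\<And>i. i < p + q \<Longrightarrow> \<kappa> (Suc (f i)) = \<kappa> (f (lasso p q (Suc i)))" "0 < q"
    and "\<And>i j. \<kappa> i = \<kappa>' j \<Longrightarrow> \<kappa> (Suc i) = \<kappa>' (Suc j)"
  shows "\<kappa> (f (lasso p q i)) = \<kappa>' i"
proof (induction i)
  case 0
  then show ?case using assms(1,3) by (simp add: lasso_id)
next
  case (Suc i)
  have "\<kappa> (f (lasso p q (Suc i))) = \<kappa> (Suc (f (lasso p q i)))"
    using assms(2)[OF lasso_less[OF assms(3)]] by (simp add: lasso_Suc_lasso)
  also have "\<dots> = \<kappa>' (Suc i)" using assms(4)[OF Suc] .
  finally show ?case .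
qed

lemma lasso_Suc_cong: "lasso p q i = lasso p q j \<Longrightarrow> lasso p q (Suc i) = lasso p q (Suc j)"
  by (metis lasso_Suc_lasso)

text \<open>A single equation at the point where the new loop closes makes the whole new lasso
  project onto the old one; this is what a finite check can verify.\<close>

lemma lasso_closed:
  assumes "lasso p q (p' + q') = lasso p q p'" "0 < q'"
  shows "lasso p q (lasso p' q' i) = lasso p q i"
proof (rule lasso_homomorphism[where f = "\<lambda>i. i" and \<kappa> = "lasso p q" and \<kappa>' = "lasso p q", OF _ _ assms(2) lasso_Suc_cong])
  fix i assume "i < p' + q'"
  then consider "Suc i < p' + q'" | "Suc i = p' + q'" by linarith
  then show "lasso p q (Suc i) = lasso p q (lasso p' q' (Suc i))"
  proof cases
    case 2
    then have "lasso p' q' (Suc i) = p'" by (simp add: lasso_def)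
    then show ?thesis using assms(1) 2 by simp
  qed (simp add: lasso_id)
qed simp

text \<open>\<open>lasso_exists\<close> applied to the pairs of \<open>s i\<close> and the position
  on the given lasso, whence the bound by \<open>card S * (p + q)\<close>. The new lasso projects
  onto the old one, so periodic data are copied correctly.\<close>

lemma lasso_refine:
  fixes s :: "nat \<Rightarrow> 's"
  assumes "0 < q" "finite S" "range s \<subseteq> S"
  obtains p' q' f where "0 < q'" "p' \<le> ty_bound \<chi> * (card S * (p + q))" "q' \<le> ty_bound \<chi> * (card S * (p + q))"
    "s (f 0) = s 0" "\<And>i. i < p' + q' \<Longrightarrow> s (Suc (f i)) = s (f (lasso p' q' (Suc i)))"
    "\<And>i. lasso p q (f (lasso p' q' i)) = lasso p q i"
    "wsat \<chi> (\<lambda>i. V (f (lasso p' q' i))) \<longleftrightarrow> wsat \<chi> V"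
proof -
  interpret omega_type "\<lambda>u. ty \<chi> (map (\<lambda>a. a) u)" "ty_bound \<chi>" "\<lambda>W. wsat \<chi> (\<lambda>i. W i)"
    by (rule omega_type_ty)
  define \<kappa> where "\<kappa> i = (s i, lasso p q i)" for i
  have sub: "range \<kappa> \<subseteq> S \<times> {..<p + q}" using assms(3) lasso_less[OF assms(1)] by (auto simp: \<kappa>_def)
  then have fin: "finite (range \<kappa>)" "card (range \<kappa>) \<le> card S * (p + q)"
    using finite_subset[OF sub] card_mono[OF _ sub] assms(2) by (auto simp: card_cartesian_product)
  obtain p' q' f where l: "0 < p'" "0 < q'" "p' \<le> ty_bound \<chi> * (card S * (p + q))"
    "q' \<le> ty_bound \<chi> * (card S * (p + q))" "\<kappa> (f 0) = \<kappa> 0"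
    "\<And>i. i < p' + q' \<Longrightarrow> \<kappa> (Suc (f i)) = \<kappa> (f (lasso p' q' (Suc i)))"
    "wsat \<chi> (\<lambda>i. V (f (lasso p' q' i))) \<longleftrightarrow> wsat \<chi> V"
    by (rule lasso_exists[OF fin, where W = V]) blast
  have hom: "lasso p q (f (lasso p' q' i)) = lasso p q i" for i
    by (rule lasso_homomorphism[where \<kappa> = "lasso p q" and \<kappa>' = "lasso p q", OF _ _ l(2) lasso_Suc_cong])
      (use l(5,6) in \<open>simp_all add: \<kappa>_def\<close>)
  show ?thesis by (rule that[OF l(2-4) _ _ hom l(7)]) (use l(5,6) in \<open>simp_all add: \<kappa>_def\<close>)
qed

definition agree :: "nat \<Rightarrow> nat \<Rightarrow> nat \<Rightarrow> nat \<Rightarrow> nat \<Rightarrow> nat \<Rightarrow> nat \<Rightarrow> nat \<Rightarrow> bool" where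
  "agree z0 Z p q w p' q' w' \<longleftrightarrow> lasso p q (p' + q') = lasso p q p' \<and>
     (\<forall>i<p' + q'. \<forall>z<Z. z = z0 \<or> wbit w' i z = wbit w (lasso p q i) z)"

lemma agreeD:
  assumes "agree z0 Z p q w p' q' w'" "0 < q'" "z < Z" "z \<noteq> z0"
  shows "lword p' q' w' i z = lword p q w i z"
proof -
  have "lasso p q (lasso p' q' i) = lasso p q i"
    using assms(1,2) by (intro lasso_closed) (simp_all add: agree_def)
  moreover have "wbit w' (lasso p' q' i) z = wbit w (lasso p q (lasso p' q' i)) z"
    using assms(1,3,4) lasso_less[OF assms(2), of p' i] unfolding agree_def by blast
  ultimately show ?thesis by (simp add: lword_def)
qed

text \<open>Replaces an arbitrary witness for a quantifier by a lasso word of computable size,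
  turning quantification over sets into a bounded search.\<close>

lemma small_witness:
  assumes "0 < q" "\<And>n. off z0 (lword p q w n) (V n)" "wsat \<chi> V" "ty_bound \<chi> \<le> N"
    and "\<And>z. z \<in> vars \<chi> \<Longrightarrow> z < Z"
  obtains p' q' w' where "0 < q'" "p' \<le> N * (p + q)" "q' \<le> N * (p + q)"
    "w' < 2 ^ prod_encode (2 * (N * (p + q)), Z)" "agree z0 Z p q w p' q' w'" "wsat \<chi> (lword p' q' w')"
proof -
  obtain p' q' f where l: "0 < q'" "p' \<le> ty_bound \<chi> * (p + q)" "q' \<le> ty_bound \<chi> * (p + q)"
    "\<And>i. lasso p q (f (lasso p' q' i)) = lasso p q i"
    "wsat \<chi> (\<lambda>i. V (f (lasso p' q' i))) \<longleftrightarrow> wsat \<chi> V"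
    by (rule lasso_refine[OF assms(1), of "{()}" "\<lambda>_. ()" \<chi> p V]) auto
  note hom = l(4)
  define w' where "w' = word_code (p' + q') Z (\<lambda>i z. V (f i) z)"
  have w': "lword p' q' w' i z \<longleftrightarrow> z < Z \<and> V (f (lasso p' q' i)) z" for i z
    using lasso_less[OF l(1)] by (simp add: lword_def w'_def wbit_word_code)
  have "wsat \<chi> (lword p' q' w') \<longleftrightarrow> wsat \<chi> (\<lambda>i. V (f (lasso p' q' i)))"
    by (rule wsat_cong) (simp add: w' assms(5))
  then have sat: "wsat \<chi> (lword p' q' w')" using l(5) assms(3) by simp
  have le: "ty_bound \<chi> * (p + q) \<le> N * (p + q)" using assms(4) by simp
  then have le': "p' \<le> N * (p + q)" "q' \<le> N * (p + q)" using l(2,3) by linarith+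
  have "agree z0 Z p q w p' q' w'"
    unfolding agree_def
  proof (intro conjI allI impI)
    have "lasso p' q' (p' + q') = lasso p' q' p'" using lasso_period[of p' p' q' 1] by simp
    then show "lasso p q (p' + q') = lasso p q p'" using hom[of "p' + q'"] hom[of p'] by simp
    fix i z assume i: "i < p' + q'" "z < Z"
    show "z = z0 \<or> wbit w' i z = wbit w (lasso p q i) z"
    proof (cases "z = z0")
      case False
      have "wbit w' i z = V (f i) z" using i by (simp add: w'_def wbit_word_code)
      also have "\<dots> = wbit w (lasso p q (f i)) z"
        using assms(2)[of "f i"] False by (simp add: off_def lword_def)
      also have "lasso p q (f i) = lasso p q i" using hom[of i] i by (simp add: lasso_id)
      finally show ?thesis by blast
    qed simp
  qed
  moreover have "w' < 2 ^ prod_encode (2 * (N * (p + q)), Z)"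
    unfolding w'_def by (rule word_code_less) (use le' in linarith)
  ultimately show ?thesis using that l(1) le' sat by blast
qed

definition col :: "nat \<Rightarrow> nat" where
  "col x = (if pfst x = 5 then 2 * pfst (psnd x) else 2 * pfst (psnd x) + 1)"

text \<open>\<open>prod_encode (2, 8)\<close> comes from the atoms \<open>Eq x x\<close> and
  \<open>Less x x\<close> of \<open>guard\<close>, so the first factor bounds the types of a guarded
  subformula. \<open>m\<close> stands for the \<open>p + q\<close> positions of the given
  lasso.\<close>

definition qbound :: "nat \<Rightarrow> nat \<Rightarrow> nat" where
  "qbound x m = Suc (prod_encode (tower x, prod_encode (2, 8)) * m)"

text \<open>A candidate has fewer than \<open>2 * qbound x m\<close> positions. The number
  \<open>2 * x + 6\<close> exceeds all columns of the formula by \<open>vars_dec\<close>, and also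
  the columns 1, 3 and 5 even if \<open>x\<close> is 0.\<close>

definition wbound :: "nat \<Rightarrow> nat \<Rightarrow> nat" where
  "wbound x m = 2 ^ prod_encode (2 * qbound x m, 2 * x + 6)"

definition candidate :: "nat \<Rightarrow> nat \<Rightarrow> nat \<Rightarrow> nat \<Rightarrow> nat \<Rightarrow> nat \<Rightarrow> nat \<Rightarrow> bool" where
  "candidate x p q w p' q' w' \<longleftrightarrow> 0 < q' \<and> agree (col x) (2 * x + 6) p q w p' q' w' \<and>
     (pfst x = 5 \<longrightarrow> ev_eq p' q' w' (col x) (col x) \<and> \<not> ev_less p' q' w' (col x) (col x))"

lemma ex1_lword:
  assumes "0 < q"
  shows "ev_eq p q w z z \<and> \<not> ev_less p q w z z \<longleftrightarrow> (\<exists>!n. lword p q w n z)"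
  unfolding ev_eq_iff[OF assms] ev_less_iff[OF assms] ex1_nat_iff by blast

lemma wsat_quantifier:
  assumes "pfst x \<ge> 5" "0 < q"
  shows "wsat (dec x) (lword p q w) \<longleftrightarrow>
    (\<exists>p'<qbound x (p + q). \<exists>q'<qbound x (p + q). \<exists>w'<wbound x (p + q).
      candidate x p q w p' q' w' \<and> wsat (dec (psnd (psnd x))) (lword p' q' w'))"
    (is "?L \<longleftrightarrow> ?R")
proof -
  let ?a = "pfst (psnd x)" and ?c = "psnd (psnd x)" and ?Z = "2 * x + 6"
  define \<chi> where "\<chi> = (if pfst x = 5 then guard ?a (dec ?c) else dec ?c)"
  have lt: "?a < x" "?c < x" using sub_less[of x] assms(1) by auto
  have dec: "dec x = (if pfst x = 5 then Ex1 ?a (dec ?c) else Ex2 ?a (dec ?c))"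
    using assms(1) by (subst dec.simps) (auto simp: Let_def)
  have L: "?L \<longleftrightarrow> (\<exists>V. (\<forall>n. off (col x) (lword p q w n) (V n)) \<and> wsat \<chi> V)"
    by (auto simp: dec \<chi>_def wsat_guard col_def)
  have vars: "z < ?Z" if "z \<in> vars \<chi>" for z
  proof -
    have "z \<in> vars (dec ?c) \<or> z = 2 * ?a"
      using that by (auto simp: \<chi>_def guard_def vars_simps split: if_splits)
    then show ?thesis using vars_dec[of z ?c] lt by auto
  qed
  have "ty_bound (dec ?c) \<le> tower x"
    using ty_bound_dec[of ?c] tower_mono[of ?c x] lt by linarith
  moreover have "prod_encode (ty_bound (dec ?c), prod_encode (2, 8)) \<le> prod_encode (tower x, prod_encode (2, 8))"
    using calculation by (intro prod_encode_mono) auto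
  ultimately have bound: "ty_bound \<chi> \<le> prod_encode (tower x, prod_encode (2, 8))"
    using le_prod_encode_1[of "tower x" "prod_encode (2, 8)"] by (auto simp: \<chi>_def guard_def)
  show ?thesis
  proof
    assume ?L
    then obtain V where V: "\<And>n. off (col x) (lword p q w n) (V n)" "wsat \<chi> V" unfolding L by blast
    obtain p' q' w' where *: "0 < q'" "p' < qbound x (p + q)" "q' < qbound x (p + q)"
      "w' < 2 ^ prod_encode (2 * (prod_encode (tower x, prod_encode (2, 8)) * (p + q)), ?Z)"
      "agree (col x) ?Z p q w p' q' w'" "wsat \<chi> (lword p' q' w')"
      by (rule small_witness[OF assms(2) V bound vars], assumption, rule that)
        (simp_all only: qbound_def less_Suc_eq_le)
    have "(2::nat) ^ prod_encode (2 * (prod_encode (tower x, prod_encode (2, 8)) * (p + q)), ?Z) \<le> wbound x (p + q)"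
      unfolding wbound_def by (intro power_increasing prod_encode_mono) (auto simp: qbound_def)
    then have "w' < wbound x (p + q)" using *(4) by linarith
    moreover have "candidate x p q w p' q' w' \<and> wsat (dec ?c) (lword p' q' w')"
      using *(1,5,6) unfolding candidate_def ex1_lword[OF *(1)]
      by (auto simp: \<chi>_def wsat_guard col_def split: if_splits)
    ultimately show ?R using * by blast
  next
    assume ?R
    then obtain p' q' w' where c: "candidate x p q w p' q' w'" "wsat (dec ?c) (lword p' q' w')" by blast
    have q': "0 < q'" and agree: "agree (col x) ?Z p q w p' q' w'"
      using c(1) by (simp_all add: candidate_def)
    have sing: "pfst x = 5 \<Longrightarrow> \<exists>!n. lword p' q' w' n (col x)"
      using c(1) unfolding candidate_def ex1_lword[OF q', symmetric] by blast
    \<comment> \<open>The candidate is controlled only on columns below \<open>?Z\<close>. Above,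
      the old word is kept, so that \<open>V\<close> is an exact variant.\<close>
    define V where "V n z = (if z < ?Z then lword p' q' w' n z else lword p q w n z)" for n z
    have "off (col x) (lword p q w n) (V n)" for n
      using agreeD[OF agree q'] by (auto simp: off_def V_def)
    moreover have "wsat \<chi> V \<longleftrightarrow> wsat \<chi> (lword p' q' w')"
      by (rule wsat_cong) (use vars in \<open>auto simp: V_def\<close>)
    moreover have "wsat \<chi> (lword p' q' w')"
      using c(2) sing by (auto simp: \<chi>_def wsat_guard col_def)
    ultimately show ?L unfolding L by blast
  qed
qed

text \<open>The assertion that the formula decoded from \<open>x\<close> has truth value
  \<open>b\<close> in the lasso word given by \<open>p\<close>, \<open>q\<close> and
  \<open>w\<close>.\<close>

definition claim :: "nat \<Rightarrow> nat \<Rightarrow> nat \<Rightarrow> nat \<Rightarrow> nat \<Rightarrow> nat" where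
  "claim b x p q w = prod_encode (b, prod_encode (x, prod_encode (p, prod_encode (q, w))))"

text \<open>One step of the evaluation, reduced to claims in \<open>S\<close> about immediate
  subformulas. By \<open>wsat_quantifier\<close> the quantifiers need only range over small lasso
  words, and all quantifiers being bounded makes the check computable.\<close>

definition justified :: "nat set \<Rightarrow> nat \<Rightarrow> nat \<Rightarrow> nat \<Rightarrow> nat \<Rightarrow> nat \<Rightarrow> bool" where
  "justified S b x p q w \<longleftrightarrow>
    (if pfst x = 0 then (b = 1) = ev_less p q w (2 * pfst (psnd x)) (2 * psnd (psnd x))
     else if pfst x = 1 then (b = 1) = ev_eq p q w (2 * pfst (psnd x)) (2 * psnd (psnd x))
     else if pfst x = 2 then (b = 1) = ev_eq p q w (2 * pfst (psnd x)) (2 * psnd (psnd x) + 1)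
     else if pfst x = 3 then claim (1 - b) (psnd x) p q w \<in> S
     else if pfst x = 4 then
       (if b = 1 then claim 1 (pfst (psnd x)) p q w \<in> S \<or> claim 1 (psnd (psnd x)) p q w \<in> S
        else claim 0 (pfst (psnd x)) p q w \<in> S \<and> claim 0 (psnd (psnd x)) p q w \<in> S)
     else if b = 1 then
       (\<exists>p'<qbound x (p + q). \<exists>q'<qbound x (p + q). \<exists>w'<wbound x (p + q).
          candidate x p q w p' q' w' \<and> claim 1 (psnd (psnd x)) p' q' w' \<in> S)
     else
       (\<forall>p'<qbound x (p + q). \<forall>q'<qbound x (p + q). \<forall>w'<wbound x (p + q).
          candidate x p q w p' q' w' \<longrightarrow> claim 0 (psnd (psnd x)) p' q' w' \<in> S))"

definition consistent :: "nat set \<Rightarrow> bool" where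
  "consistent S \<longleftrightarrow> (\<forall>b x p q w. claim b x p q w \<in> S \<longrightarrow> b < 2 \<and> 0 < q \<and> justified S b x p q w)"

lemma claim_eq_iff [simp]:
  "claim b x p q w = claim b' x' p' q' w' \<longleftrightarrow> b = b' \<and> x = x' \<and> p = p' \<and> q = q' \<and> w = w'"
  by (auto simp: claim_def prod_encode_eq)

lemma justified_mono: "justified S b x p q w \<Longrightarrow> S \<subseteq> S' \<Longrightarrow> justified S' b x p q w"
  unfolding justified_def by (auto split: if_splits)

lemma consistent_Union:
  assumes "\<And>S. S \<in> A \<Longrightarrow> consistent S"
  shows "consistent (\<Union>A)"
  unfolding consistent_def
proof (intro allI impI)
  fix b x p q w assume "claim b x p q w \<in> \<Union>A"
  then obtain S where S: "S \<in> A" "claim b x p q w \<in> S" by blast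
  then have "b < 2 \<and> 0 < q \<and> justified S b x p q w" using assms unfolding consistent_def by blast
  then show "b < 2 \<and> 0 < q \<and> justified (\<Union>A) b x p q w" using S justified_mono by blast
qed

lemma consistent_insert:
  assumes "consistent S" "b < 2" "0 < q" "justified S b x p q w"
  shows "consistent (insert (claim b x p q w) S)"
  unfolding consistent_def
proof (intro allI impI)
  fix b' x' p' q' w' assume "claim b' x' p' q' w' \<in> insert (claim b x p q w) S"
  then have "b' < 2 \<and> 0 < q' \<and> justified S b' x' p' q' w'"
    using assms unfolding consistent_def by auto
  then show "b' < 2 \<and> 0 < q' \<and> justified (insert (claim b x p q w) S) b' x' p' q' w'"
    using justified_mono[of S _ _ _ _ _ "insert (claim b x p q w) S"] by blast
qed

definition branch :: "nat \<Rightarrow> nat \<Rightarrow> nat \<Rightarrow> nat \<Rightarrow> nat \<Rightarrow> nat \<Rightarrow> nat \<Rightarrow> bool" where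
  "branch x p q w p' q' w' \<longleftrightarrow> p' < qbound x (p + q) \<and> q' < qbound x (p + q) \<and> w' < wbound x (p + q) \<and>
     candidate x p q w p' q' w'"

lemma justified_branch:
  assumes "5 \<le> pfst x"
  shows "justified S b x p q w \<longleftrightarrow>
    (if b = 1 then \<exists>p' q' w'. branch x p q w p' q' w' \<and> claim 1 (psnd (psnd x)) p' q' w' \<in> S
     else \<forall>p' q' w'. branch x p q w p' q' w' \<longrightarrow> claim 0 (psnd (psnd x)) p' q' w' \<in> S)"
  using assms by (auto simp: justified_def branch_def)

lemma wsat_branch:
  assumes "5 \<le> pfst x" "0 < q"
  shows "wsat (dec x) (lword p q w) \<longleftrightarrow>
    (\<exists>p' q' w'. branch x p q w p' q' w' \<and> wsat (dec (psnd (psnd x))) (lword p' q' w'))"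
  unfolding wsat_quantifier[OF assms] branch_def by blast

lemma dec_cases:
  obtains "pfst x = 0" "dec x = Less (pfst (psnd x)) (psnd (psnd x))"
  | "pfst x = 1" "dec x = Eq (pfst (psnd x)) (psnd (psnd x))"
  | "pfst x = 2" "dec x = Mem (pfst (psnd x)) (psnd (psnd x))"
  | "pfst x = 3" "dec x = Neg (dec (psnd x))"
  | "pfst x = 4" "dec x = Disj (dec (pfst (psnd x))) (dec (psnd (psnd x)))"
  | "pfst x \<ge> 5"
proof -
  consider "pfst x = 0" | "pfst x = 1" | "pfst x = 2" | "pfst x = 3" | "pfst x = 4" | "pfst x \<ge> 5"
    by linarith
  then show ?thesis by cases (use that in \<open>simp_all add: dec.simps[of x] Let_def\<close>)
qed

text \<open>Justifications refer only to smaller codes, so mutual support among claims cannot be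
  circular.\<close>

lemma consistent_sound:
  assumes "consistent S" "claim b x p q w \<in> S"
  shows "b = of_bool (wsat (dec x) (lword p q w))"
  using assms(2)
proof (induction x arbitrary: b p q w rule: less_induct)
  case (less x)
  let ?a = "pfst (psnd x)" and ?c = "psnd (psnd x)"
  have b: "b = 0 \<or> b = 1" and q: "0 < q" and just: "justified S b x p q w"
    using assms(1) less.prems unfolding consistent_def by force+
  show ?case
  proof (cases x rule: dec_cases)
    case 1
    then show ?thesis using b just by (auto simp: justified_def ev_less_iff[OF q])
  next
    case 2
    then show ?thesis using b just by (auto simp: justified_def ev_eq_iff[OF q])
  next
    case 3
    then show ?thesis using b just by (auto simp: justified_def ev_eq_iff[OF q])
  next
    case 4
    then have "1 - b = of_bool (wsat (dec (psnd x)) (lword p q w))"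
      using just by (intro less.IH sub_less) (simp_all add: justified_def)
    then show ?thesis using b 4 by (auto simp: of_bool_def split: if_splits)
  next
    case 5
    have *: "b' = of_bool (wsat (dec y) (lword p q w))" if "claim b' y p q w \<in> S" "y = ?a \<or> y = ?c" for b' y
      using that 5(1) sub_less[of x] by (intro less.IH) auto
    have "if b = 1 then claim 1 ?a p q w \<in> S \<or> claim 1 ?c p q w \<in> S else claim 0 ?a p q w \<in> S \<and> claim 0 ?c p q w \<in> S"
      using just 5(1) by (simp add: justified_def)
    moreover have "wsat (dec y) (lword p q w)" if "claim 1 y p q w \<in> S" "y = ?a \<or> y = ?c" for y
      using *[OF that] by (simp add: of_bool_def split: if_splits)
    moreover have "\<not> wsat (dec y) (lword p q w)" if "claim 0 y p q w \<in> S" "y = ?a \<or> y = ?c" for y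
      using *[OF that] by (simp add: of_bool_def split: if_splits)
    ultimately show ?thesis using b unfolding 5(2) wsat.simps by (cases "b = 1") auto
  next
    case 6
    have *: "b' = of_bool (wsat (dec ?c) (lword p' q' w'))" if "claim b' ?c p' q' w' \<in> S" for b' p' q' w'
      using that 6 sub_less[of x] by (intro less.IH) auto
    have "wsat (dec ?c) (lword p' q' w')" if "claim 1 ?c p' q' w' \<in> S" for p' q' w'
      using *[OF that] by (simp add: of_bool_def split: if_splits)
    moreover have "\<not> wsat (dec ?c) (lword p' q' w')" if "claim 0 ?c p' q' w' \<in> S" for p' q' w'
      using *[OF that] by (simp add: of_bool_def split: if_splits)
    ultimately have "wsat (dec x) (lword p q w) \<longleftrightarrow> b = 1"
      using just unfolding wsat_branch[OF 6 q] justified_branch[OF 6] by (metis (full_types))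
    then show ?thesis using b by auto
  qed
qed

lemma claims_union:
  assumes "\<And>p q w. 0 < q \<Longrightarrow> \<exists>S. finite S \<and> consistent S \<and>
    claim (of_bool (wsat (dec x) (lword p q w))) x p q w \<in> S"
  obtains S where "finite S" "consistent S" "\<And>p q w. p < m \<Longrightarrow> q < m \<Longrightarrow> w < m' \<Longrightarrow> 0 < q \<Longrightarrow>
    claim (of_bool (wsat (dec x) (lword p q w))) x p q w \<in> S"
proof -
  define F where "F p q w = (SOME S. finite S \<and> consistent S \<and>
    claim (of_bool (wsat (dec x) (lword p q w))) x p q w \<in> S)" for p q w
  have F: "finite (F p q w) \<and> consistent (F p q w) \<and>
      claim (of_bool (wsat (dec x) (lword p q w))) x p q w \<in> F p q w" if "0 < q" for p q w
    unfolding F_def by (rule someI_ex[OF assms[OF that]])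
  define S where "S = (\<Union>(p, q, w) \<in> {..<m} \<times> {0<..<m} \<times> {..<m'}. F p q w)"
  have "finite S" unfolding S_def using F by auto
  moreover have "consistent S" unfolding S_def by (rule consistent_Union) (use F in auto)
  moreover have "claim (of_bool (wsat (dec x) (lword p q w))) x p q w \<in> S"
    if "p < m" "q < m" "w < m'" "0 < q" for p q w
    using that F[of q p w] unfolding S_def by fastforce
  ultimately show ?thesis using that by blast
qed

text \<open>Each claim calls for only finitely many claims about smaller codes, since the witnesses
  are bounded; the certificate is collected by recursion on the code.\<close>

lemma consistent_complete:
  assumes "0 < q"
  shows "\<exists>S. finite S \<and> consistent S \<and> claim (of_bool (wsat (dec x) (lword p q w))) x p q w \<in> S"
  using assms
proof (induction x arbitrary: p q w rule: less_induct)
  case (less x)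
  let ?a = "pfst (psnd x)" and ?c = "psnd (psnd x)" and ?b = "of_bool (wsat (dec x) (lword p q w)) :: nat"
  have step: ?case if "finite S" "consistent S" "justified S ?b x p q w" for S
    using consistent_insert[OF that(2) _ less.prems that(3)] that(1)
    by (intro exI[of _ "insert (claim ?b x p q w) S"]) simp
  have empty: "consistent {}" by (simp add: consistent_def)
  show ?case
  proof (cases x rule: dec_cases)
    case 1
    then have "justified {} ?b x p q w" by (simp add: justified_def ev_less_iff[OF less.prems])
    then show ?thesis by (rule step[OF finite.emptyI empty])
  next
    case 2
    then have "justified {} ?b x p q w" by (simp add: justified_def ev_eq_iff[OF less.prems])
    then show ?thesis by (rule step[OF finite.emptyI empty])
  next
    case 3
    then have "justified {} ?b x p q w" by (simp add: justified_def ev_eq_iff[OF less.prems])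
    then show ?thesis by (rule step[OF finite.emptyI empty])
  next
    case 4
    have lt: "psnd x < x" using sub_less(1)[of x] 4(1) by simp
    obtain S where S: "finite S" "consistent S" "claim (of_bool (wsat (dec (psnd x)) (lword p q w))) (psnd x) p q w \<in> S"
      using less.IH[OF lt less.prems] by blast
    then have "justified S ?b x p q w" using 4 by (cases "wsat (dec (psnd x)) (lword p q w)") (simp_all add: justified_def)
    then show ?thesis by (rule step[OF S(1,2)])
  next
    case 5
    have lt: "?a < x" "?c < x" using sub_less(2,3)[of x] 5(1) by simp_all
    obtain S where S: "finite S" "consistent S" "claim (of_bool (wsat (dec ?a) (lword p q w))) ?a p q w \<in> S"
      using less.IH[OF lt(1) less.prems] by blast
    obtain S' where S': "finite S'" "consistent S'" "claim (of_bool (wsat (dec ?c) (lword p q w))) ?c p q w \<in> S'"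
      using less.IH[OF lt(2) less.prems] by blast
    have "consistent (S \<union> S')" using consistent_Union[of "{S, S'}"] S(2) S'(2) by auto
    moreover have "justified (S \<union> S') ?b x p q w"
      using 5 S(3) S'(3)
      by (cases "wsat (dec ?a) (lword p q w)"; cases "wsat (dec ?c) (lword p q w)") (simp_all add: justified_def)
    ultimately show ?thesis using step[of "S \<union> S'"] S(1) S'(1) by simp
  next
    case 6
    have lt: "?c < x" using sub_less(3)[of x] 6 by simp
    from claims_union[OF less.IH[OF lt]]
    obtain S where S: "finite S" "consistent S" "\<And>p' q' w'. p' < qbound x (p + q) \<Longrightarrow> q' < qbound x (p + q) \<Longrightarrow>
        w' < wbound x (p + q) \<Longrightarrow> 0 < q' \<Longrightarrow> claim (of_bool (wsat (dec ?c) (lword p' q' w'))) ?c p' q' w' \<in> S"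
      by blast
    have in_S: "claim (of_bool (wsat (dec ?c) (lword p' q' w'))) ?c p' q' w' \<in> S"
      if "branch x p q w p' q' w'" for p' q' w'
      using that S(3) unfolding branch_def candidate_def by blast
    have "justified S ?b x p q w"
    proof (cases "wsat (dec x) (lword p q w)")
      case True
      then obtain p' q' w' where w': "branch x p q w p' q' w'" "wsat (dec ?c) (lword p' q' w')"
        unfolding wsat_branch[OF 6 less.prems] by blast
      then have "claim 1 ?c p' q' w' \<in> S" using in_S[OF w'(1)] by simp
      then show ?thesis unfolding justified_branch[OF 6] using True w'(1) by auto
    next
      case False
      have "claim 0 ?c p' q' w' \<in> S" if "branch x p q w p' q' w'" for p' q' w'
      proof -
        have "\<not> wsat (dec ?c) (lword p' q' w')" using False that unfolding wsat_branch[OF 6 less.prems] by blast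
        then show ?thesis using in_S[OF that] by simp
      qed
      then show ?thesis unfolding justified_branch[OF 6] using False by simp
    qed
    then show ?thesis by (rule step[OF S(1,2)])
  qed
qed

text \<open>The bound \<open>t < D\<close> loses nothing, as members of \<open>set_decode D\<close>
  lie below \<open>D\<close>, and makes the check a bounded quantification.\<close>

definition consistent_code :: "nat \<Rightarrow> bool" where
  "consistent_code D \<longleftrightarrow> (\<forall>t<D. t \<in> set_decode D \<longrightarrow> pfst t < 2 \<and> 0 < pfst (psnd (psnd (psnd t))) \<and>
     justified (set_decode D) (pfst t) (pfst (psnd t)) (pfst (psnd (psnd t))) (pfst (psnd (psnd (psnd t))))
       (psnd (psnd (psnd (psnd t)))))"

lemma mem_set_decode_less:
  assumes "t \<in> set_decode D" shows "t < D"
proof -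
  have "2 ^ t \<le> D"
  proof (rule ccontr)
    assume "\<not> 2 ^ t \<le> D"
    then have "D div 2 ^ t = 0" by simp
    then show False using assms by (simp add: set_decode_def)
  qed
  then show ?thesis using less_exp[of t] by linarith
qed

lemma consistent_code_iff: "consistent_code D \<longleftrightarrow> consistent (set_decode D)"
proof
  assume c: "consistent_code D"
  show "consistent (set_decode D)"
    unfolding consistent_def
  proof (intro allI impI)
    fix b x p q w assume "claim b x p q w \<in> set_decode D"
    then show "b < 2 \<and> 0 < q \<and> justified (set_decode D) b x p q w"
      using c mem_set_decode_less[of "claim b x p q w" D] unfolding consistent_code_def
      by (auto simp: claim_def)
  qed
next
  assume c: "consistent (set_decode D)"
  show "consistent_code D"
    unfolding consistent_code_def
  proof (intro allI impI)
    fix t assume "t \<in> set_decode D"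
    moreover have "t = claim (pfst t) (pfst (psnd t)) (pfst (psnd (psnd t))) (pfst (psnd (psnd (psnd t))))
       (psnd (psnd (psnd (psnd t))))" by (simp add: claim_def)
    ultimately show "pfst t < 2 \<and> 0 < pfst (psnd (psnd (psnd t))) \<and>
     justified (set_decode D) (pfst t) (pfst (psnd t)) (pfst (psnd (psnd t))) (pfst (psnd (psnd (psnd t))))
       (psnd (psnd (psnd (psnd t))))" using c unfolding consistent_def by metis
  qed
qed

lemma computable_lasso [comp_intros]:
  "computable p \<Longrightarrow> computable q \<Longrightarrow> computable i \<Longrightarrow> computable (\<lambda>x. lasso (p x) (q x) (i x))"
  unfolding lasso_def by (intro comp_intros)

lemma computable_claim [comp_intros]:
  "computable b \<Longrightarrow> computable x \<Longrightarrow> computable p \<Longrightarrow> computable q \<Longrightarrow> computable w \<Longrightarrow>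
    computable (\<lambda>t. claim (b t) (x t) (p t) (q t) (w t))"
  unfolding claim_def by (intro comp_intros)

lemma decp_wbit [comp_intros]:
  "computable w \<Longrightarrow> computable i \<Longrightarrow> computable z \<Longrightarrow> decp (\<lambda>t. wbit (w t) (i t) (z t))"
  unfolding wbit_def by (intro comp_intros)

lemma decp_ev_eq [comp_intros]:
  assumes c: "computable p" "computable q" "computable w" "computable a" "computable b"
  shows "decp (\<lambda>t. ev_eq (p t) (q t) (w t) (a t) (b t))"
  unfolding ev_eq_def by (intro comp_intros c c[THEN computable_comp])

lemma decp_ev_less [comp_intros]:
  assumes c: "computable p" "computable q" "computable w" "computable a" "computable b"
  shows "decp (\<lambda>t. ev_less (p t) (q t) (w t) (a t) (b t))"
  unfolding ev_less_def by (intro comp_intros c c[THEN computable_comp])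

lemma decp_agree [comp_intros]:
  assumes c: "computable z0" "computable Z" "computable p" "computable q" "computable w"
    "computable p'" "computable q'" "computable w'"
  shows "decp (\<lambda>t. agree (z0 t) (Z t) (p t) (q t) (w t) (p' t) (q' t) (w' t))"
  unfolding agree_def by (intro comp_intros c c[THEN computable_comp])

lemma computable_tower [comp_intros]: "computable f \<Longrightarrow> computable (\<lambda>x. tower (f x))"
proof -
  assume f: "computable f"
  have "computable (\<lambda>x. rec_nat 8 (\<lambda>k r. 2 ^ prod_encode (r, r)) (f x))" by (intro comp_intros f)
  moreover have "rec_nat 8 (\<lambda>k r. 2 ^ prod_encode (r, r)) n = tower n" for n by (induction n) simp_all
  ultimately show ?thesis by simp
qed

lemma computable_qbound [comp_intros]: "computable x \<Longrightarrow> computable m \<Longrightarrow> computable (\<lambda>t. qbound (x t) (m t))"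
  unfolding qbound_def by (intro comp_intros)

lemma computable_wbound [comp_intros]: "computable x \<Longrightarrow> computable m \<Longrightarrow> computable (\<lambda>t. wbound (x t) (m t))"
  unfolding wbound_def by (intro comp_intros)

lemma computable_col [comp_intros]: "computable x \<Longrightarrow> computable (\<lambda>t. col (x t))"
  unfolding col_def by (intro comp_intros)

lemma decp_candidate [comp_intros]:
  assumes c: "computable x" "computable p" "computable q" "computable w"
    "computable p'" "computable q'" "computable w'"
  shows "decp (\<lambda>t. candidate (x t) (p t) (q t) (w t) (p' t) (q' t) (w' t))"
  unfolding candidate_def by (intro comp_intros c)

lemma decp_justified [comp_intros]:
  assumes c: "computable D" "computable b" "computable x" "computable p" "computable q" "computable w"
  shows "decp (\<lambda>t. justified (set_decode (D t)) (b t) (x t) (p t) (q t) (w t))"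
  unfolding justified_def by (intro comp_intros c c[THEN computable_comp])

lemma decp_consistent_code [comp_intros]:
  assumes c: "computable D"
  shows "decp (\<lambda>t. consistent_code (D t))"
  unfolding consistent_code_def by (intro comp_intros c c[THEN computable_comp])

section \<open>The synthesis algorithm\<close>

text \<open>A nonempty list is coded by the successor of a pair, so subtracting 1 and projecting
  gives the tail. The empty list has code 0 and stays there.\<close>

definition suffix :: "nat \<Rightarrow> nat \<Rightarrow> nat" where
  "suffix l k = rec_nat l (\<lambda>_ r. psnd (r - 1)) k"

definition entry :: "nat \<Rightarrow> nat \<Rightarrow> nat" where
  "entry l k = pfst (suffix l k - 1)"

lemma suffix_list_encode: "suffix (list_encode xs) k = list_encode (drop k xs)"
proof (induction k)
  case 0
  then show ?case by (simp add: suffix_def)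
next
  case (Suc k)
  have "suffix (list_encode xs) (Suc k) = psnd (list_encode (drop k xs) - 1)"
    using Suc by (simp add: suffix_def)
  also have "\<dots> = list_encode (drop (Suc k) xs)"
  proof (cases "drop k xs")
    case Nil
    moreover have "psnd 0 = 0" using psnd_le[of 0] by simp
    ultimately show ?thesis by (simp add: drop_Suc drop_tl)
  next
    case (Cons y ys)
    then show ?thesis by (simp add: drop_Suc drop_tl)
  qed
  finally show ?case .
qed

lemma list_encode_eq_0: "list_encode xs = 0 \<longleftrightarrow> xs = []" "0 < list_encode xs \<longleftrightarrow> xs \<noteq> []"
  by (cases xs; simp)+

lemma entry_list_encode: "k < length xs \<Longrightarrow> entry (list_encode xs) k = xs ! k"
  by (simp add: entry_def suffix_list_encode flip: Cons_nth_drop_Suc)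

definition slot :: "nat \<Rightarrow> bool \<Rightarrow> bool \<Rightarrow> nat" where
  "slot s a b = 4 * s + 2 * of_bool a + of_bool b"

definition trans_of :: "nat \<Rightarrow> nat \<Rightarrow> bool \<times> bool \<Rightarrow> nat" where
  "trans_of l s a = pfst (entry l (slot s (fst a) (snd a)))"

definition out_of :: "nat \<Rightarrow> nat \<Rightarrow> bool \<times> bool \<Rightarrow> bool" where
  "out_of l s a \<longleftrightarrow> psnd (entry l (slot s (fst a) (snd a))) = 1"

text \<open>Recognises tables of machines without decoding lists: all suffixes before
  \<open>4 * n\<close> are nonempty and the one at \<open>4 * n\<close> is empty, so the length is
  exactly \<open>4 * n\<close>.\<close>

definition valid :: "nat \<Rightarrow> nat \<Rightarrow> nat \<Rightarrow> bool" where
  "valid n q0 l \<longleftrightarrow> q0 < n \<and> suffix l (4 * n) = 0 \<and>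
     (\<forall>k<4 * n. suffix l k \<noteq> 0 \<and> pfst (entry l k) < n \<and> psnd (entry l k) \<le> 1)"

lemma slot_less: "s < n \<Longrightarrow> slot s a b < 4 * n"
  by (auto simp: slot_def)

lemma valid_transition_system:
  assumes "valid n q0 l" shows "transition_system {..<n} q0 (trans_of l)"
  using assms slot_less by (auto simp: valid_def transition_system_def trans_of_def)

lemma concat_rows:
  assumes "4 * n \<le> length xs"
  shows "concat (map (\<lambda>s. [xs ! (4 * s), xs ! (4 * s + 1), xs ! (4 * s + 2), xs ! (4 * s + 3)]) [0..<n]) = take (4 * n) xs"
  using assms
proof (induction n)
  case (Suc n)
  have four: "4 * Suc n = Suc (Suc (Suc (Suc (4 * n))))" by simp
  have "take (4 * Suc n) xs = take (4 * n) xs @ [xs ! (4 * n), xs ! (4 * n + 1), xs ! (4 * n + 2), xs ! (4 * n + 3)]"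
    unfolding four using Suc.prems by (simp add: take_Suc_conv_app_nth eval_nat_numeral)
  then show ?case using Suc by simp
qed simp

lemma valid_code_machine:
  assumes "valid n q0 l"
  shows "prod_encode (q0, l) = code_machine n q0 (trans_of l) (out_of l)"
proof -
  define xs where "xs = list_decode l"
  have l: "l = list_encode xs" by (simp add: xs_def)
  have v: "drop (4 * n) xs = []" "\<And>k. k < 4 * n \<Longrightarrow> drop k xs \<noteq> []"
    using assms by (simp_all add: valid_def l suffix_list_encode list_encode_eq_0)
  have "length xs \<le> 4 * n" using v(1) by simp
  moreover have "\<not> length xs < 4 * n" using v(2)[of "length xs"] by auto
  ultimately have len: "length xs = 4 * n" by simp
  have e: "prod_encode (pfst (xs ! k), of_bool (psnd (xs ! k) = 1)) = xs ! k" if "k < 4 * n" for k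
  proof -
    have "psnd (xs ! k) = 0 \<or> psnd (xs ! k) = 1"
      using assms that len by (auto simp: valid_def l entry_list_encode le_Suc_eq)
    then have "of_bool (psnd (xs ! k) = 1) = psnd (xs ! k)" by auto
    then show ?thesis by simp
  qed
  have en: "entry l k = xs ! k" if "k < 4 * n" for k using that len by (simp add: l entry_list_encode)
  have "map (\<lambda>q. map (\<lambda>a. prod_encode (trans_of l q a, of_bool (out_of l q a)))
        [(False, False), (False, True), (True, False), (True, True)]) [0..<n]
     = map (\<lambda>s. [xs ! (4 * s), xs ! (4 * s + 1), xs ! (4 * s + 2), xs ! (4 * s + 3)]) [0..<n]"
  proof (rule map_cong[OF refl])
    fix s assume "s \<in> set [0..<n]"
    then have "4 * s < 4 * n" "4 * s + 1 < 4 * n" "4 * s + 2 < 4 * n" "4 * s + 3 < 4 * n" by auto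
    note this[THEN e] this[THEN en]
    then show "map (\<lambda>a. prod_encode (trans_of l s a, of_bool (out_of l s a)))
        [(False, False), (False, True), (True, False), (True, True)]
      = [xs ! (4 * s), xs ! (4 * s + 1), xs ! (4 * s + 2), xs ! (4 * s + 3)]"
      by (simp add: trans_of_def out_of_def slot_def numeral_3_eq_3)
  qed
  then show ?thesis
    using concat_rows[of n xs] len by (simp only: code_machine_def l) simp
qed

lemma valid_exists:
  assumes "transition_system {..<n} q0 \<delta>"
  obtains l where "valid n q0 l" "\<And>s a. s < n \<Longrightarrow> trans_of l s a = \<delta> s a"
    "\<And>s a. s < n \<Longrightarrow> out_of l s a = out s a"
proof -
  define h where "h k = (2 \<le> k mod 4, odd k)" for k :: nat
  define xs where "xs = map (\<lambda>k. prod_encode (\<delta> (k div 4) (h k), of_bool (out (k div 4) (h k)))) [0..<4 * n]"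
  define l where "l = list_encode xs"
  have len: "length xs = 4 * n" by (simp add: xs_def)
  have en: "entry l k = prod_encode (\<delta> (k div 4) (h k), of_bool (out (k div 4) (h k)))" if "k < 4 * n" for k
    using that by (simp add: l_def entry_list_encode len) (simp add: xs_def)
  have q: "q0 < n" "\<And>s a. s < n \<Longrightarrow> \<delta> s a < n" using assms by (auto simp: transition_system_def)
  have "k div 4 < n" if "k < 4 * n" for k using that by (simp add: less_mult_imp_div_less mult.commute)
  then have "valid n q0 l"
    using q by (simp add: valid_def en) (simp add: l_def suffix_list_encode len list_encode_eq_0)
  moreover have "slot s a b div 4 = s \<and> (2 \<le> slot s a b mod 4 \<longleftrightarrow> a) \<and> (odd (slot s a b) \<longleftrightarrow> b)" for s a b
    by (cases a; cases b; simp only: slot_def of_bool_eq; presburger)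
  then have sl: "slot s a b div 4 = s" "h (slot s a b) = (a, b)" for s a b by (simp_all add: h_def)
  moreover have "trans_of l s a = \<delta> s a" "out_of l s a = out s a" if "s < n" for s a
    using en[OF slot_less[OF that, of "fst a" "snd a"]] by (simp_all add: trans_of_def out_of_def sl)
  ultimately show ?thesis using that by blast
qed

lemma machine_op_cong:
  assumes "transition_system {..<n} q0 \<delta>" "\<And>s a. s < n \<Longrightarrow> \<delta>' s a = \<delta> s a"
    "\<And>s a. s < n \<Longrightarrow> out' s a = out s a"
  shows "machine_op q0 \<delta>' out' = machine_op q0 \<delta> out"
proof -
  have fold: "foldl \<delta>' q0 w = foldl \<delta> q0 w \<and> foldl \<delta> q0 w < n" for w
    using assms(1,2) by (induction w rule: rev_induct) (auto simp: transition_system_def)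
  show ?thesis
    unfolding machine_op_def using fold assms(3) by simp
qed

lemma causal_machine_op: "causal (machine_op q0 \<delta> out)"
proof -
  have "map x [0..<i] = map y [0..<i]" if "\<forall>j\<le>t. x j = y j" "i \<le> t" for x y :: "nat \<Rightarrow> 'a" and i t
    using that by simp
  then show ?thesis unfolding causal_def machine_op_def by metis
qed

lemma finite_state_machine_op:
  "transition_system {..<n::nat} q0 \<delta> \<Longrightarrow> finite_state_C_operator (machine_op q0 \<delta> out)"
  unfolding finite_state_C_operator_def by (intro conjI causal_machine_op exI) auto

text \<open>Lets one argument serve both players: the machine for \<open>Y\<close> reads column 1
  and writes column 3, the machine for \<open>X\<close> the other way round.\<close>

definition mixed :: "nat \<Rightarrow> nat \<Rightarrow> nat set \<Rightarrow> nat set \<Rightarrow> nat set \<Rightarrow> nat \<Rightarrow> nat \<Rightarrow> bool" where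
  "mixed a b I J P i z \<longleftrightarrow> z = a \<and> i \<in> I \<or> z = b \<and> i \<in> J \<or> z = 5 \<and> i \<in> P"

lemma mixed_play: "mixed 1 3 X Y P = play X Y P" "mixed 3 1 Y X P = play X Y P"
  by (intro ext; auto simp: mixed_def play_def)+

definition wstate :: "nat \<Rightarrow> nat \<Rightarrow> nat \<Rightarrow> nat \<Rightarrow> nat \<Rightarrow> nat" where
  "wstate l q0 a w i = rec_nat q0 (\<lambda>k s. pfst (entry l (slot s (wbit w k a) (wbit w k 5)))) i"

text \<open>\<open>P\<close> enters the algorithm only through the three numbers \<open>pre\<close>,
  \<open>per\<close> and \<open>bits\<close>, which are constants for the computability
  rules.\<close>

locale parameter =
  fixes P :: "nat set" and pre per bits :: nat
  assumes q_pos: "0 < per" and mem_lasso: "\<And>i. i \<in> P \<longleftrightarrow> lasso pre per i \<in> P"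
    and c_def: "bits = set_encode (P \<inter> {..<pre + per})"
begin

text \<open>The lasso word is the record of a play in which the machine reads the columns \<open>a\<close> and 5 and
  writes the column \<open>b\<close>; the loop closes for the machine as well as for the parameter.\<close>

definition compatible :: "nat \<Rightarrow> nat \<Rightarrow> nat \<Rightarrow> nat \<Rightarrow> nat \<Rightarrow> nat \<Rightarrow> nat \<Rightarrow> nat \<Rightarrow> bool" where
  "compatible l q0 a b x p q w \<longleftrightarrow> 0 < q \<and> lasso pre per (p + q) = lasso pre per p \<and>
     wstate l q0 a w (p + q) = wstate l q0 a w p \<and>
     (\<forall>i<p + q. wbit w i 5 = (lasso pre per i \<in> set_decode bits) \<and>
        wbit w i b = (psnd (entry l (slot (wstate l q0 a w i) (wbit w i a) (wbit w i 5))) = 1) \<and>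
        (\<forall>z<2 * x + 6. z = 1 \<or> z = 3 \<or> z = 5 \<or> \<not> wbit w i z))"

lemma mem_code: "lasso pre per i \<in> set_decode bits \<longleftrightarrow> i \<in> P"
  using mem_lasso[of i] lasso_less[OF q_pos, of pre i] by (simp add: c_def)

definition states_of :: "nat \<Rightarrow> nat \<Rightarrow> nat set \<Rightarrow> nat \<Rightarrow> nat" where
  "states_of l q0 I i = foldl (trans_of l) q0 (map (\<lambda>n. (n \<in> I, n \<in> P)) [0..<i])"

abbreviation response :: "nat \<Rightarrow> nat \<Rightarrow> nat set \<Rightarrow> nat set" where
  "response l q0 I \<equiv> apply_op2 (machine_op q0 (trans_of l) (out_of l)) I P"

lemma states_of_simps [simp]:
  "states_of l q0 I 0 = q0"
  "states_of l q0 I (Suc i) = trans_of l (states_of l q0 I i) (i \<in> I, i \<in> P)"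
  by (simp_all add: states_of_def)

lemma mem_response: "i \<in> response l q0 I \<longleftrightarrow> out_of l (states_of l q0 I i) (i \<in> I, i \<in> P)"
  by (simp add: apply_op2_def machine_op_def states_of_def)

lemma wstate_simps [simp]:
  "wstate l q0 a w 0 = q0"
  "wstate l q0 a w (Suc i) = trans_of l (wstate l q0 a w i) (wbit w i a, wbit w i 5)"
  by (simp_all add: wstate_def trans_of_def)

lemma compatible_wsat:
  assumes "compatible l q0 a b x p q w" and ab: "a = 1 \<and> b = 3 \<or> a = 3 \<and> b = 1"
  defines "I \<equiv> {i. lword p q w i a}"
  shows "wsat (dec x) (lword p q w) \<longleftrightarrow> wsat (dec x) (mixed a b I (response l q0 I) P)"
proof (rule wsat_cong)
  have q: "0 < q" and cl: "lasso pre per (p + q) = lasso pre per p" "wstate l q0 a w (p + q) = wstate l q0 a w p"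
    and c: "\<And>i. i < p + q \<Longrightarrow> wbit w i 5 = (lasso pre per i \<in> set_decode bits)"
      "\<And>i. i < p + q \<Longrightarrow> wbit w i b = out_of l (wstate l q0 a w i) (wbit w i a, wbit w i 5)"
      "\<And>i z. i < p + q \<Longrightarrow> z < 2 * x + 6 \<Longrightarrow> z = 1 \<or> z = 3 \<or> z = 5 \<or> \<not> wbit w i z"
    using assms(1) unfolding compatible_def out_of_def by auto
  note less = lasso_less[OF q, of p]
  have P: "lword p q w i 5 \<longleftrightarrow> i \<in> P" for i
    by (simp only: lword_def c(1)[OF less] lasso_closed[OF cl(1) q] mem_code)
  \<comment> \<open>By induction along the input; on the back edge the recorded state at
    \<open>p + q\<close> is that at \<open>p\<close>.\<close>
  have s: "states_of l q0 I i = wstate l q0 a w (lasso p q i)" for i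
  proof (induction i)
    case 0
    then show ?case using q by (simp add: lasso_id)
  next
    case (Suc i)
    have "states_of l q0 I (Suc i) = wstate l q0 a w (Suc (lasso p q i))"
      using Suc P[of i] by (simp add: I_def lword_def)
    also have "\<dots> = wstate l q0 a w (lasso p q (Suc (lasso p q i)))"
    proof -
      consider "Suc (lasso p q i) < p + q" | "Suc (lasso p q i) = p + q" using less[of i] by linarith
      then show ?thesis
      proof cases
        case 1
        then show ?thesis by (simp only: lasso_id)
      next
        case 2
        have "lasso p q (p + q) = p" by (simp add: lasso_def)
        then show ?thesis using 2 cl(2) by simp
      qed
    qed
    finally show ?case by (simp only: lasso_Suc_lasso)
  qed
  have mem_I: "i \<in> I \<longleftrightarrow> wbit w (lasso p q i) a" for i by (simp add: I_def lword_def)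
  have J: "lword p q w i b \<longleftrightarrow> i \<in> response l q0 I" for i
    using c(2)[OF less, of i] P[of i] by (simp add: mem_response s mem_I lword_def)
  fix i z assume "z \<in> vars (dec x)"
  then have z: "z < 2 * x + 6" using vars_dec[of z x] by simp
  have "\<not> lword p q w i z" if "z \<noteq> 1" "z \<noteq> 3" "z \<noteq> 5"
    using c(3)[OF less[of i] z] that by (simp add: lword_def)
  then show "lword p q w i z = mixed a b I (response l q0 I) P i z"
    using P[of i] J[of i] ab by (auto simp: mixed_def I_def)
qed

text \<open>From \<open>lasso_refine\<close>: types of the formula times pairs of one of
  \<open>n\<close> machine states and a position on the lasso of \<open>P\<close>; the successor
  makes the bound strict.\<close>

definition mbound :: "nat \<Rightarrow> nat \<Rightarrow> nat" where
  "mbound x n = Suc (tower x * (n * (pre + per)))"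

definition mwbound :: "nat \<Rightarrow> nat \<Rightarrow> nat" where
  "mwbound x n = 2 ^ prod_encode (2 * mbound x n, 2 * x + 6)"

text \<open>Every play of the machine has the truth value of some small recorded play, perhaps on
  another input. Hence finitely many recorded plays decide whether the machine wins against all
  inputs.\<close>

lemma compatible_exists:
  assumes "valid n q0 l" and ab: "a = 1 \<and> b = 3 \<or> a = 3 \<and> b = 1"
  obtains p q w where "p < mbound x n" "q < mbound x n" "w < mwbound x n"
    "compatible l q0 a b x p q w"
    "wsat (dec x) (lword p q w) \<longleftrightarrow> wsat (dec x) (mixed a b I (response l q0 I) P)"
proof -
  define s where "s i = states_of l q0 I i" for i
  define V where "V = mixed a b I (response l q0 I) P"
  have ts: "transition_system {..<n} q0 (trans_of l)" using assms(1) by (rule valid_transition_system)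
  have "s i < n" for i
    by (induction i) (use ts in \<open>auto simp: s_def transition_system_def\<close>)
  then have sub: "range s \<subseteq> {..<n}" by auto
  obtain p q f where l: "0 < q" "p \<le> ty_bound (dec x) * (n * (pre + per))"
    "q \<le> ty_bound (dec x) * (n * (pre + per))" "s (f 0) = s 0"
    "\<And>i. i < p + q \<Longrightarrow> s (Suc (f i)) = s (f (lasso p q (Suc i)))"
    "\<And>i. lasso pre per (f (lasso p q i)) = lasso pre per i"
    "wsat (dec x) (\<lambda>i. V (f (lasso p q i))) \<longleftrightarrow> wsat (dec x) V"
    by (rule lasso_refine[OF q_pos finite_lessThan sub, of "dec x" pre V, unfolded card_lessThan])
      (rule that; assumption)
  note hom = l(6)
  define w where "w = word_code (p + q) (2 * x + 6) (\<lambda>i z. V (f i) z)"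
  have w: "wbit w i z \<longleftrightarrow> i < p + q \<and> z < 2 * x + 6 \<and> V (f i) z" for i z
    by (simp add: w_def wbit_word_code)
  have wa: "wbit w i a \<longleftrightarrow> f i \<in> I" and wb: "wbit w i b \<longleftrightarrow> f i \<in> response l q0 I"
    and wP: "wbit w i 5 \<longleftrightarrow> f i \<in> P" if "i < p + q" for i
    using that ab by (auto simp: w V_def mixed_def)
  have pp: "lasso p q (p + q) = p" "lasso p q p = p" using l(1) by (simp_all add: lasso_def)
  have st: "wstate l q0 a w i = s (f (lasso p q i))" if "i \<le> p + q" for i
    using that
  proof (induction i)
    case 0
    then show ?case using l(1,4) by (simp add: lasso_id s_def)
  next
    case (Suc i)
    then have i: "i < p + q" by simp
    have "wstate l q0 a w (Suc i) = s (Suc (f i))"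
      using Suc i wa[OF i] wP[OF i] by (simp add: s_def lasso_id)
    then show ?case using l(5)[OF i] by simp
  qed
  have "compatible l q0 a b x p q w"
    unfolding compatible_def
  proof (intro conjI allI impI)
    show "0 < q" by fact
    show "lasso pre per (p + q) = lasso pre per p" using hom[of "p + q"] hom[of p] pp by simp
    show "wstate l q0 a w (p + q) = wstate l q0 a w p" using st[of "p + q"] st[of p] pp by simp
    fix i assume i: "i < p + q"
    have "lasso pre per (f i) = lasso pre per i" using hom[of i] i by (simp add: lasso_id)
    then show "wbit w i 5 = (lasso pre per i \<in> set_decode bits)" using wP[OF i] mem_code[of "f i"] by simp
    have "wstate l q0 a w i = states_of l q0 I (f i)" using st[of i] i by (simp add: lasso_id s_def)
    then show "wbit w i b = (psnd (entry l (slot (wstate l q0 a w i) (wbit w i a) (wbit w i 5))) = 1)"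
      using wa[OF i] wb[OF i] wP[OF i] by (simp add: mem_response out_of_def)
    fix z assume "z < 2 * x + 6"
    show "z = 1 \<or> z = 3 \<or> z = 5 \<or> \<not> wbit w i z" using ab by (auto simp: w V_def mixed_def)
  qed
  moreover have le: "p < mbound x n" "q < mbound x n"
  proof -
    have "ty_bound (dec x) * (n * (pre + per)) \<le> tower x * (n * (pre + per))"
      using ty_bound_dec[of x] by (rule mult_le_mono1)
    then show "p < mbound x n" "q < mbound x n" using l(2,3) unfolding mbound_def by linarith+
  qed
  moreover have "w < mwbound x n"
    unfolding w_def mwbound_def by (rule word_code_less) (use le in linarith)
  moreover have "wsat (dec x) (lword p q w) \<longleftrightarrow> wsat (dec x) (\<lambda>i. V (f (lasso p q i)))"
  proof (rule wsat_cong)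
    fix i z assume "z \<in> vars (dec x)"
    then have "z < 2 * x + 6" using vars_dec[of z x] by simp
    then show "lword p q w i z = V (f (lasso p q i)) z" using lasso_less[OF l(1)] by (simp add: lword_def w)
  qed
  then have "wsat (dec x) (lword p q w) \<longleftrightarrow> wsat (dec x) V" using l(7) by simp
  ultimately show ?thesis using that unfolding V_def by blast
qed

text \<open>In the order of \<open>slot\<close>, entries 0 and 2, and likewise 1 and 3, differ only
  in the first input bit.\<close>

definition ignores_input :: "nat \<Rightarrow> nat \<Rightarrow> bool" where
  "ignores_input n l \<longleftrightarrow> (\<forall>s<n. psnd (entry l (4 * s)) = psnd (entry l (4 * s + 2)) \<and>
     psnd (entry l (4 * s + 1)) = psnd (entry l (4 * s + 3)))"

definition certifies :: "nat \<Rightarrow> nat \<Rightarrow> nat \<Rightarrow> nat \<Rightarrow> nat \<Rightarrow> nat \<Rightarrow> nat \<Rightarrow> nat \<Rightarrow> bool" where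
  "certifies D r a b x n q0 l \<longleftrightarrow> valid n q0 l \<and> consistent_code D \<and>
     (\<forall>p<mbound x n. \<forall>q<mbound x n. \<forall>w<mwbound x n. compatible l q0 a b x p q w \<longrightarrow>
        claim r x p q w \<in> set_decode D)"

definition solves :: "nat \<Rightarrow> nat \<Rightarrow> nat \<Rightarrow> nat \<Rightarrow> nat \<Rightarrow> nat \<Rightarrow> bool" where
  "solves x v n q0 l D \<longleftrightarrow> v = Suc (prod_encode (q0, l)) \<and> certifies D 1 1 3 x n q0 l \<or>
     v = 0 \<and> ignores_input n l \<and> certifies D 0 3 1 x n q0 l"

lemma certificate_exists:
  assumes "transition_system {..<n} q0 \<delta>" "a = 1 \<and> b = 3 \<or> a = 3 \<and> b = 1"
    and "\<And>I. wsat (dec x) (mixed a b I (apply_op2 (machine_op q0 \<delta> out) I P) P) \<longleftrightarrow> r"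
  obtains l D where "certifies D (of_bool r) a b x n q0 l" "\<And>s a. s < n \<Longrightarrow> out_of l s a = out s a"
proof -
  obtain l where l: "valid n q0 l" "\<And>s a. s < n \<Longrightarrow> trans_of l s a = \<delta> s a"
    "\<And>s a. s < n \<Longrightarrow> out_of l s a = out s a" by (rule valid_exists[OF assms(1), of out]) blast
  have op: "machine_op q0 (trans_of l) (out_of l) = machine_op q0 \<delta> out"
    by (rule machine_op_cong[OF assms(1) l(2,3)])
  from claims_union[OF consistent_complete]
  obtain S where S: "finite S" "consistent S" "\<And>p q w. p < mbound x n \<Longrightarrow> q < mbound x n \<Longrightarrow> w < mwbound x n \<Longrightarrow>
      0 < q \<Longrightarrow> claim (of_bool (wsat (dec x) (lword p q w))) x p q w \<in> S" by blast
  define D where "D = set_encode S"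
  have D: "set_decode D = S" using S(1) by (simp add: D_def)
  have "claim (of_bool r) x p q w \<in> set_decode D"
    if "p < mbound x n" "q < mbound x n" "w < mwbound x n" "compatible l q0 a b x p q w" for p q w
  proof -
    have "wsat (dec x) (lword p q w) = r"
      unfolding compatible_wsat[OF that(4) assms(2)] op by (rule assms(3))
    moreover have "0 < q" using that(4) by (simp add: compatible_def)
    ultimately show ?thesis using S(3)[OF that(1-3)] by (simp add: D)
  qed
  then have "certifies D (of_bool r) a b x n q0 l" using l(1) S(2) unfolding certifies_def consistent_code_iff D by blast
  then show ?thesis using that l(3) by blast
qed

lemma certificate_sound:
  assumes "certifies D (of_bool r) a b x n q0 l" "a = 1 \<and> b = 3 \<or> a = 3 \<and> b = 1"
  shows "wsat (dec x) (mixed a b I (response l q0 I) P) \<longleftrightarrow> r"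
proof -
  have "valid n q0 l" using assms(1) by (simp add: certifies_def)
  then obtain p q w where *: "p < mbound x n" "q < mbound x n" "w < mwbound x n"
    "compatible l q0 a b x p q w"
    "wsat (dec x) (lword p q w) \<longleftrightarrow> wsat (dec x) (mixed a b I (response l q0 I) P)"
    by (rule compatible_exists[OF _ assms(2), of n q0 l x I]) blast+
  have "claim (of_bool r) x p q w \<in> set_decode D" "consistent (set_decode D)"
    using assms(1) * unfolding certifies_def consistent_code_iff by auto
  then have "of_bool r = (of_bool (wsat (dec x) (lword p q w)) :: nat)" by (intro consistent_sound)
  then show ?thesis using *(5) unfolding of_bool_eq_iff by blast
qed

text \<open>Determinacy makes the search of the algorithm total: one of the players has a machine,
  and its finitely many small plays have a common certificate.\<close>

lemma solves_exists: "\<exists>v n q0 l D. solves x v n q0 l D"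
proof -
  consider (F) n q0 \<delta> out where "transition_system {..<n::nat} q0 \<delta>"
      "\<And>X. wsat (dec x) (play X (apply_op2 (machine_op q0 \<delta> out) X P) P)"
    | (G) n q0 \<delta> out where "transition_system {..<n::nat} q0 \<delta>" "\<And>q x y p. out q (x, p) = out q (y, p)"
      "\<And>Y. \<not> wsat (dec x) (play (apply_op2 (machine_op q0 \<delta> out) Y P) Y P)"
    using machine_determinacy[OF q_pos mem_lasso, of "dec x"] by blast
  then show ?thesis
  proof cases
    case F
    obtain l D where "certifies D (of_bool True) 1 3 x n q0 l"
      by (rule certificate_exists[OF F(1), of 1 3 x out True]) (use F(2) in \<open>auto simp: mixed_play[simplified]\<close>)
    then show ?thesis unfolding solves_def of_bool_eq by blast
  next
    case G
    obtain l D where l: "certifies D (of_bool False) 3 1 x n q0 l" "\<And>s a. s < n \<Longrightarrow> out_of l s a = out s a"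
      by (rule certificate_exists[OF G(1), of 3 1 x out False]) (use G(3) in \<open>auto simp: mixed_play[simplified]\<close>)
    have "ignores_input n l"
      unfolding ignores_input_def
    proof (intro allI impI)
      fix s assume s: "s < n"
      have le: "psnd (entry l (slot s a b)) \<le> 1" for a b
        using l(1) slot_less[OF s] by (auto simp: certifies_def valid_def)
      have "out_of l s (False, b) = out_of l s (True, b)" for b
        using l(2)[OF s] G(2)[of s False b True] by simp
      then have eq: "(psnd (entry l (slot s False b)) = 1) = (psnd (entry l (slot s True b)) = 1)" for b
        by (simp only: out_of_def fst_conv snd_conv)
      have "psnd (entry l (slot s False b)) = psnd (entry l (slot s True b))" for b
        using le[of False b] le[of True b] eq[of b] by linarith
      from this[of False] this[of True]
      show "psnd (entry l (4 * s)) = psnd (entry l (4 * s + 2)) \<and>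
          psnd (entry l (4 * s + 1)) = psnd (entry l (4 * s + 3))"
        by (simp add: slot_def numeral_3_eq_3)
    qed
    then show ?thesis using l(1) unfolding solves_def of_bool_eq by blast
  qed
qed

lemma solves_Suc:
  assumes "solves x v n q0 l D" "v \<noteq> 0"
  shows "v = Suc (prod_encode (q0, l))" "valid n q0 l" "wsat (dec x) (play X (response l q0 X) P)"
  using assms certificate_sound[of D True 1 3 x n q0 l X] unfolding solves_def certifies_def mixed_play
  by auto

lemma solves_0:
  assumes "solves x 0 n q0 l D"
  shows "ignores_input n l" "valid n q0 l" "\<not> wsat (dec x) (play (response l q0 Y) Y P)"
  using assms certificate_sound[of D False 3 1 x n q0 l Y] unfolding solves_def certifies_def mixed_play
  by auto

text \<open>A machine that ignores its present input letter can be played against any machine.\<close>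

lemma mutual_play:
  assumes "ignores_input n l" "valid n q0 l"
  obtains X Y where "Y = apply_op2 (machine_op q \<delta> out) X P" "X = response l q0 Y"
proof -
  \<comment> \<open>The bit \<open>False\<close> stands in for the input not yet known; the output
    ignores it. So \<open>X\<close> can be computed first at each moment and fed to the other
    machine.\<close>
  define x where "x g t = out_of l g (False, t \<in> P)" for g t
  define st where "st t = rec_nat (q0, q) (\<lambda>t (g, f).
     (trans_of l g (out f (x g t, t \<in> P), t \<in> P), \<delta> f (x g t, t \<in> P))) t" for t
  define X where "X = {t. x (fst (st t)) t}"
  define Y where "Y = {t. out (snd (st t)) (t \<in> X, t \<in> P)}"
  have ts: "transition_system {..<n} q0 (trans_of l)" using assms(2) by (rule valid_transition_system)
  have st: "fst (st t) = states_of l q0 Y t \<and> snd (st t) = foldl \<delta> q (map (\<lambda>n. (n \<in> X, n \<in> P)) [0..<t])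
      \<and> states_of l q0 Y t < n" for t
  proof (induction t)
    case 0
    then show ?case using assms(2) by (simp add: st_def valid_def)
  next
    case (Suc t)
    have "st (Suc t) = (trans_of l (fst (st t)) (t \<in> Y, t \<in> P), \<delta> (snd (st t)) (t \<in> X, t \<in> P))"
      by (simp add: st_def X_def Y_def case_prod_beta)
    then show ?case using Suc ts by (simp add: transition_system_def)
  qed
  have "Y = apply_op2 (machine_op q \<delta> out) X P"
    using st by (auto simp: apply_op2_def machine_op_def Y_def)
  moreover have "X = response l q0 Y"
  proof (intro set_eqI)
    fix t
    have ig: "out_of l s (False, b) = out_of l s (a, b)" if "s < n" for s a b
      using assms(1) that by (cases a; cases b; simp add: ignores_input_def out_of_def slot_def numeral_3_eq_3)
    show "t \<in> X \<longleftrightarrow> t \<in> response l q0 Y"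
      unfolding mem_response using st[of t] ig[of "states_of l q0 Y t" "t \<in> P" "t \<in> Y"] by (simp add: X_def x_def)
  qed
  ultimately show ?thesis by (rule that)
qed

lemma computable_entry [comp_intros]:
  assumes c: "computable l" "computable k"
  shows "computable (\<lambda>t. entry (l t) (k t))"
  unfolding entry_def suffix_def by (intro comp_intros c)

lemma decp_solves:
  assumes c: "computable x" "computable v" "computable n" "computable q0" "computable l" "computable D"
  shows "decp (\<lambda>t. solves (x t) (v t) (n t) (q0 t) (l t) (D t))"
  unfolding solves_def certifies_def valid_def ignores_input_def mbound_def mwbound_def compatible_def wstate_def slot_def suffix_def
  by (intro comp_intros c c[THEN computable_comp])

lemma problem4: "problem4_computable P"
proof -
  define R where "R e x = solves x (pfst e) (pfst (psnd e)) (pfst (psnd (psnd e)))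
    (pfst (psnd (psnd (psnd e)))) (psnd (psnd (psnd (psnd e))))" for e x
  define h where "h x = (LEAST e. R e x)" for x
  have ex: "\<exists>e. R e x" for x
  proof -
    obtain v n q0 l D where "solves x v n q0 l D" using solves_exists by blast
    then show ?thesis
      by (intro exI[of _ "prod_encode (v, prod_encode (n, prod_encode (q0, prod_encode (l, D))))"]) (simp add: R_def)
  qed
  have "decp (\<lambda>z. R (pfst z) (psnd z))" unfolding R_def by (intro decp_solves comp_intros)
  then have "computable h" unfolding h_def using ex by (rule computable_Least)
  then have comp: "computable (\<lambda>x. pfst (h x))" by (intro comp_intros) 
  have R: "R (h x) x" for x unfolding h_def using ex[of x] by (rule LeastI_ex)
  show ?thesis
    unfolding problem4_computable_def
  proof (intro exI[of _ "\<lambda>x. pfst (h x)"] conjI comp allI impI)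
    fix \<psi> assume \<psi>: "formula_XYP \<psi>"
    define x where "x = code_mlo \<psi>"
    have holds: "holds_XYP \<psi> X Y P \<longleftrightarrow> wsat (dec x) (play X Y P)" for X Y
      using holds_XYP_iff[OF \<psi>] by (simp add: x_def dec_code_mlo)
    let ?F = "\<exists>F. finite_state_C_operator F \<and> (\<forall>X. holds_XYP \<psi> X (apply_op2 F X P) P)"
    obtain n q0 l D where s: "solves x (pfst (h x)) n q0 l D" using R[of x] unfolding R_def by blast
    show "if ?F
      then \<exists>n q0 \<delta> out. pfst (h (code_mlo \<psi>)) = Suc (code_machine n q0 \<delta> out) \<and>
             transition_system {..<n} q0 \<delta> \<and>
             (\<forall>X. holds_XYP \<psi> X (apply_op2 (machine_op q0 \<delta> out) X P) P)
      else pfst (h (code_mlo \<psi>)) = 0"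
    proof (cases "pfst (h x) = 0")
      \<comment> \<open>An answer 0 comes with a machine for \<open>X\<close>. Played against any
        machine for \<open>Y\<close>, it yields one pair of sets on which the formula would have to
        be both true and false.\<close>
      case True
      have "\<not> ?F"
      proof
        assume ?F
        then obtain q \<delta> out where F: "\<And>X. holds_XYP \<psi> X (apply_op2 (machine_op (q::nat) \<delta> out) X P) P"
          unfolding finite_state_C_operator_def by blast
        note s0 = solves_0[OF s[unfolded True]]
        obtain X Y where "Y = apply_op2 (machine_op q \<delta> out) X P" "X = response l q0 Y"
          by (rule mutual_play[OF s0(1,2)])
        then show False using F[of X] s0(3)[of Y] holds by auto
      qed
      then show ?thesis using True by (simp add: x_def)
    next
      case False
      note sS = solves_Suc[OF s False]
      have ts: "transition_system {..<n} q0 (trans_of l)" by (rule valid_transition_system[OF sS(2)])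
      have win: "\<forall>X. holds_XYP \<psi> X (response l q0 X) P" using sS(3) holds by blast
      then have ?F using finite_state_machine_op[OF ts] by blast
      moreover have "pfst (h (code_mlo \<psi>)) = Suc (code_machine n q0 (trans_of l) (out_of l))"
        using sS(1) valid_code_machine[OF sS(2)] by (simp add: x_def)
      ultimately show ?thesis using ts win by auto
    qed
  qed
qed

end

section \<open>Equivalence of the conditions\<close>

definition And :: "mlo \<Rightarrow> mlo \<Rightarrow> mlo" where
  "And \<phi> \<psi> = Neg (Disj (Neg \<phi>) (Neg \<psi>))"

text \<open>The first conjunct makes variable 1 the successor of variable 0. In
  \<open>Mem 1 2\<close> the number 2 names the set variable \<open>P\<close>, in
  \<open>Ex1 2\<close> a first-order variable.\<close>

definition next_formula :: "nat \<Rightarrow> mlo" where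
  "next_formula V = Neg (Ex1 0 (Ex1 1
     (And (And (Less 0 1) (Neg (Ex1 2 (And (Less 0 2) (Less 2 1)))))
       (Disj (And (Mem 0 V) (Neg (Mem 1 2))) (And (Neg (Mem 0 V)) (Mem 1 2))))))"

lemma sat_next_formula: "sat e E (next_formula V) \<longleftrightarrow> (\<forall>n. n \<in> E V \<longleftrightarrow> Suc n \<in> E 2)"
proof -
  have succ: "n < m \<and> \<not> (\<exists>k. n < k \<and> k < m) \<longleftrightarrow> m = Suc n" for n m :: nat
    by (metis Suc_lessI lessI not_less_eq)
  have "sat e E (next_formula V) \<longleftrightarrow>
      (\<forall>n m. n < m \<and> \<not> (\<exists>k. n < k \<and> k < m) \<longrightarrow> (n \<in> E V \<longleftrightarrow> m \<in> E 2))"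
    by (auto simp: next_formula_def And_def)
  then show ?thesis unfolding succ by simp
qed

lemma next_formula_free: "free1 (next_formula V) = {}" "free2 (next_formula V) = {V, 2}"
  by (auto simp: next_formula_def And_def)

text \<open>A machine that reads \<open>P\<close> and announces the next bit of \<open>P\<close> determines its own
  further run from its present state and input letter.\<close>

lemma ultimately_periodic_if_predictable:
  assumes "transition_system Q q0 \<delta>" "\<And>i. machine_op q0 \<delta> out (\<lambda>n. h (n \<in> P)) i \<longleftrightarrow> Suc i \<in> P"
  shows "ultimately_periodic P"
proof -
  define s where "s i = foldl \<delta> q0 (map (\<lambda>n. h (n \<in> P)) [0..<i])" for i
  define c where "c i = (s i, i \<in> P)" for i
  have s_Suc: "s (Suc i) = \<delta> (s i) (h (i \<in> P))" for i by (simp add: s_def)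
  have P_Suc: "Suc i \<in> P \<longleftrightarrow> out (s i) (h (i \<in> P))" for i
    using assms(2)[of i] by (simp add: machine_op_def s_def)
  have "s i \<in> Q" for i
    by (induction i) (use assms(1) s_Suc in \<open>auto simp: transition_system_def s_def[of 0]\<close>)
  then have "range c \<subseteq> Q \<times> UNIV" by (auto simp: c_def)
  moreover have "finite (Q \<times> (UNIV :: bool set))" using assms(1) by (simp add: transition_system_def)
  ultimately have "finite (range c)" by (rule finite_subset)
  then have "\<not> inj c" using finite_imageD[of c UNIV] by auto
  then obtain i j where "c i = c j" "i \<noteq> j" unfolding inj_def by blast
  then obtain i j where ij: "c i = c j" "i < j" by (metis linorder_neqE_nat)
  have run: "c (i + k) = c (j + k)" for k
  proof (induction k)
    case (Suc k)
    then have "s (i + k) = s (j + k)" "(i + k \<in> P) = (j + k \<in> P)" by (simp_all add: c_def)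
    then show ?case by (simp add: c_def s_Suc P_Suc)
  qed (simp add: ij(1))
  have "n \<in> P \<longleftrightarrow> n + (j - i) \<in> P" if "n > i" for n
  proof -
    have "i + (n - i) = n" "j + (n - i) = n + (j - i)" using that ij(2) by auto
    then show ?thesis using run[of "n - i"] by (simp add: c_def)
  qed
  moreover have "0 < j - i" using ij(2) by simp
  ultimately show ?thesis unfolding ultimately_periodic_def by blast
qed

lemma ultimately_periodic_if_selection:
  assumes "selection_condition P"
  shows "ultimately_periodic P"
proof -
  let ?\<alpha> = "next_formula 0"
  have "formula_XP ?\<alpha>" by (simp add: formula_XP_def next_formula_free)
  moreover have holds: "holds_XP ?\<alpha> X P \<longleftrightarrow> (\<forall>n. n \<in> X \<longleftrightarrow> Suc n \<in> P)" for X
    by (simp add: holds_XP_def sat_next_formula)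
  then have "holds_XP ?\<alpha> {n. Suc n \<in> P} P" by simp
  ultimately obtain H where H: "finite_state_C_operator H" "holds_XP ?\<alpha> (apply_op1 H P) P"
    using assms unfolding selection_condition_def by blast
  then obtain Q :: "nat set" and q0 \<delta> out where m: "transition_system Q q0 \<delta>" "H = machine_op q0 \<delta> out"
    unfolding finite_state_C_operator_def by blast
  show ?thesis
    by (rule ultimately_periodic_if_predictable[OF m(1), of out "\<lambda>b. b"])
      (use H(2)[unfolded holds] m(2) in \<open>simp add: apply_op1_def\<close>)
qed

lemma ultimately_periodic_if_determinacy:
  assumes "finite_state_determinacy P"
  shows "ultimately_periodic P"
proof -
  let ?\<psi> = "next_formula 1"
  have "formula_XYP ?\<psi>" by (simp add: formula_XYP_def next_formula_free)
  have holds: "holds_XYP ?\<psi> X Y P \<longleftrightarrow> (\<forall>n. n \<in> Y \<longleftrightarrow> Suc n \<in> P)" for X Y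
    by (simp add: holds_XYP_def sat_next_formula)
  \<comment> \<open>The formula does not mention \<open>X\<close>, so choosing \<open>Y\<close> as
    the true shift of \<open>P\<close> defeats every \<open>G\<close>.\<close>
  have "\<not> (\<exists>G. finite_state_C_operator G \<and> (\<forall>Y. \<not> holds_XYP ?\<psi> (apply_op2 G Y P) Y P))"
    using holds[of _ "{n. Suc n \<in> P}"] by auto
  then obtain F where F: "finite_state_C_operator F" "\<And>X. holds_XYP ?\<psi> X (apply_op2 F X P) P"
    using assms \<open>formula_XYP ?\<psi>\<close> unfolding finite_state_determinacy_def by blast
  then obtain Q :: "nat set" and q0 \<delta> out where m: "transition_system Q q0 \<delta>" "F = machine_op q0 \<delta> out"
    unfolding finite_state_C_operator_def by blast
  show ?thesis
    by (rule ultimately_periodic_if_predictable[OF m(1), of out "\<lambda>b. (False, b)"])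
      \<comment> \<open>With \<open>X\<close> fixed to the empty set the machine reads nothing but
        \<open>P\<close>.\<close>
      (use F(2)[of "{}", unfolded holds] m(2) in \<open>simp add: apply_op2_def\<close>)
qed

context parameter
begin

lemma determinacy: "finite_state_determinacy P"
  unfolding finite_state_determinacy_def
proof (intro allI impI)
  fix \<psi> assume "formula_XYP \<psi>"
  note holds = holds_XYP_iff[OF this]
  from machine_determinacy[OF q_pos mem_lasso, of \<psi>]
  show "(\<exists>F. finite_state_C_operator F \<and> (\<forall>X. holds_XYP \<psi> X (apply_op2 F X P) P)) \<or>
     (\<exists>G. finite_state_C_operator G \<and> (\<forall>Y. \<not> holds_XYP \<psi> (apply_op2 G Y P) Y P))"
    unfolding holds using finite_state_machine_op by blast
qed

text \<open>A lasso word that projects onto the lasso of \<open>P\<close> reproduces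
  \<open>P\<close> and carries an ultimately periodic witness for \<open>X\<close>. A clock running
  along that lasso outputs the witness without reading its input.\<close>

lemma selection: "selection_condition P"
  unfolding selection_condition_def
proof (intro allI impI)
  fix \<alpha> assume "formula_XP \<alpha>" "\<exists>X. holds_XP \<alpha> X P"
  note holds = holds_XP_iff[OF \<open>formula_XP \<alpha>\<close>]
  obtain X where X: "wsat \<alpha> (play X {} P)" using \<open>\<exists>X. holds_XP \<alpha> X P\<close> by (auto simp: holds)
  obtain p q f where l: "0 < q" "\<And>i. lasso pre per (f (lasso p q i)) = lasso pre per i"
    "wsat \<alpha> (\<lambda>i. play X {} P (f (lasso p q i)))"
    by (rule lasso_refine[OF q_pos, of "{()}" "\<lambda>_. ()" \<alpha> pre "play X {} P"]) (use X in auto)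
  have P: "f (lasso p q i) \<in> P \<longleftrightarrow> i \<in> P" for i using mem_lasso l(2) by metis
  define \<delta> where "\<delta> s b = lasso p q (Suc s)" for s and b :: bool
  define out where "out s b \<longleftrightarrow> f s \<in> X" for s and b :: bool
  have ts: "transition_system {..<p + q} 0 \<delta>"
    using l(1) lasso_less by (simp add: transition_system_def \<delta>_def)
  have "foldl \<delta> 0 (map x [0..<i]) = lasso p q i" for x i
  proof (induction i)
    case 0
    then show ?case using l(1) by (simp add: lasso_id)
  next
    case (Suc i)
    then show ?case by (simp add: \<delta>_def lasso_Suc_lasso)
  qed
  then have "apply_op1 (machine_op 0 \<delta> out) P = {i. f (lasso p q i) \<in> X}"
    by (simp add: apply_op1_def machine_op_def out_def)
  moreover have "(\<lambda>i. play X {} P (f (lasso p q i))) = play {i. f (lasso p q i) \<in> X} {} P"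
    by (intro ext) (simp add: play_def P)
  ultimately have "holds_XP \<alpha> (apply_op1 (machine_op 0 \<delta> out) P) P" using l(3) by (simp add: holds)
  then show "\<exists>H. finite_state_C_operator H \<and> holds_XP \<alpha> (apply_op1 H P) P"
    using finite_state_machine_op[OF ts] by blast
qed

end

theorem theorem5p1:
  fixes P :: "nat set"
  shows "(ultimately_periodic P \<longleftrightarrow> finite_state_determinacy P) \<and>
         (finite_state_determinacy P \<longleftrightarrow> selection_condition P) \<and>
         (ultimately_periodic P \<longrightarrow> problem4_computable P)"
proof -
  have "finite_state_determinacy P \<and> selection_condition P \<and> problem4_computable P"
    if "ultimately_periodic P"
  proof -
    obtain p q where pq: "0 < q" "\<And>i. i \<in> P \<longleftrightarrow> lasso p q i \<in> P"
      by (rule ultimately_periodic_lasso[OF \<open>ultimately_periodic P\<close>]) blast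
    interpret parameter P p q "set_encode (P \<inter> {..<p + q})"
      by unfold_locales (use pq in auto)
    show ?thesis using determinacy selection problem4 by blast
  qed
  then show ?thesis
    using ultimately_periodic_if_determinacy ultimately_periodic_if_selection by blast
qed

end
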